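(* Let $N\ge2$ be fixed. For $\beta\ge1$ let $\lambda_1^{(\beta)}(t)\le\cdots\le\lambda_N^{(\beta)}(t)$ be the unique strong solution of $$d\lambda_i(t)=\sqrt{\tfrac{2}{\beta}}\,db_i(t)+\sum_{j:\,j\ne i}\frac{1}{\lambda_i(t)-\lambda_j(t)}\,dt,\qquad \lambda_i(0)=0,\quad i=1,\dots,N,$$ with $\lambda_1(t)\le\cdots\le\lambda_N(t)$ almost surely, where $b_1,\dots,b_N$ are independent standard Brownian motions. Let $\mu_t^{(\beta)}=\frac1N\sum_{i=1}^N\delta_{\lambda_i^{(\beta)}(t)}$ and $\mu_t=\frac1N\sum_{i=1}^N\delta_{\sqrt t\,z_{i,N}^{(H)}}$, where $z_{1,N}^{(H)}<\dots<z_{N,N}^{(H)}$ are the zeros of the $N$th probabilist's Hermite polynomial. Let $q_0,\dots,q_{N-1}$ be the polynomials $$q_0=1,\quad q_1=x,\quad q_{n+1}=xq_n-(N-n)q_{n-1}\quad(n=1,\dots,N-2),$$ let $Q_n$ be the primitive of $q_n$ with zero constant term, and let $\widetilde Q_n(t,x)=t^{(n+1)/2}Q_n(x/\sqrt t)$, which is a polynomial in $t$ and $x$. Then, as $\beta\to\infty$, the random processes $$\Big\{\sqrt{\beta N/2}\,\big(\langle\mu_t^{(\beta)},\widetilde Q_n\rangle-\langle\mu_t,\widetilde Q_n\rangle\big)\Big\}_{n=0}^{N-1}$$ converge jointly in distribution to independent centered Gaussian processes $\{\widetilde\eta_n(t)\}_{n=0}^{N-1}$ with covariance $$\mathbb E[\widetilde\eta_m(s)\widetilde\eta_n(t)]=\delta_{mn}\,\frac{\langle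 q_n,q_n\rangle_{\mu^*}}{n+1}\,(s\wedge t)^{n+1}.$$
   Context: $\langle\mu,f\rangle=\int f(t,x)\,d\mu(x)$ (integration over $x$). $\mu^*=\mu_1=\frac1N\sum_{i=1}^N\delta_{z_{i,N}^{(H)}}$ and $\langle f,g\rangle_{\mu^*}=\int fg\,d\mu^*$. The polynomials $q_0,\dots,q_{N-1}$ are orthogonal with respect to $\mu^*$, with $\langle q_m,q_n\rangle_{\mu^*}=\delta_{mn}\prod_{i=1}^n(N-i)$. $\delta_{mn}$ is the Kronecker delta and $s\wedge t=\min(s,t)$. The probabilist's Hermite polynomials are $H_0=1$, $H_1=x$, $H_{n+1}=xH_n-nH_{n-1}$. The processes are regarded as random elements of $C([0,T])$ (with the uniform norm) for arbitrary fixed $T>0$, and joint convergence in distribution is that of the corresponding $C([0,T])^N$-valued random elements. It is known that the SDEs have a unique strong solution. *)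

theory Defs
  imports "HOL-Probability.Probability" "HOL-Computational_Algebra.Polynomial"
begin

section \<open>Stochastic processes\<close>

text \<open>Processes have type \<^typ>\<open>real \<Rightarrow> 'a \<Rightarrow> real\<close>; only times \<open>t \<ge> 0\<close> are meaningful.\<close>

definition brownian_motion :: "'a measure \<Rightarrow> (real \<Rightarrow> 'a \<Rightarrow> real) \<Rightarrow> bool" where
  "brownian_motion M B \<longleftrightarrow>
     (\<forall>t\<ge>0. B t \<in> borel_measurable M) \<and>
     (AE \<omega> in M. B 0 \<omega> = 0) \<and>
     (AE \<omega> in M. continuous_on {0..} (\<lambda>t. B t \<omega>)) \<and>
     (\<forall>s t. 0 \<le> s \<longrightarrow> s < t \<longrightarrow>
        distributed M lborel (\<lambda>\<omega>. B t \<omega> - B s \<omega>) (normal_density 0 (sqrt (t - s)))) \<and>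
     (\<forall>(t :: nat \<Rightarrow> real) n. 0 \<le> t 0 \<longrightarrow> incseq t \<longrightarrow>
        prob_space.indep_vars M (\<lambda>_. borel) (\<lambda>k \<omega>. B (t (Suc k)) \<omega> - B (t k) \<omega>) {..<n})"

text \<open>Independence of processes, i.e. of the sigma-algebras generated by their whole paths.\<close>

definition indep_processes :: "'a measure \<Rightarrow> (nat \<Rightarrow> real \<Rightarrow> 'a \<Rightarrow> real) \<Rightarrow> nat set \<Rightarrow> bool" where
  "indep_processes M X I \<longleftrightarrow>
     prob_space.indep_vars M (\<lambda>_. PiM {0..} (\<lambda>_. borel)) (\<lambda>i \<omega>. \<lambda>t\<in>{0..}. X i t \<omega>) I"

text \<open>The variance may vanish: point masses count as Gaussian.\<close>

definition gaussian_rv :: "'a measure \<Rightarrow> ('a \<Rightarrow> real) \<Rightarrow> bool" where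
  "gaussian_rv M X \<longleftrightarrow>
     X \<in> borel_measurable M \<and>
     (\<exists>m \<sigma>. 0 \<le> \<sigma> \<and>
        distr M borel X = (if \<sigma> = 0 then return borel m else density lborel (normal_density m \<sigma>)))"

definition centered_gaussian_process :: "'a measure \<Rightarrow> (real \<Rightarrow> 'a \<Rightarrow> real) \<Rightarrow> bool" where
  "centered_gaussian_process M X \<longleftrightarrow>
     (\<forall>J c. finite J \<longrightarrow> J \<subseteq> {0..} \<longrightarrow> gaussian_rv M (\<lambda>\<omega>. \<Sum>t\<in>J. c t * X t \<omega>)) \<and>
     (\<forall>t\<ge>0. (\<integral>\<omega>. X t \<omega> \<partial>M) = 0)"


section \<open>Convergence in distribution in \<open>C([0,T])\<close>\<close>

text \<open>\<^const>\<open>cfunspace\<close> carries the uniform metric; its elements are functions that are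
  extensional on \<open>{0..T}\<close>. For finitely many factors the product topology is the one of the
  maximum of the uniform distances.\<close>

definition path_space :: "real \<Rightarrow> nat \<Rightarrow> (nat \<Rightarrow> real \<Rightarrow> real) topology" where
  "path_space T N =
     product_topology (\<lambda>_. mtopology_of (cfunspace (top_of_set {0..T}) euclidean_metric)) {..<N}"

definition paths :: "real \<Rightarrow> nat \<Rightarrow> (nat \<Rightarrow> real \<Rightarrow> 'a \<Rightarrow> real) \<Rightarrow> 'a \<Rightarrow> nat \<Rightarrow> real \<Rightarrow> real" where
  "paths T N X \<omega> = (\<lambda>n\<in>{..<N}. \<lambda>t\<in>{0..T}. X n t \<omega>)"

definition random_element :: "'a measure \<Rightarrow> 'b topology \<Rightarrow> ('a \<Rightarrow> 'b) \<Rightarrow> bool" where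
  "random_element M S X \<longleftrightarrow> X \<in> measurable M (sigma (topspace S) {U. openin S U})"

definition converges_in_distribution ::
    "'b topology \<Rightarrow> 'a measure \<Rightarrow> ('i \<Rightarrow> 'a \<Rightarrow> 'b) \<Rightarrow> 'c measure \<Rightarrow> ('c \<Rightarrow> 'b) \<Rightarrow> 'i filter \<Rightarrow> bool" where
  "converges_in_distribution S M X P Y F \<longleftrightarrow>
     (\<forall>\<^sub>F i in F. random_element M S (X i)) \<and> random_element P S Y \<and>
     (\<forall>f :: 'b \<Rightarrow> real. continuous_map S euclideanreal f \<longrightarrow> bounded (f ` topspace S) \<longrightarrow>
        ((\<lambda>i. \<integral>\<omega>. f (X i \<omega>) \<partial>M) \<longlongrightarrow> (\<integral>\<omega>. f (Y \<omega>) \<partial>P)) F)"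


section \<open>The stochastic differential equation\<close>

text \<open>The filtration generated by the driving processes, augmented by the null sets.\<close>

definition augmented_filtration ::
    "'a measure \<Rightarrow> nat \<Rightarrow> (nat \<Rightarrow> real \<Rightarrow> 'a \<Rightarrow> real) \<Rightarrow> real \<Rightarrow> 'a measure" where
  "augmented_filtration M N b t =
     sigma (space M)
       ({b i s -` A \<inter> space M | i s A. i \<in> {1..N} \<and> 0 \<le> s \<and> s \<le> t \<and> A \<in> sets borel} \<union> null_sets M)"

definition drift :: "nat \<Rightarrow> (nat \<Rightarrow> real) \<Rightarrow> nat \<Rightarrow> real" where
  "drift N x i = (\<Sum>j\<in>{1..N} - {i}. 1 / (x i - x j))"

text \<open>The noise is additive, so the equation is an integral equation for the paths. The drift
  is only meaningful at points with distinct coordinates (\<open>1 / 0 = 0\<close> in HOL), hence the demand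
  that for almost all times the coordinates be distinct.\<close>

definition strong_solution ::
    "'a measure \<Rightarrow> nat \<Rightarrow> real \<Rightarrow> (nat \<Rightarrow> real \<Rightarrow> 'a \<Rightarrow> real) \<Rightarrow> (nat \<Rightarrow> real \<Rightarrow> 'a \<Rightarrow> real) \<Rightarrow> bool" where
  "strong_solution M N \<beta> b X \<longleftrightarrow>
     (\<forall>i\<in>{1..N}. \<forall>t\<ge>0. X i t \<in> borel_measurable (augmented_filtration M N b t)) \<and>
     (\<forall>i\<in>{1..N}. \<forall>\<omega>\<in>space M. continuous_on {0..} (\<lambda>t. X i t \<omega>)) \<and>
     (AE \<omega> in M. \<forall>i\<in>{1..N}. X i 0 \<omega> = 0) \<and>
     (AE \<omega> in M. AE s in lborel. 0 < s \<longrightarrow> inj_on (\<lambda>i. X i s \<omega>) {1..N}) \<and>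
     (AE \<omega> in M. \<forall>i\<in>{1..N}. \<forall>t\<ge>0.
        set_integrable lborel {0..t} (\<lambda>s. drift N (\<lambda>j. X j s \<omega>) i) \<and>
        X i t \<omega> = X i 0 \<omega> + sqrt (2 / \<beta>) * (b i t \<omega> - b i 0 \<omega>)
                   + (LBINT s:{0..t}. drift N (\<lambda>j. X j s \<omega>) i))"


section \<open>Empirical measures and Hermite zeros\<close>

definition empirical_measure :: "nat \<Rightarrow> (nat \<Rightarrow> real) \<Rightarrow> real measure" where
  "empirical_measure N x = distr (uniform_count_measure {1..N}) borel x"

lemma integral_empirical_measure:
  fixes f :: "real \<Rightarrow> real"
  assumes "f \<in> borel_measurable borel"
  shows "(\<integral>x. f x \<partial>empirical_measure N x') = (\<Sum>i = 1..N. f (x' i)) / N"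
proof -
  have "(\<integral>x. f x \<partial>empirical_measure N x') = (\<integral>i. f (x' i) \<partial>uniform_count_measure {1..N})"
    unfolding empirical_measure_def
    by (rule integral_distr[OF _ assms]) (simp add: measurable_def sets_uniform_count_measure space_uniform_count_measure)
  then show ?thesis
    by (simp add: integral_uniform_count_measure)
qed

fun hermite :: "nat \<Rightarrow> real poly" where
  "hermite 0 = 1"
| "hermite (Suc 0) = [:0, 1:]"
| "hermite (Suc (Suc n)) = [:0, 1:] * hermite (Suc n) - smult (real (Suc n)) (hermite n)"

text \<open>The \<open>i\<close>-th smallest zero of \<open>hermite N\<close>, for \<open>1 \<le> i \<le> N\<close>.\<close>

definition hermite_zero :: "nat \<Rightarrow> nat \<Rightarrow> real" where
  "hermite_zero N i = sorted_list_of_set {x. poly (hermite N) x = 0} ! (i - 1)"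

definition limit_measure :: "nat \<Rightarrow> real \<Rightarrow> real measure" where
  "limit_measure N t = empirical_measure N (\<lambda>i. sqrt t * hermite_zero N i)"


section \<open>The dual polynomials\<close>

fun q_poly :: "nat \<Rightarrow> nat \<Rightarrow> real poly" where
  "q_poly N 0 = 1"
| "q_poly N (Suc 0) = [:0, 1:]"
| "q_poly N (Suc (Suc n)) =
     [:0, 1:] * q_poly N (Suc n) - smult (real N - real (Suc n)) (q_poly N n)"

definition poly_primitive :: "real poly \<Rightarrow> real poly" where
  "poly_primitive p = (\<Sum>k\<le>degree p. monom (coeff p k / real (Suc k)) (Suc k))"

lemma coeff_poly_primitive_0 [simp]: "coeff (poly_primitive p) 0 = 0"
  by (simp add: poly_primitive_def coeff_sum)

lemma coeff_poly_primitive_Suc [simp]: "coeff (poly_primitive p) (Suc k) = coeff p k / real (Suc k)"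
proof -
  have "coeff (poly_primitive p) (Suc k) = (\<Sum>j\<le>degree p. if j = k then coeff p k / real (Suc k) else 0)"
    unfolding poly_primitive_def coeff_sum by (intro sum.cong) auto
  also have "\<dots> = coeff p k / real (Suc k)"
    by (simp add: coeff_eq_0)
  finally show ?thesis .
qed

lemma pderiv_poly_primitive: "pderiv (poly_primitive p) = p"
  by (rule poly_eqI) (simp add: coeff_pderiv)

definition Q_poly :: "nat \<Rightarrow> nat \<Rightarrow> real poly" where
  "Q_poly N n = poly_primitive (q_poly N n)"

text \<open>\<open>Q_poly N n\<close> has degree \<open>n + 1\<close> and only contains powers \<open>x ^ k\<close> with \<open>n + 1 - k\<close> even,
  so \<open>t powr ((n + 1) / 2) * Q (x / sqrt t)\<close> is the following polynomial in \<open>t\<close> and \<open>x\<close>. At \<open>t = 0\<close>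
  only the polynomial form has the right value.\<close>

definition Qt_poly :: "nat \<Rightarrow> nat \<Rightarrow> real \<Rightarrow> real \<Rightarrow> real" where
  "Qt_poly N n t x = (\<Sum>k\<le>Suc n. coeff (Q_poly N n) k * t ^ ((Suc n - k) div 2) * x ^ k)"

lemma coeff_q_poly_nonzero:
  "coeff (q_poly N n) k \<noteq> 0 \<Longrightarrow> k \<le> n \<and> even (n + k)"
proof (induction N n arbitrary: k rule: q_poly.induct)
  case (1 N)
  then show ?case by (cases k) auto
next
  case (2 N)
  then show ?case by (auto simp: coeff_pCons split: nat.splits if_splits)
next
  case (3 N n)
  from "3.prems" consider j where "k = Suc j" "coeff (q_poly N (Suc n)) j \<noteq> 0"
    | "coeff (q_poly N n) k \<noteq> 0"
    by (cases k; cases "coeff (q_poly N n) k = 0") (auto simp: coeff_pCons)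
  then show ?case
    by cases (use "3.IH" in fastforce)+
qed

lemma coeff_Q_poly_nonzero:
  assumes "coeff (Q_poly N n) k \<noteq> 0"
  shows "k \<le> Suc n \<and> even (Suc n - k)"
proof (cases k)
  case 0
  then show ?thesis using assms by (simp add: Q_poly_def)
next
  case (Suc j)
  then have "coeff (q_poly N n) j \<noteq> 0"
    using assms by (auto simp: Q_poly_def)
  from coeff_q_poly_nonzero[OF this] Suc show ?thesis by auto
qed

lemma Qt_poly_eq:
  assumes "0 < t"
  shows "Qt_poly N n t x = t powr ((real n + 1) / 2) * poly (Q_poly N n) (x / sqrt t)"
proof -
  have "degree (Q_poly N n) \<le> Suc n"
    by (rule degree_le) (use coeff_Q_poly_nonzero in fastforce)
  then have "poly (Q_poly N n) (x / sqrt t) = (\<Sum>k\<le>Suc n. coeff (Q_poly N n) k * (x / sqrt t) ^ k)"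
    unfolding poly_altdef
    by (intro sum.mono_neutral_left) (auto simp: coeff_eq_0)
  moreover have "coeff (Q_poly N n) k * t ^ ((Suc n - k) div 2) * x ^ k =
      t powr ((real n + 1) / 2) * (coeff (Q_poly N n) k * (x / sqrt t) ^ k)" for k
  proof (cases "coeff (Q_poly N n) k = 0")
    case False
    with coeff_Q_poly_nonzero obtain m where m: "k \<le> Suc n" "Suc n - k = 2 * m"
      by (blast elim: evenE)
    then have "Suc n = k + 2 * m" by simp
    then have "t powr ((real n + 1) / 2) = t powr (real k / 2 + real m)"
      by (simp add: add_divide_distrib flip: of_nat_Suc add.commute[of 1 "real n"])
    also have "\<dots> = sqrt t ^ k * t ^ m"
      using assms by (simp add: powr_add powr_realpow powr_half_sqrt flip: powr_powr)
        (metis powr_half_sqrt less_imp_le mult.commute powr_powr powr_realpow real_sqrt_gt_zero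
          times_divide_eq_right mult_1_right)
    finally show ?thesis
      using assms m by (simp add: power_divide)
  qed simp
  ultimately show ?thesis
    unfolding Qt_poly_def by (simp only: sum_distrib_left)
qed

definition fluctuation ::
    "nat \<Rightarrow> real \<Rightarrow> (nat \<Rightarrow> real \<Rightarrow> 'a \<Rightarrow> real) \<Rightarrow> nat \<Rightarrow> real \<Rightarrow> 'a \<Rightarrow> real" where
  "fluctuation N \<beta> X n t \<omega> =
     sqrt (\<beta> * real N / 2) *
       ((\<integral>x. Qt_poly N n t x \<partial>empirical_measure N (\<lambda>i. X i t \<omega>)) -
        (\<integral>x. Qt_poly N n t x \<partial>limit_measure N t))"

end

theory Submission
  imports Defs
begin

text \<open>The noise is additive and the same Brownian motions drive the equations for all \<open>\<beta>\<close>, so the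
  limit can be taken path by path. Put \<open>\<epsilon> = sqrt (2 / \<beta>)\<close> and compare the solution \<open>x\<close> with
  \<open>y i t = sqrt t * z i\<close>, the solution for \<open>\<epsilon> = 0\<close>. Since the drift is monotone, an energy estimate
  gives \<open>x - y = O(\<epsilon> powr (3/4))\<close>, uniformly up to the singular time \<open>0\<close>. This suffices to linearize
  the equation: \<open>(x - y) / \<epsilon>\<close> approaches the solution \<open>\<xi>\<close> of \<open>d\<xi> = dw - (1/t) A \<xi> dt\<close>, where \<open>A\<close> is
  symmetric with eigenvectors \<open>q\<^sub>n(z)\<close> and eigenvalues \<open>n / 2\<close>. Hence the \<open>n\<close>-th fluctuation converges,
  uniformly on \<open>[0, T]\<close>, to the Wiener integral of \<open>s powr (n/2)\<close> against \<open>\<Sum> q\<^sub>n(z\<^sub>i) dw\<^sub>i / sqrt N\<close>, and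
  orthogonality of the \<open>q\<^sub>n\<close> makes these integrals uncorrelated. Their joint characteristic function,
  computed by Riemann sums, identifies them as independent Gaussian processes.\<close>

section \<open>Hermite zeros and the dual polynomials\<close>

text \<open>The obstacle is time 0: all particles start at one point, the drift is singular there,
  and the perturbed gaps have no usable lower bound. The modest a priori rate suffices because the
  Taylor remainder of the drift is quadratic in the deviation. Close to time 0, where even that
  remainder is not integrable, the repulsion is not estimated pointwise; its time integral is read
  off from the equation, which expresses it by the displacement of the particles. The linear part
  needs no solution theory: the weight \<open>sqrt t ^ n\<close> is an integrating factor, since
  \<open>n / 2\<close> is exactly the eigenvalue that multiplies \<open>1 / t\<close>, and only the
  noise and the remainder survive. With \<epsilon> written as \<delta> to the power 8 the
  accumulated remainder is of order \<delta> to the power 9, so the normalised error is O(\<delta>)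
  with a constant that depends on the Brownian path but not on the solution. Convergence therefore
  holds almost surely along every sequence of \<beta>, uniformly in time, and bounded continuous
  functionals follow by dominated convergence, without any tightness argument.\<close>

lemma poly_hermite_Suc_Suc:
  "poly (hermite (Suc (Suc n))) x = x * poly (hermite (Suc n)) x - (real n + 1) * poly (hermite n) x"
  by simp

lemma poly_hermite_minus: "poly (hermite n) (- x) = (- 1) ^ n * poly (hermite n) x"
  by (induction n rule: hermite.induct) (auto simp: algebra_simps)

lemma degree_hermite: "degree (hermite n) = n \<and> lead_coeff (hermite n) = 1"
proof (induction n rule: hermite.induct)
  case (3 n)
  let ?p = "[:0, 1:] * hermite (Suc n)"
  have ne: "hermite (Suc n) \<noteq> 0" using 3 by force
  have d: "degree ?p = Suc (Suc n)" using 3 ne by (subst degree_mult_eq) auto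
  have lt: "degree (- smult (real (Suc n)) (hermite n)) < degree ?p"
    using 3 d by (simp add: le_imp_less_Suc)
  have e: "hermite (Suc (Suc n)) = ?p + (- smult (real (Suc n)) (hermite n))" by simp
  have "lead_coeff ?p = 1" unfolding lead_coeff_mult using 3 by (metis lead_coeff_pCons(1) lead_coeff_1 mult_1 one_pCons one_neq_zero pCons_eq_0_iff)
  moreover have "lead_coeff (?p + (- smult (real (Suc n)) (hermite n))) = lead_coeff ?p"
    unfolding degree_add_eq_left[OF lt] coeff_add using coeff_eq_0[OF lt] by simp
  ultimately show ?case unfolding e using degree_add_eq_left[OF lt] d by simp
qed auto

text \<open>The Appell property. Differentiating the recurrence involves the derivatives of both
  preceding polynomials, hence the strong induction.\<close>

lemma pderiv_hermite: "pderiv (hermite (Suc n)) = smult (real (Suc n)) (hermite n)"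
proof (induction n rule: less_induct)
  case (less n)
  show ?case
  proof (cases n)
    case 0 then show ?thesis by (simp add: pderiv_pCons)
  next
    case (Suc m)
    have 1: "pderiv (hermite m) = smult (real m) (hermite (m - 1))"
      using less.IH[of "m - 1"] Suc by (cases m) auto
    \<comment> \<open>The recurrence read backwards. The factor \<open>real m\<close> makes it true
      also for \<open>m = 0\<close>, where the truncated index \<open>m - 1\<close> has no
      meaning.\<close>
    have 2: "real m * (x * poly (hermite m) x) =
        real m * (poly (hermite (Suc m)) x + real m * poly (hermite (m - 1)) x)" for x
      by (cases m) auto
    have 3: "pderiv (hermite (Suc m)) = smult (real (Suc m)) (hermite m)"
      using less.IH[of m] Suc by simp
    have "poly (pderiv (hermite (Suc n))) x = poly (smult (real (Suc n)) (hermite n)) x" for x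
    proof -
      have "poly (pderiv (hermite (Suc n))) x = poly (hermite (Suc m)) x + x * (real (Suc m) * poly (hermite m) x)
          - real (Suc m) * (real m * poly (hermite (m - 1)) x)"
        unfolding Suc hermite.simps(3)
        by (simp add: pderiv_diff pderiv_smult pderiv_mult pderiv_pCons 1 3 del: hermite.simps of_nat_Suc)
      also have "\<dots> = poly (hermite (Suc m)) x + x * poly (hermite m) x + real m * (x * poly (hermite m) x)
          - real (Suc m) * (real m * poly (hermite (m - 1)) x)" by (simp add: algebra_simps)
      also have "\<dots> = poly (smult (real (Suc n)) (hermite n)) x"
        unfolding 2 poly_smult Suc poly_hermite_Suc_Suc[symmetric]
        by (cases m) (simp_all add: algebra_simps)
      finally show ?thesis .
    qed
    then show ?thesis by (simp add: poly_eq_poly_eq_iff[symmetric] fun_eq_iff)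
  qed
qed

text \<open>Hermite's differential equation: applying the derivative rule twice turns it into the
  recurrence. Its value at a zero is what yields the equilibrium condition.\<close>

lemma hermite_ode:
  "poly (pderiv (pderiv (hermite n))) x = x * poly (pderiv (hermite n)) x - real n * poly (hermite n) x"
proof (cases n)
  case (Suc m)
  show ?thesis
    by (cases m) (simp_all only: Suc pderiv_hermite pderiv_smult poly_smult poly_hermite_Suc_Suc,
       simp_all add: algebra_simps pderiv_pCons)
qed simp

section \<open>Real and simple zeros of the Hermite polynomials\<close>

text \<open>The difference of two monic polynomials of equal degree has smaller degree, so it cannot
  vanish at \<open>card I\<close> distinct points without being zero.\<close>

lemma monic_poly_eq_prod_roots:
  fixes p :: "real poly"
  assumes "finite I" and "degree p = card I" and "lead_coeff p = 1"
    and "inj_on s I" and "\<And>i. i \<in> I \<Longrightarrow> poly p (s i) = 0"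
  shows "p = (\<Prod>i\<in>I. [:- s i, 1:])"
proof (rule ccontr)
  define q where "q = (\<Prod>i\<in>I. [:- s i, 1:])"
  assume "p \<noteq> (\<Prod>i\<in>I. [:- s i, 1:])"
  then have ne: "p - q \<noteq> 0" by (simp add: q_def)
  have dq: "degree q = card I" unfolding q_def
    by (subst degree_prod_eq_sum_degree) auto
  have lq: "lead_coeff q = 1" unfolding q_def by (subst lead_coeff_prod) auto
  have "coeff (p - q) (card I) = 0" using dq lq assms by simp
  moreover have "degree (p - q) \<le> card I" using dq assms by (simp add: degree_diff_le)
  ultimately have lt: "degree (p - q) < card I \<or> card I = 0"
    using ne by (metis le_neq_implies_less leading_coeff_0_iff)
  have "poly (p - q) (s i) = 0" if "i \<in> I" for i
    using that assms by (auto simp: q_def poly_prod)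
  then have "s ` I \<subseteq> {x. poly (p - q) x = 0}" by auto
  then have "card (s ` I) \<le> degree (p - q)"
    using order_trans[OF card_mono[OF poly_roots_finite[OF ne]] card_poly_roots_bound[OF ne]] by blast
  then have "card I \<le> degree (p - q)" using assms(4) by (simp add: card_image)
  with lt have "card I = 0" by auto
  then show False using assms dq lq ne by (metis degree_0 coeff_0 \<open>coeff (p - q) (card I) = 0\<close>
    \<open>degree (p - q) \<le> card I\<close> le_zero_eq leading_coeff_0_iff)
qed

text \<open>Sturm's argument: the recurrence makes \<open>hermite (n + 1)\<close> change sign between consecutive
  roots of \<open>hermite n\<close>, and the signs at infinity give the two outer roots.\<close>

lemma hermite_roots_interlace:
  "\<exists>r. strict_mono_on {..n} r \<and> (\<forall>k\<le>n. poly (hermite (Suc n)) (r k) = 0) \<and>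
       (\<forall>k\<le>n. 0 < (- 1) ^ (n - k) * poly (hermite n) (r k))"
proof (induction n)
  case 0
  show ?case by (intro exI[of _ "\<lambda>_. 0"]) (auto simp: strict_mono_on_def)
next
  case (Suc n)
  then obtain r where r: "strict_mono_on {..n} r" "\<And>k. k \<le> n \<Longrightarrow> poly (hermite (Suc n)) (r k) = 0"
    "\<And>k. k \<le> n \<Longrightarrow> 0 < (- 1) ^ (n - k) * poly (hermite n) (r k)" by blast
  let ?H = "\<lambda>n x. poly (hermite n) x"
  have inj: "inj_on r {..n}" using r(1) by (rule strict_mono_on_imp_inj_on)
  have prod: "hermite (Suc n) = (\<Prod>k\<le>n. [:- r k, 1:])"
    by (rule monic_poly_eq_prod_roots) (use degree_hermite[of "Suc n"] inj r in auto)
  obtain L where L: "\<And>x. x \<ge> L \<Longrightarrow> ?H (Suc (Suc n)) x \<ge> 1"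
    using poly_pinfty_gt_lc[of "hermite (Suc (Suc n))"] degree_hermite[of "Suc (Suc n)"] by (metis zero_less_one)
  \<comment> \<open>All roots \<open>r k\<close> lie inside \<open>(-u, u)\<close>, and
    \<open>u\<close> exceeds the bound \<open>L\<close> beyond which the next polynomial is
    positive; parity gives its sign at \<open>-u\<close>.\<close>
  define u where "u = Max (insert L ((\<lambda>k. \<bar>r k\<bar>) ` {..n})) + 1"
  have u: "L < u" "\<And>k. k \<le> n \<Longrightarrow> \<bar>r k\<bar> < u"
  proof -
    have *: "x \<le> Max (insert L ((\<lambda>k. \<bar>r k\<bar>) ` {..n}))" if "x \<in> insert L ((\<lambda>k. \<bar>r k\<bar>) ` {..n})" for x
      using that by (intro Max_ge) auto
    from this[of L] show "L < u" unfolding u_def by simp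
    show "\<bar>r k\<bar> < u" if "k \<le> n" for k
    proof -
      have "\<bar>r k\<bar> \<le> Max (insert L ((\<lambda>k. \<bar>r k\<bar>) ` {..n}))" by (rule *) (use that in auto)
      then show ?thesis unfolding u_def by linarith
    qed
  qed
  \<comment> \<open>The separating points for the new roots: the old roots, shifted by one index,
    framed by \<open>-u\<close> and \<open>u\<close>. At an old root the recurrence leaves only the
    term with \<open>hermite n\<close>, whose sign the induction hypothesis knows.\<close>
  define R where "R k = (if k = 0 then - u else if k = Suc (Suc n) then u else r (k - 1))" for k
  have Rmono: "R k < R (Suc k)" if k: "k \<le> Suc n" for k
  proof -
    consider "k = 0" | "k = Suc n" | "0 < k" "k < Suc n" using k by linarith
    then show ?thesis
    proof cases
      case 3
      then show ?thesis using r(1) by (auto simp: R_def strict_mono_on_def)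
    qed (use u(2)[of 0] u(2)[of n] in \<open>auto simp: R_def\<close>)
  qed
  have Rsgn: "0 < (- 1) ^ (Suc (Suc n) - k) * ?H (Suc (Suc n)) (R k)" if k: "k \<le> Suc (Suc n)" for k
  proof -
    consider "k = 0" | "k = Suc (Suc n)" | j where "k = Suc j" "j \<le> n" using k by (cases k) force+
    then show ?thesis
    proof cases
      case 1
      then show ?thesis using L[of u] u(1)
        by (simp add: R_def poly_hermite_minus del: hermite.simps flip: power_add mult_2)
    next
      case 2 then show ?thesis using L[of u] u(1) by (simp add: R_def del: hermite.simps)
    next
      case 3
      then have "?H (Suc (Suc n)) (R k) = - (real n + 1) * ?H n (r j)" using r(2)[of j]
        unfolding poly_hermite_Suc_Suc by (simp add: R_def algebra_simps)
      moreover have "Suc (Suc n) - k = Suc (n - j)" using 3 by simp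
      ultimately have "(- 1) ^ (Suc (Suc n) - k) * ?H (Suc (Suc n)) (R k) = (- 1) ^ Suc (n - j) * (- (real n + 1) * ?H n (r j))"
        by (simp only:)
      also have "\<dots> = (real n + 1) * ((-1)^(n-j) * ?H n (r j))" by (simp add: algebra_simps)
      also have "\<dots> > 0" by (rule mult_pos_pos) (use r(3)[of j] 3 in auto)
      finally show ?thesis .
    qed
  qed
  have "\<exists>s. R k < s \<and> s < R (Suc k) \<and> ?H (Suc (Suc n)) s = 0" if k: "k \<le> Suc n" for k
  proof -
    define c :: real where "c = (- 1) ^ (Suc (Suc n) - k)"
    have "0 < c * ?H (Suc (Suc n)) (R k)" "0 < - c * ?H (Suc (Suc n)) (R (Suc k))"
      using Rsgn[of k] Rsgn[of "Suc k"] k by (simp_all add: c_def Suc_diff_le del: hermite.simps)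
    moreover have "c = 1 \<or> c = - 1" unfolding c_def by (metis neg_one_even_power neg_one_odd_power)
    ultimately have "?H (Suc (Suc n)) (R k) * ?H (Suc (Suc n)) (R (Suc k)) < 0"
      by (auto simp: mult_less_0_iff simp del: hermite.simps)
    from poly_IVT[OF Rmono[OF k] this] show ?thesis by auto
  qed
  then obtain s where s: "\<And>k. k \<le> Suc n \<Longrightarrow> R k < s k \<and> s k < R (Suc k) \<and> ?H (Suc (Suc n)) (s k) = 0"
    by metis
  have Rle: "R i \<le> R j" if "i \<le> j" "j \<le> Suc (Suc n)" for i j
    using that by (induction j rule: dec_induct) (use Rmono in force)+
  have smono: "strict_mono_on {..Suc n} s"
    by (rule strict_mono_onI) (use s Rle in \<open>smt (verit, ccfv_threshold) Suc_leI atMost_iff le_SucI le_Suc_eq\<close>)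
  have "0 < (- 1) ^ (Suc n - k) * ?H (Suc n) (s k)" if k: "k \<le> Suc n" for k
  proof -
    \<comment> \<open>For the sign in the next round: exactly the old roots \<open>r k\<close>, ...,
      \<open>r n\<close> lie to the right of \<open>s k\<close>, so the product form has
      \<open>Suc n - k\<close> negative factors.\<close>
    have "{..n} = {..<k} \<union> {k..n}" using k by auto
    then have "?H (Suc n) (s k) = (\<Prod>j\<in>{..<k} \<union> {k..n}. s k - r j)" unfolding prod
      by (simp add: poly_prod)
    also have "\<dots> = (\<Prod>j<k. s k - r j) * (\<Prod>j=k..n. s k - r j)"
      by (rule prod.union_disjoint) auto
    also have "(\<Prod>j=k..n. s k - r j) = (\<Prod>j=k..n. - 1 * (r j - s k))" by simp
    also have "\<dots> = (- 1) ^ (Suc n - k) * (\<Prod>j=k..n. r j - s k)" unfolding prod.distrib by simp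
    finally have eq: "(- 1) ^ (Suc n - k) * ?H (Suc n) (s k) = (\<Prod>j<k. s k - r j) * (\<Prod>j=k..n. r j - s k)"
      by (simp del: hermite.simps add: mult.left_commute flip: power_add mult_2)
    have "0 < s k - r j" if "j < k" for j
      using s[OF k] Rle[of "Suc j" k] that k by (auto simp: R_def split: if_splits)
    moreover have "0 < r j - s k" if "j \<in> {k..n}" for j
      using s[OF k] Rle[of "Suc k" "Suc j"] that k by (auto simp: R_def split: if_splits)
    ultimately show ?thesis unfolding eq by (intro mult_pos_pos prod_pos) auto
  qed
  then show ?case using smono s by blast
qed

text \<open>Interlacing supplies \<open>N\<close> distinct zeros and the degree allows no more. Thus
  the sorted list behind \<open>hermite_zero\<close> has length \<open>N\<close>, and its index
  \<open>i - 1\<close> is in range.\<close>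

lemma hermite_roots: "finite {x. poly (hermite N) x = 0}" "card {x. poly (hermite N) x = 0} = N"
proof -
  have ne: "hermite N \<noteq> 0" using degree_hermite[of N] by force
  show fin: "finite {x. poly (hermite N) x = 0}" by (rule poly_roots_finite[OF ne])
  show "card {x. poly (hermite N) x = 0} = N"
  proof (cases N)
    case (Suc n)
    from hermite_roots_interlace[of n] obtain r where r: "strict_mono_on {..n} r"
      "\<And>k. k \<le> n \<Longrightarrow> poly (hermite N) (r k) = 0" unfolding Suc by blast
    have "card (r ` {..n}) = N"
      using card_image[OF strict_mono_on_imp_inj_on[OF r(1)]] Suc by simp
    moreover have "r ` {..n} \<subseteq> {x. poly (hermite N) x = 0}" using r by auto
    ultimately show ?thesis
      using card_mono[OF fin] card_poly_roots_bound[OF ne] degree_hermite[of N] by (metis le_antisym)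
  qed simp
qed

lemma hermite_zero_less:
  assumes "1 \<le> i" "i < j" "j \<le> N"
  shows "hermite_zero N i < hermite_zero N j"
  unfolding hermite_zero_def
  using strict_sorted_list_of_set[of "{x. poly (hermite N) x = 0}"] assms hermite_roots[of N]
  by (auto simp: sorted_wrt_iff_nth_less)

lemma poly_hermite_zero:
  assumes "i \<in> {1..N}"
  shows "poly (hermite N) (hermite_zero N i) = 0"
proof -
  have "hermite_zero N i \<in> set (sorted_list_of_set {x. poly (hermite N) x = 0})"
    unfolding hermite_zero_def using assms hermite_roots[of N] by (intro nth_mem) auto
  then show ?thesis using hermite_roots[of N] by simp
qed

lemma inj_on_hermite_zero: "inj_on (hermite_zero N) {1..N}"
  by (rule linorder_inj_onI) (use hermite_zero_less in force)+

section \<open>Equilibrium of the zeros and spectrum of the linearised drift\<close>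

text \<open>Stieltjes' argument: if \<open>G\<close> is the Hermite polynomial without its factor at
  the zero \<open>z i\<close>, Hermite's equation there reads \<open>2 G' = z i * G\<close>, and the
  logarithmic derivative of \<open>G\<close> is the sum of reciprocals.\<close>

lemma hermite_zero_equilibrium:
  assumes i: "i \<in> {1..N}"
  shows "(\<Sum>j\<in>{1..N} - {i}. 1 / (hermite_zero N i - hermite_zero N j)) = hermite_zero N i / 2"
proof -
  let ?z = "hermite_zero N"
  define G where "G = (\<Prod>j\<in>{1..N} - {i}. [:- ?z j, 1:])"
  have "hermite N = (\<Prod>j\<in>{1..N}. [:- ?z j, 1:])"
    by (rule monic_poly_eq_prod_roots) (use degree_hermite[of N] inj_on_hermite_zero poly_hermite_zero in auto)
  also have "\<dots> = [:- ?z i, 1:] * G" unfolding G_def using i by (subst prod.remove[of _ i]) auto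
  finally have H: "hermite N = [:- ?z i, 1:] * G" .
  have ne: "?z i \<noteq> ?z j" if "j \<in> {1..N} - {i}" for j
    using inj_onD[OF inj_on_hermite_zero, of N i j] i that by auto
  have G: "poly G (?z i) \<noteq> 0" unfolding G_def poly_prod using ne by auto
  have d: "pderiv ([:- ?z i, 1:] * p) = [:- ?z i, 1:] * pderiv p + p" for p
    by (simp only: pderiv_mult) (simp add: pderiv_pCons)
  have "2 * poly (pderiv G) (?z i) = ?z i * poly G (?z i)"
    using hermite_ode[of N "?z i"] unfolding H d pderiv_add poly_add poly_mult by simp
  moreover have "poly (pderiv G) (?z i) = (\<Sum>j\<in>{1..N} - {i}. poly G (?z i) / (?z i - ?z j))"
    unfolding G_def pderiv_prod poly_sum poly_mult
  proof (intro sum.cong refl)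
    fix j assume j: "j \<in> {1..N} - {i}"
    show "poly (\<Prod>k\<in>{1..N} - {i} - {j}. [:- ?z k, 1:]) (?z i) * poly (pderiv [:- ?z j, 1:]) (?z i) =
       poly (\<Prod>k\<in>{1..N} - {i}. [:- ?z k, 1:]) (?z i) / (?z i - ?z j)"
      using ne[OF j] j by (subst (2) prod.remove[of _ j]) (auto simp: pderiv_pCons simp del: mult_pCons_left)
  qed
  ultimately have "2 * (poly G (?z i) * (\<Sum>j\<in>{1..N} - {i}. 1 / (?z i - ?z j))) = ?z i * poly G (?z i)"
    by (simp add: sum_distrib_left)
  then show ?thesis using G by simp
qed

text \<open>\<open>A\<close> is, up to sign, the Jacobian of the drift at the Hermite zeros; the auxiliary operator \<open>B\<close>
  measures its commutator with the multiplication by \<open>x\<close>, which carries the induction along the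
  three-term recurrence.\<close>

lemma q_poly_eigen_aux:
  fixes z :: "nat \<Rightarrow> real"
  assumes inj: "inj_on z {1..N}"
    and eq: "\<And>i. i \<in> {1..N} \<Longrightarrow> (\<Sum>j\<in>{1..N} - {i}. 1 / (z i - z j)) = z i / 2"
  defines "A \<equiv> \<lambda>f i. \<Sum>j\<in>{1..N} - {i}. (f i - f j) / (z i - z j)\<^sup>2"
    and "B \<equiv> \<lambda>f i. \<Sum>j\<in>{1..N} - {i}. f j / (z i - z j)"
    and "q \<equiv> \<lambda>n i. poly (q_poly N n) (z i)"
  shows "\<forall>i\<in>{1..N}. A (q n) i = real n / 2 * q n i \<and>
    B (q n) i = q (Suc n) i / 2 - (if n = 0 then 0 else (real N - real n) / 2 * q (n - 1) i)"
proof -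
  have ne: "z i \<noteq> z j" if "i \<in> {1..N}" "j \<in> {1..N} - {i}" for i j
    using inj_onD[OF inj, of i j] that by auto
  have Ax: "A (\<lambda>i. z i * f i) i = z i * A f i + B f i" if "i \<in> {1..N}" for f i
    unfolding A_def B_def sum_distrib_left sum.distrib[symmetric]
  proof (intro sum.cong refl)
    fix j assume "j \<in> {1..N} - {i}"
    from ne[OF that this] have "f j / (z i - z j) = f j * (z i - z j) / (z i - z j)\<^sup>2"
      by (simp add: power2_eq_square)
    then show "(z i * f i - z j * f j) / (z i - z j)\<^sup>2 = z i * ((f i - f j) / (z i - z j)\<^sup>2) + f j / (z i - z j)"
      by (simp add: algebra_simps flip: add_divide_distrib diff_divide_distrib)
  qed
  \<comment> \<open>Unlike \<open>Ax\<close>, this relation produces a rank-one term, the total sum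
    of \<open>f\<close>. It disappears for the higher eigenvectors by \<open>sumA\<close>.\<close>
  have Bx: "B (\<lambda>i. z i * f i) i = z i * B f i + f i - (\<Sum>j\<in>{1..N}. f j)" if "i \<in> {1..N}" for f i
  proof -
    have "B (\<lambda>i. z i * f i) i = (\<Sum>j\<in>{1..N} - {i}. z i * (f j / (z i - z j)) - f j)"
      unfolding B_def by (intro sum.cong refl) (use ne[OF that] in \<open>simp add: field_simps\<close>)
    also have "\<dots> = z i * B f i - (\<Sum>j\<in>{1..N} - {i}. f j)"
      by (simp add: sum_subtractf sum_distrib_left B_def)
    finally show ?thesis using that by (simp add: sum.remove)
  qed
  have lin: "A (\<lambda>i. f i - c * g i) i = A f i - c * A g i" "B (\<lambda>i. f i - c * g i) i = B f i - c * B g i" for f g c i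
    unfolding A_def B_def sum_distrib_left sum_subtractf[symmetric]
    by (intro sum.cong; simp add: diff_divide_distrib right_diff_distrib)+
  \<comment> \<open>The summands are antisymmetric in the two indices. Consequently an eigenvector
    with nonzero eigenvalue has vanishing sum.\<close>
  have sumA: "(\<Sum>i\<in>{1..N}. A f i) = 0" for f
  proof -
    let ?g = "\<lambda>i j. if i = j then 0 else (f i - f j) / (z i - z j)\<^sup>2"
    have "(\<Sum>i\<in>{1..N}. A f i) = (\<Sum>i\<in>{1..N}. \<Sum>j\<in>{1..N}. ?g i j)"
      unfolding A_def by (intro sum.cong refl sum.mono_neutral_cong_left) auto
    moreover have "(\<Sum>i\<in>{1..N}. \<Sum>j\<in>{1..N}. ?g i j) = (\<Sum>i\<in>{1..N}. \<Sum>j\<in>{1..N}. ?g j i)"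
      by (rule sum.swap)
    moreover have "?g j i = - ?g i j" for i j
      by (simp add: power2_commute[of "z j" "z i"] diff_divide_distrib)
    then have "(\<Sum>i\<in>{1..N}. \<Sum>j\<in>{1..N}. ?g j i) = (\<Sum>i\<in>{1..N}. \<Sum>j\<in>{1..N}. - ?g i j)"
      by (intro sum.cong refl)
    ultimately show ?thesis unfolding sum_negf by linarith
  qed
  have q_SS: "q (Suc (Suc n)) = (\<lambda>i. z i * q (Suc n) i - (real N - real (Suc n)) * q n i)" for n
    by (auto simp: q_def)
  have B0: "B (q 0) i = z i / 2" if "i \<in> {1..N}" for i
    unfolding B_def q_def using eq[OF that] by simp
  have q0: "q 0 = (\<lambda>_. 1)" and q1: "q (Suc 0) = z" "q (Suc 0) = (\<lambda>i. z i * q 0 i)" by (auto simp: q_def)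
  show ?thesis
  proof (induction n rule: induct_nat_012)
    case 0
    then show ?case using B0 by (auto simp: q1) (simp add: A_def q0)
  next
    case 1
    show ?case
    proof (intro ballI conjI)
      fix i assume i: "i \<in> {1..N}"
      have A0: "A (q 0) i = 0" by (simp add: A_def q0)
      show "A (q (Suc 0)) i = real (Suc 0) / 2 * q (Suc 0) i"
        unfolding q1(2) Ax[OF i] using B0[OF i] A0 by (simp add: q0)
      have "B (q (Suc 0)) i = z i * (z i / 2) + 1 - real N"
        unfolding q1(2) Bx[OF i] B0[OF i] by (simp add: q0)
      then show "B (q (Suc 0)) i = q (Suc (Suc 0)) i / 2 - (if Suc 0 = 0 then 0 else (real N - real (Suc 0)) / 2 * q (Suc 0 - 1) i)"
        by (simp add: q_SS q1 q0 field_simps)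
    qed
  next
    case (ge2 n)
    show ?case
    proof (intro ballI conjI)
      fix i assume i: "i \<in> {1..N}"
      have A1: "A (q (Suc n)) i = (real n + 1) / 2 * q (Suc n) i" and A0: "A (q n) i = real n / 2 * q n i"
        and B1: "B (q (Suc n)) i = q (Suc (Suc n)) i / 2 - (real N - real n - 1) / 2 * q n i"
        using ge2 i by auto
      show A2: "A (q (Suc (Suc n))) i = real (Suc (Suc n)) / 2 * q (Suc (Suc n)) i"
        unfolding q_SS lin Ax[OF i] A1 A0 B1 by (simp add: q_SS field_simps)
      have "(\<Sum>j\<in>{1..N}. (1 + real n) * q (Suc n) j) = (\<Sum>j\<in>{1..N}. 2 * A (q (Suc n)) j)"
        by (intro sum.cong refl) (simp add: bspec[OF ge2(2), THEN conjunct1])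
      then have S: "(\<Sum>j\<in>{1..N}. q (Suc n) j) = 0" unfolding sum_distrib_left[symmetric] sumA by simp
      have "B (q (Suc (Suc n))) i = z i * B (q (Suc n)) i + q (Suc n) i - (real N - real (Suc n)) * B (q n) i"
        by (subst q_SS, unfold lin Bx[OF i] S) simp
      also have "(real N - real (Suc n)) * B (q n) i = (real N - real (Suc n)) * q (Suc n) i / 2 -
         (real N - real (Suc n)) * (if n = 0 then 0 else (real N - real n) / 2 * q (n - 1) i)"
        using ge2(1) i by (simp add: right_diff_distrib)
      also have "(if n = 0 then 0 else (real N - real n) / 2 * q (n - 1) i) =
         (if n = 0 then 0 else (z i * q n i - q (Suc n) i) / 2)"
        by (cases n) (auto simp: q_SS field_simps)
      finally have e: "B (q (Suc (Suc n))) i = z i * B (q (Suc n)) i + q (Suc n) i -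
         ((real N - real (Suc n)) * q (Suc n) i / 2 -
         (real N - real (Suc n)) * (if n = 0 then 0 else (z i * q n i - q (Suc n) i) / 2))" .
      \<comment> \<open>For \<open>n = 0\<close> the right-hand side vanishes anyway, because
        \<open>q 1 = z * q 0\<close>; this removes the case distinction.\<close>
      have n0: "(if n = 0 then 0 else (z i * q n i - q (Suc n) i) / 2) = (z i * q n i - q (Suc n) i) / 2"
        by (auto simp: q0 q1)
      show "B (q (Suc (Suc n))) i = q (Suc (Suc (Suc n))) i / 2 -
          (if Suc (Suc n) = 0 then 0 else (real N - real (Suc (Suc n))) / 2 * q (Suc (Suc n) - 1) i)"
        unfolding e n0 B1 by (simp add: q_SS field_simps)
    qed
  qed
qed

lemma q_poly_eigen:
  assumes "i \<in> {1..N}"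
  shows "(\<Sum>j\<in>{1..N} - {i}. (poly (q_poly N n) (hermite_zero N i) - poly (q_poly N n) (hermite_zero N j))
      / (hermite_zero N i - hermite_zero N j)\<^sup>2) = real n / 2 * poly (q_poly N n) (hermite_zero N i)"
  using q_poly_eigen_aux[OF inj_on_hermite_zero hermite_zero_equilibrium, of N n] assms by blast

lemma sum_sum_remove:
  fixes h :: "nat \<Rightarrow> nat \<Rightarrow> real"
  shows "(\<Sum>i\<in>{1..N}. \<Sum>j\<in>{1..N} - {i}. h i j) = (\<Sum>i\<in>{1..N}. \<Sum>j\<in>{1..N} - {i}. h j i)"
proof -
  have "(\<Sum>i\<in>{1..N}. \<Sum>j\<in>{1..N} - {i}. h i j) = (\<Sum>i\<in>{1..N}. \<Sum>j\<in>{1..N}. if i = j then 0 else h i j)" for h :: "nat \<Rightarrow> nat \<Rightarrow> real"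
    by (intro sum.cong refl sum.mono_neutral_cong_left) auto
  note * = this
  show ?thesis unfolding * by (subst sum.swap) (intro sum.cong refl, auto)
qed

text \<open>The matrix is symmetric, so it can be moved from \<open>v\<close> onto the eigenvector.
  This projects the linearised drift of an arbitrary deviation \<open>v\<close> onto a single
  mode.\<close>

lemma q_poly_eigen_sum:
  "(\<Sum>i\<in>{1..N}. poly (q_poly N n) (hermite_zero N i) * (\<Sum>j\<in>{1..N} - {i}. (v i - v j) / (hermite_zero N i - hermite_zero N j)\<^sup>2))
   = real n / 2 * (\<Sum>i\<in>{1..N}. poly (q_poly N n) (hermite_zero N i) * v i)"
proof -
  let ?z = "hermite_zero N" and ?q = "\<lambda>i. poly (q_poly N n) (hermite_zero N i)"
  have "(\<Sum>i\<in>{1..N}. ?q i * (\<Sum>j\<in>{1..N} - {i}. (v i - v j) / (?z i - ?z j)\<^sup>2))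
     = (\<Sum>i\<in>{1..N}. \<Sum>j\<in>{1..N} - {i}. ?q i * v i / (?z i - ?z j)\<^sup>2) - (\<Sum>i\<in>{1..N}. \<Sum>j\<in>{1..N} - {i}. ?q i * v j / (?z i - ?z j)\<^sup>2)"
    unfolding sum_distrib_left sum_subtractf[symmetric] by (simp add: diff_divide_distrib right_diff_distrib)
  also have "(\<Sum>i\<in>{1..N}. \<Sum>j\<in>{1..N} - {i}. ?q i * v j / (?z i - ?z j)\<^sup>2) = (\<Sum>i\<in>{1..N}. \<Sum>j\<in>{1..N} - {i}. ?q j * v i / (?z i - ?z j)\<^sup>2)"
    by (subst sum_sum_remove) (simp add: power2_commute)
  also have "(\<Sum>i\<in>{1..N}. \<Sum>j\<in>{1..N} - {i}. ?q i * v i / (?z i - ?z j)\<^sup>2) - \<dots> =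
     (\<Sum>i\<in>{1..N}. v i * (\<Sum>j\<in>{1..N} - {i}. (?q i - ?q j) / (?z i - ?z j)\<^sup>2))"
    unfolding sum_distrib_left sum_subtractf[symmetric]
    by (intro sum.cong refl) (simp add: diff_divide_distrib right_diff_distrib mult.commute)
  also have "\<dots> = (\<Sum>i\<in>{1..N}. v i * (real n / 2 * ?q i))"
    by (intro sum.cong refl) (simp only: q_poly_eigen)
  finally show ?thesis by (simp add: sum_distrib_left mult_ac)
qed

text \<open>Eigenvectors of a symmetric operator belonging to the distinct eigenvalues
  \<open>m / 2\<close> and \<open>n / 2\<close>.\<close>

lemma q_poly_orthogonal:
  assumes "m \<noteq> n"
  shows "(\<Sum>i\<in>{1..N}. poly (q_poly N m) (hermite_zero N i) * poly (q_poly N n) (hermite_zero N i)) = 0"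
proof -
  let ?q = "\<lambda>n i. poly (q_poly N n) (hermite_zero N i)"
  have "real m / 2 * (\<Sum>i\<in>{1..N}. ?q m i * ?q n i) = (\<Sum>i\<in>{1..N}. ?q m i * (real n / 2 * ?q n i))"
    unfolding q_poly_eigen_sum[symmetric] by (intro sum.cong refl) (simp only: q_poly_eigen)
  also have "\<dots> = real n / 2 * (\<Sum>i\<in>{1..N}. ?q m i * ?q n i)"
    by (simp add: sum_distrib_left mult_ac)
  finally have "(real m - real n) * (\<Sum>i\<in>{1..N}. ?q m i * ?q n i) = 0"
    unfolding left_diff_distrib by linarith
  then show ?thesis using assms by simp
qed

section \<open>Indefinite Lebesgue integrals\<close>

lemma integrable_fubini_product:
  fixes A B :: "real \<Rightarrow> real"
  assumes A: "integrable lborel A" and B: "integrable lborel B"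
  shows "integrable (lborel \<Otimes>\<^sub>M lborel) (\<lambda>(r, s). A r * B s)"
proof (rule lborel_pair.Fubini_integrable)
  have [measurable]: "A \<in> borel_measurable borel" "B \<in> borel_measurable borel"
    using A B by (auto dest: borel_measurable_integrable)
  show "(\<lambda>(r, s). A r * B s) \<in> borel_measurable (lborel \<Otimes>\<^sub>M lborel)" by measurable
  show "integrable lborel (\<lambda>x. \<integral>y. norm (case (x, y) of (r, s) \<Rightarrow> A r * B s) \<partial>lborel)"
    using A B by (simp add: abs_mult)
  show "AE x in lborel. integrable lborel (\<lambda>y. case (x, y) of (r, s) \<Rightarrow> A r * B s)"
    using B by simp
qed

text \<open>The integral of the product over the plane is split along the diagonal into the halves
  \<open>r \<le> s\<close> and \<open>s < r\<close>, each evaluated by Fubini. This is integration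
  by parts in disguise.\<close>

lemma fubini_triangle:
  fixes A B :: "real \<Rightarrow> real"
  assumes A: "integrable lborel A" and B: "integrable lborel B"
  shows "integrable lborel (\<lambda>s. (LBINT r:{..s}. A r) * B s)"
    and "integrable lborel (\<lambda>s. A s * (LBINT r:{..s}. B r))"
    and "(\<integral>s. A s \<partial>lborel) * (\<integral>s. B s \<partial>lborel) =
      (\<integral>s. (LBINT r:{..s}. A r) * B s \<partial>lborel) + (\<integral>s. A s * (LBINT r:{..s}. B r) \<partial>lborel)"
proof -
  have [measurable]: "A \<in> borel_measurable borel" "B \<in> borel_measurable borel"
    using A B by (auto dest: borel_measurable_integrable)
  note AB = integrable_fubini_product[OF A B]
  define h1 h2 where "h1 r s = (if r \<le> s then A r * B s else 0)" and "h2 r s = (if s < r then A r * B s else 0)"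
    for r s
  have i1: "integrable (lborel \<Otimes>\<^sub>M lborel) (\<lambda>(r, s). h1 r s)" and i2: "integrable (lborel \<Otimes>\<^sub>M lborel) (\<lambda>(r, s). h2 r s)"
    by (rule Bochner_Integration.integrable_bound[OF AB]; auto simp: h1_def h2_def)+
  \<comment> \<open>The diagonal is a null set, so the strict half may be written with closed
    half-lines as well.\<close>
  have lt: "(LBINT s:{..<r}. B s) = (LBINT s:{..r}. B s)" for r
    unfolding set_lebesgue_integral_def
  proof (rule integral_cong_AE)
    show "AE s in lborel. indicator {..<r} s *\<^sub>R B s = indicator {..r} s *\<^sub>R B s"
      using AE_lborel_singleton[of r] by eventually_elim (auto simp: indicator_def)
  qed auto
  have e1: "(\<integral>r. h1 r s \<partial>lborel) = (LBINT r:{..s}. A r) * B s" for s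
    unfolding set_lebesgue_integral_def integral_mult_left_zero[symmetric]
    by (intro Bochner_Integration.integral_cong) (auto simp: h1_def)
  have e2: "(\<integral>s. h2 r s \<partial>lborel) = A r * (LBINT s:{..r}. B s)" for r
    unfolding lt[symmetric] unfolding set_lebesgue_integral_def integral_mult_right_zero[symmetric]
    by (intro Bochner_Integration.integral_cong) (auto simp: h2_def)
  show "integrable lborel (\<lambda>s. (LBINT r:{..s}. A r) * B s)"
    using lborel_pair.integrable_snd[OF i1] unfolding e1 .
  show "integrable lborel (\<lambda>s. A s * (LBINT r:{..s}. B r))"
    using lborel_pair.integrable_fst[OF i2] unfolding e2 .
  have "(\<integral>s. A s \<partial>lborel) * (\<integral>s. B s \<partial>lborel) = (\<integral>p. (case p of (r, s) \<Rightarrow> A r * B s) \<partial>(lborel \<Otimes>\<^sub>M lborel))"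
    using lborel_pair.integral_fst[OF AB] by simp
  also have "\<dots> = (\<integral>p. (case p of (r, s) \<Rightarrow> h1 r s) + (case p of (r, s) \<Rightarrow> h2 r s) \<partial>(lborel \<Otimes>\<^sub>M lborel))"
    by (intro Bochner_Integration.integral_cong) (auto simp: h1_def h2_def)
  also have "\<dots> = (\<integral>p. (case p of (r, s) \<Rightarrow> h1 r s) \<partial>(lborel \<Otimes>\<^sub>M lborel)) + (\<integral>p. (case p of (r, s) \<Rightarrow> h2 r s) \<partial>(lborel \<Otimes>\<^sub>M lborel))"
    by (rule Bochner_Integration.integral_add[OF i1 i2])
  also have "(\<integral>p. (case p of (r, s) \<Rightarrow> h1 r s) \<partial>(lborel \<Otimes>\<^sub>M lborel)) = (\<integral>s. (LBINT r:{..s}. A r) * B s \<partial>lborel)"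
    using lborel_pair.integral_snd[OF i1] unfolding e1 by simp
  also have "(\<integral>p. (case p of (r, s) \<Rightarrow> h2 r s) \<partial>(lborel \<Otimes>\<^sub>M lborel)) = (\<integral>s. A s * (LBINT r:{..s}. B r) \<partial>lborel)"
    using lborel_pair.integral_fst[OF i2] unfolding e2 by simp
  finally show "(\<integral>s. A s \<partial>lborel) * (\<integral>s. B s \<partial>lborel) =
      (\<integral>s. (LBINT r:{..s}. A r) * B s \<partial>lborel) + (\<integral>s. A s * (LBINT r:{..s}. B r) \<partial>lborel)" .
qed

text \<open>Absolute continuity with prescribed density, stated by Lebesgue integrals so that
  \<open>f'\<close> may blow up at time 0 and need only be known almost everywhere. For
  \<open>T < 0\<close> the interval is empty and the predicate holds trivially.\<close>

definition primitive :: "real \<Rightarrow> (real \<Rightarrow> real) \<Rightarrow> (real \<Rightarrow> real) \<Rightarrow> bool" where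
  "primitive T f f' \<longleftrightarrow> set_integrable lborel {0..T} f' \<and> (\<forall>t\<in>{0..T}. f t = f 0 + (LBINT s:{0..t}. f' s))"

lemma primitiveI:
  assumes "set_integrable lborel {0..T} f'"
    and "\<And>t. 0 \<le> t \<Longrightarrow> t \<le> T \<Longrightarrow> f t = f 0 + (LBINT s:{0..t}. f' s)"
  shows "primitive T f f'"
  unfolding primitive_def using assms by (metis atLeastAtMost_iff)

lemma primitive_integrable: "primitive T f f' \<Longrightarrow> t \<le> T \<Longrightarrow> set_integrable lborel {0..t} f'"
  unfolding primitive_def by (rule set_integrable_subset) auto

lemma primitiveD: "primitive T f f' \<Longrightarrow> 0 \<le> t \<Longrightarrow> t \<le> T \<Longrightarrow> f t = f 0 + (LBINT s:{0..t}. f' s)"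
  unfolding primitive_def by (metis atLeastAtMost_iff)

lemma primitive_const: "primitive T (\<lambda>_. c) (\<lambda>_. 0)"
  by (rule primitiveI) (simp_all add: set_integrable_def)

lemma primitive_add:
  assumes f: "primitive T f f'" and g: "primitive T g g'"
  shows "primitive T (\<lambda>t. f t + g t) (\<lambda>t. f' t + g' t)"
proof (rule primitiveI)
  fix t assume t: "0 \<le> t" "t \<le> T"
  show "f t + g t = f 0 + g 0 + (LBINT s:{0..t}. f' s + g' s)"
    using primitiveD[OF f t] primitiveD[OF g t] primitive_integrable[OF f t(2)] primitive_integrable[OF g t(2)]
    by (simp only: set_integral_add)
qed (use assms primitive_integrable in \<open>blast intro: set_integral_add\<close>)

lemma primitive_cmult:
  assumes f: "primitive T f f'"
  shows "primitive T (\<lambda>t. c * f t) (\<lambda>t. c * f' t)"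
proof (rule primitiveI)
  fix t assume t: "0 \<le> t" "t \<le> T"
  show "c * f t = c * f 0 + (LBINT s:{0..t}. c * f' s)"
    unfolding primitiveD[OF f t] by (simp add: distrib_left)
qed (use primitive_integrable[OF f order_refl] in simp)

lemma primitive_diff:
  assumes "primitive T f f'" "primitive T g g'"
  shows "primitive T (\<lambda>t. f t - g t) (\<lambda>t. f' t - g' t)"
  using primitive_add[OF assms(1) primitive_cmult[OF assms(2), of "-1"]] by simp

lemma primitive_sum:
  assumes "\<And>i. i \<in> I \<Longrightarrow> primitive T (f i) (f' i)"
  shows "primitive T (\<lambda>t. \<Sum>i\<in>I. f i t) (\<lambda>t. \<Sum>i\<in>I. f' i t)"
  using assms by (induction I rule: infinite_finite_induct) (auto intro: primitive_add primitive_const)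

lemma primitive_subset:
  assumes "primitive T f f'" "S \<le> T"
  shows "primitive S f f'"
  by (rule primitiveI) (use assms primitive_integrable primitiveD[OF assms(1)] in \<open>blast intro: order_trans\<close>)+

text \<open>The product rule. Both factors are initial value plus integral; multiplying out, the
  only nontrivial term is a product of two integrals, which \<open>fubini_triangle\<close>
  rewrites.\<close>

lemma primitive_mult:
  assumes f: "primitive T f f'" and g: "primitive T g g'"
  shows "primitive T (\<lambda>t. f t * g t) (\<lambda>t. f t * g' t + f' t * g t)"
proof -
  have *: "set_integrable lborel {0..t} (\<lambda>s. f s * g' s + f' s * g s) \<and>
      f t * g t = f 0 * g 0 + (LBINT s:{0..t}. f s * g' s + f' s * g s)" if t: "0 \<le> t" "t \<le> T" for t
  proof -
    \<comment> \<open>The densities are cut off outside \<open>{0..t}\<close> so that integrals over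
      half-lines and over the whole line can be used.\<close>
    define A B where "A = (\<lambda>s. indicator {0..t} s * f' s)" and "B = (\<lambda>s. indicator {0..t} s * g' s)"
    have A: "integrable lborel A" and B: "integrable lborel B"
      using primitive_integrable[OF f] primitive_integrable[OF g] t by (auto simp: A_def B_def set_integrable_def)
    have F: "f s = f 0 + (LBINT r:{..s}. A r)" if "s \<in> {0..t}" for s
    proof -
      have "(LBINT r:{..s}. A r) = (LBINT r:{0..s}. f' r)" unfolding set_lebesgue_integral_def A_def
        by (intro Bochner_Integration.integral_cong) (use that in \<open>auto simp: indicator_def\<close>)
      then show ?thesis using primitiveD[OF f, of s] that t by (metis atLeastAtMost_iff order_trans)
    qed
    have G: "g s = g 0 + (LBINT r:{..s}. B r)" if "s \<in> {0..t}" for s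
    proof -
      have "(LBINT r:{..s}. B r) = (LBINT r:{0..s}. g' r)" unfolding set_lebesgue_integral_def B_def
        by (intro Bochner_Integration.integral_cong) (use that in \<open>auto simp: indicator_def\<close>)
      then show ?thesis using primitiveD[OF g, of s] that t by (metis atLeastAtMost_iff order_trans)
    qed
    note tri = fubini_triangle[OF A B]
    have eq: "(\<lambda>s. indicator {0..t} s *\<^sub>R (f s * g' s + f' s * g s)) =
      (\<lambda>s. (f 0 * B s + g 0 * A s) + ((LBINT r:{..s}. A r) * B s + A s * (LBINT r:{..s}. B r)))"
    proof
      fix s show "indicator {0..t} s *\<^sub>R (f s * g' s + f' s * g s) = (f 0 * B s + g 0 * A s) + ((LBINT r:{..s}. A r) * B s + A s * (LBINT r:{..s}. B r))"
      proof (cases "s \<in> {0..t}")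
        case True
        have "A s = f' s" "B s = g' s" using True by (auto simp: A_def B_def)
        then show ?thesis using True by (simp add: F[OF True] G[OF True] algebra_simps)
      next
        case False
        then have "A s = 0" "B s = 0" by (auto simp: A_def B_def)
        then show ?thesis using False by simp
      qed
    qed
    have int: "set_integrable lborel {0..t} (\<lambda>s. f s * g' s + f' s * g s)"
      unfolding set_integrable_def eq using A B tri by (intro Bochner_Integration.integrable_add integrable_mult_right) auto
    have "(LBINT s:{0..t}. f s * g' s + f' s * g s) =
      (f 0 * (\<integral>s. B s \<partial>lborel) + g 0 * (\<integral>s. A s \<partial>lborel)) + (\<integral>s. A s \<partial>lborel) * (\<integral>s. B s \<partial>lborel)"
      unfolding set_lebesgue_integral_def[of _ "{0..t}"] eq tri(3) using A B tri by simp
    moreover have "f t = f 0 + (\<integral>s. A s \<partial>lborel)" "g t = g 0 + (\<integral>s. B s \<partial>lborel)"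
      using primitiveD[OF f t] primitiveD[OF g t] unfolding A_def B_def set_lebesgue_integral_def by simp_all
    ultimately show ?thesis using int by (simp add: algebra_simps)
  qed
  show ?thesis
  proof (rule primitiveI)
    show "set_integrable lborel {0..T} (\<lambda>t. f t * g' t + f' t * g t)"
      by (cases "0 \<le> T") (use * in \<open>auto simp: set_integrable_def\<close>)
  qed (use * in blast)
qed

text \<open>The densities are compared only for \<open>0 < s\<close>: time 0, where singular
  densities take default values, is a null set.\<close>

lemma primitive_mono:
  assumes f: "primitive T f f'" and g: "primitive T g g'"
    and le: "AE s in lborel. 0 < s \<longrightarrow> s \<le> T \<longrightarrow> f' s \<le> g' s" and t: "0 \<le> t" "t \<le> T"
  shows "f t - f 0 \<le> g t - g 0"
proof -
  have "(LBINT s:{0..t}. f' s) \<le> (LBINT s:{0..t}. g' s)"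
    by (rule set_integral_mono_AE)
      (use primitive_integrable[OF f] primitive_integrable[OF g] le AE_lborel_singleton[of 0] t in
        \<open>auto elim!: eventually_elim2 simp: less_eq_real_def\<close>)
  then show ?thesis using primitiveD[OF f t] primitiveD[OF g t] by linarith
qed

lemma primitive_abs_bound:
  assumes f: "primitive T f f'" and g: "primitive T g g'"
    and le: "AE s in lborel. 0 < s \<longrightarrow> s \<le> T \<longrightarrow> \<bar>f' s\<bar> \<le> g' s" and t: "0 \<le> t" "t \<le> T"
  shows "\<bar>f t - f 0\<bar> \<le> g t - g 0"
proof -
  have "f t - f 0 \<le> g t - g 0"
    by (rule primitive_mono[OF f g _ t]) (use le in \<open>auto elim!: eventually_mono\<close>)
  moreover have "- 1 * f t - - 1 * f 0 \<le> g t - g 0"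
    by (rule primitive_mono[OF primitive_cmult[OF f] g _ t]) (use le in \<open>auto elim!: eventually_mono\<close>)
  ultimately show ?thesis by linarith
qed

text \<open>Stopping the function at \<open>\<tau>\<close> switches its density off afterwards. This
  is how the repulsion is integrated over a short initial interval only.\<close>

lemma primitive_stop:
  assumes f: "primitive T f f'" and "0 \<le> \<tau>"
  shows "primitive T (\<lambda>t. f (min t \<tau>)) (\<lambda>s. indicator {0..\<tau>} s * f' s)"
proof (rule primitiveI)
  have "set_integrable lborel ({0..T} \<inter> {0..\<tau>}) f'"
    by (rule set_integrable_subset[OF primitive_integrable[OF f order_refl]]) auto
  moreover have "(\<lambda>x. indicator ({0..T} \<inter> {0..\<tau>}) x *\<^sub>R f' x) = (\<lambda>x. indicator {0..T} x *\<^sub>R (indicator {0..\<tau>} x * f' x))"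
    by (auto simp: indicator_def)
  ultimately show "set_integrable lborel {0..T} (\<lambda>s. indicator {0..\<tau>} s * f' s)"
    unfolding set_integrable_def by simp
  fix t assume t: "0 \<le> t" "t \<le> T"
  have "(LBINT s:{0..t}. indicator {0..\<tau>} s * f' s) = (LBINT s:{0..min t \<tau>}. f' s)"
    unfolding set_lebesgue_integral_def by (intro Bochner_Integration.integral_cong) (auto simp: indicator_def)
  then show "f (min t \<tau>) = f (min 0 \<tau>) + (LBINT s:{0..t}. indicator {0..\<tau>} s * f' s)"
    using primitiveD[OF f, of "min t \<tau>"] assms(2) t by (simp add: min_absorb1)
qed

lemma primitive_continuous:
  assumes "primitive T f f'"
  shows "continuous_on {0..T} f"
proof -
  have "f' integrable_on {0..T}" using assms by (auto simp: primitive_def dest: set_borel_integral_eq_integral)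
  then have "continuous_on {0..T} (\<lambda>t. f 0 + integral {0..t} f')"
    by (intro continuous_intros indefinite_integral_continuous_1)
  then show ?thesis
    by (rule continuous_on_eq)
      (simp only: atLeastAtMost_iff primitiveD[OF assms] set_borel_integral_eq_integral(2)[OF primitive_integrable[OF assms]])
qed

lemma set_integral_zero_interval: "(LBINT s:{0..0::real}. f s :: real) = 0"
proof -
  have "AE s in lborel. s \<noteq> (0::real)" by (rule AE_lborel_singleton)
  then have "AE s in lborel. indicator {0..0} s *\<^sub>R f s = 0"
    by eventually_elim (auto simp: indicator_def)
  then show ?thesis unfolding set_lebesgue_integral_def by (rule integral_eq_zero_AE)
qed

text \<open>For \<open>a < 1\<close> the density is unbounded at 0. The fundamental theorem is
  therefore applied on the open interval with one-sided limits at its ends, which are then added as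
  null sets.\<close>

lemma primitive_powr:
  assumes "0 < a"
  shows "primitive T (\<lambda>t. t powr a) (\<lambda>s. a * s powr (a - 1))"
proof -
  have *: "set_integrable lborel {0..t} (\<lambda>s. a * s powr (a - 1)) \<and> (LBINT s:{0..t}. a * s powr (a - 1)) = t powr a"
    if t: "0 < t" for t
  proof -
    have "set_integrable lborel (einterval 0 (ereal t)) (\<lambda>s. a * s powr (a - 1)) \<and>
       interval_lebesgue_integral lborel 0 (ereal t) (\<lambda>s. a * s powr (a - 1)) = t powr a - 0"
    proof (intro conjI; rule interval_integral_FTC_nonneg)
      have "((\<lambda>x. x powr a) \<longlongrightarrow> 0 powr a) (at_right 0)"
        by (rule tendsto_powr') (use assms in \<open>auto simp: eventually_at_filter intro: tendsto_ident_at\<close>)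
      then show "(((\<lambda>x. x powr a) \<circ> real_of_ereal) \<longlongrightarrow> 0) (at_right 0)"
        "(((\<lambda>x. x powr a) \<circ> real_of_ereal) \<longlongrightarrow> 0) (at_right 0)"
        unfolding zero_ereal_def ereal_tendsto_simps1 by simp_all
      have "((\<lambda>x. x powr a) \<longlongrightarrow> t powr a) (at_left t)"
        by (intro tendsto_intros) (use t in auto)
      then show "(((\<lambda>x. x powr a) \<circ> real_of_ereal) \<longlongrightarrow> t powr a) (at_left (ereal t))"
        "(((\<lambda>x. x powr a) \<circ> real_of_ereal) \<longlongrightarrow> t powr a) (at_left (ereal t))"
        unfolding ereal_tendsto_simps1 by simp_all
    qed (use t assms in \<open>auto intro!: derivative_eq_intros continuous_intros simp: zero_ereal_def\<close>)
    moreover have "einterval 0 (ereal t) = {0<..<t}" by (auto simp: einterval_def zero_ereal_def)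
    ultimately have 1: "set_integrable lborel {0<..<t} (\<lambda>s. a * s powr (a - 1))"
      and 2: "(LBINT s:{0<..<t}. a * s powr (a - 1)) = t powr a"
      using t by (auto simp: interval_lebesgue_integral_def zero_ereal_def)
    have ae: "AE s in lborel. indicator {0..t} s *\<^sub>R (a * s powr (a - 1)) = indicator {0<..<t} s *\<^sub>R (a * s powr (a - 1))"
      using AE_lborel_singleton[of 0] AE_lborel_singleton[of t] by eventually_elim (auto simp: indicator_def)
    have m: "(\<lambda>s. indicator {0..t} s *\<^sub>R (a * s powr (a - 1))) \<in> borel_measurable lborel"
      "(\<lambda>s. indicator {0<..<t} s *\<^sub>R (a * s powr (a - 1))) \<in> borel_measurable lborel" by measurable
    show ?thesis using 1 2 unfolding set_integrable_def set_lebesgue_integral_def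
      integral_cong_AE[OF m ae] integrable_cong_AE[OF m ae] by simp
  qed
  show ?thesis
  proof (rule primitiveI)
    show "set_integrable lborel {0..T} (\<lambda>s. a * s powr (a - 1))"
    proof (cases "0 < T")
      case True then show ?thesis using * by simp
    next
      case False
      then show ?thesis using *[of 1] by (auto intro!: set_integrable_subset[of lborel "{0..1}"])
    qed
    fix t :: real assume "0 \<le> t" "t \<le> T"
    show "t powr a = 0 powr a + (LBINT s:{0..t}. a * s powr (a - 1))"
    proof (cases "t = 0")
      case False then show ?thesis using *[of t] \<open>0 \<le> t\<close> by simp
    next
      case True
      then show ?thesis using assms set_integral_zero_interval[of "\<lambda>s. a * s powr (a - 1)"] by simp
    qed
  qed
qed

section \<open>Pathwise analysis of the equation\<close>

text \<open>Symmetrisation: pairing \<open>(i, j)\<close> with \<open>(j, i)\<close> turns forces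
  tested against \<open>c\<close> into a sum over relative quantities \<open>c i - c j\<close>,
  where the monotonicity of the repulsion becomes visible.\<close>

lemma double_sum_antisym:
  fixes h :: "nat \<Rightarrow> nat \<Rightarrow> real"
  assumes "\<And>i j. h j i = - h i j"
  shows "2 * (\<Sum>i\<in>{1..N}. c i * (\<Sum>j\<in>{1..N} - {i}. h i j)) = (\<Sum>i\<in>{1..N}. \<Sum>j\<in>{1..N} - {i}. (c i - c j) * h i j)"
proof -
  have "(\<Sum>i\<in>{1..N}. c i * (\<Sum>j\<in>{1..N} - {i}. h i j)) = (\<Sum>i\<in>{1..N}. \<Sum>j\<in>{1..N} - {i}. c i * h i j)"
    by (simp add: sum_distrib_left)
  moreover have "(\<Sum>i\<in>{1..N}. \<Sum>j\<in>{1..N} - {i}. c i * h i j) = (\<Sum>i\<in>{1..N}. \<Sum>j\<in>{1..N} - {i}. c j * h j i)"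
    by (rule sum_sum_remove)
  moreover have "(\<Sum>i\<in>{1..N}. \<Sum>j\<in>{1..N} - {i}. (c i - c j) * h i j) =
     (\<Sum>i\<in>{1..N}. \<Sum>j\<in>{1..N} - {i}. c i * h i j) + (\<Sum>i\<in>{1..N}. \<Sum>j\<in>{1..N} - {i}. c j * h j i)"
    unfolding sum.distrib[symmetric] by (intro sum.cong refl) (subst assms, simp add: algebra_simps)
  ultimately show ?thesis by linarith
qed

lemma hermite_zero_gap: "\<exists>g>0. \<forall>i\<in>{1..N}. \<forall>j\<in>{1..N}. i < j \<longrightarrow> g \<le> hermite_zero N j - hermite_zero N i"
proof -
  \<comment> \<open>The element 1 keeps the set nonempty when there are no pairs.\<close>
  define S where "S = insert 1 ((\<lambda>(i, j). hermite_zero N j - hermite_zero N i) ` ({1..N} \<times> {1..N} \<inter> {(i, j). i < j}))"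
  have S: "finite S" "S \<noteq> {}" by (auto simp: S_def)
  have "0 < x" if "x \<in> S" for x using that hermite_zero_less[of _ _ N] by (auto simp: S_def)
  then have "0 < Min S" using S by simp
  moreover have "Min S \<le> hermite_zero N j - hermite_zero N i" if "i \<in> {1..N}" "j \<in> {1..N}" "i < j" for i j
    by (rule Min_le[OF S(1)]) (use that in \<open>auto simp: S_def\<close>)
  ultimately show ?thesis by blast
qed

text \<open>The pathwise form of the equation, with noise amplitude \<open>\<epsilon> = sqrt (2 / \<beta>)\<close>.\<close>

definition driven :: "nat \<Rightarrow> real \<Rightarrow> real \<Rightarrow> (nat \<Rightarrow> real \<Rightarrow> real) \<Rightarrow> (nat \<Rightarrow> real \<Rightarrow> real) \<Rightarrow> bool" where
  "driven N T \<epsilon> w x \<longleftrightarrow>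
     (\<forall>i\<in>{1..N}. primitive T (\<lambda>t. x i t - \<epsilon> * w i t) (\<lambda>s. drift N (\<lambda>j. x j s) i)) \<and>
     (\<forall>i\<in>{1..N}. x i 0 = 0) \<and>
     (AE s in lborel. 0 < s \<longrightarrow> s \<le> T \<longrightarrow> (\<forall>i\<in>{1..N}. \<forall>j\<in>{1..N}. i < j \<longrightarrow> x i s < x j s))"

section \<open>A priori estimate against the noise-free flow\<close>

text \<open>The drift is homogeneous of degree -1, and the right-hand side is the time derivative of
  \<open>sqrt s * hermite_zero N i\<close>. So the scaled zeros solve the equation without
  noise.\<close>

lemma equilibrium_scaled:
  assumes "i \<in> {1..N}" "0 < s"
  shows "(\<Sum>j\<in>{1..N} - {i}. 1 / (s powr (1/2) * hermite_zero N i - s powr (1/2) * hermite_zero N j)) =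
    hermite_zero N i * (1 / 2 * s powr (1 / 2 - 1))"
proof -
  have "(\<Sum>j\<in>{1..N} - {i}. 1 / (s powr (1/2) * hermite_zero N i - s powr (1/2) * hermite_zero N j)) =
    (\<Sum>j\<in>{1..N} - {i}. s powr (-1/2) * (1 / (hermite_zero N i - hermite_zero N j)))"
    by (intro sum.cong refl) (simp add: right_diff_distrib[symmetric] powr_minus_divide del: powr_half_sqrt)
  also have "\<dots> = s powr (-1/2) * (hermite_zero N i / 2)"
    unfolding sum_distrib_left[symmetric] hermite_zero_equilibrium[OF assms(1)] ..
  finally show ?thesis by simp
qed

text \<open>The shift \<open>e \<ge> 0\<close> makes the product positive only where the perturbed gap \<open>\<alpha>\<close> exceeds the
  unperturbed gap \<open>\<beta>\<close>, so that no lower bound for \<open>\<alpha>\<close> is needed.\<close>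

lemma shifted_gap_product:
  fixes \<alpha> \<beta> e :: real
  assumes "0 < \<alpha>" "0 < \<beta>" "0 \<le> e"
  shows "(\<alpha> - \<beta> - e) * (1 / \<alpha> - 1 / \<beta>) \<le> (e / \<beta>) powr (3 / 2)"
proof -
  define u where "u = \<alpha> - \<beta>"
  have eq: "(\<alpha> - \<beta> - e) * (1 / \<alpha> - 1 / \<beta>) = (e - u) * u / (\<alpha> * \<beta>)"
    using assms by (simp add: u_def field_simps)
  show ?thesis
  proof (cases "0 < u \<and> u < e")
    case False
    then have "(e - u) * u \<le> 0" using assms by (auto simp: mult_le_0_iff not_less)
    then have "(e - u) * u / (\<alpha> * \<beta>) \<le> 0" using assms by (intro divide_nonpos_pos) auto
    then show ?thesis unfolding eq by (meson order_trans powr_ge_zero)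
  next
    case True
    \<comment> \<open>In the remaining case two bounds are available: \<open>v\<close>, from
      \<open>u \<le> \<alpha>\<close>, and the square of \<open>v\<close>, from
      \<open>\<beta> \<le> \<alpha>\<close>. The exponent 3/2 lies between 1 and 2, so one of them
      suffices on either side of \<open>v = 1\<close>.\<close>
    define v where "v = e / \<beta>"
    have v: "0 < v" using True assms by (simp add: v_def)
    have "(e - u) * u / (\<alpha> * \<beta>) \<le> e * \<alpha> / (\<alpha> * \<beta>)"
      using True assms by (intro divide_right_mono mult_mono) (auto simp: u_def)
    then have 1: "(e - u) * u / (\<alpha> * \<beta>) \<le> v" using assms by (simp add: v_def)
    have "(e - u) * u / (\<alpha> * \<beta>) \<le> e * e / (\<beta> * \<beta>)"
      using True assms by (intro frac_le mult_mono) (auto simp: u_def)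
    then have 2: "(e - u) * u / (\<alpha> * \<beta>) \<le> v powr 2" using v by (simp add: v_def power2_eq_square)
    show ?thesis
    proof (cases "v \<le> 1")
      case True
      have "v powr 2 \<le> v powr (3 / 2)" using True v by (intro powr_mono') auto
      then show ?thesis unfolding eq v_def[symmetric] using 2 by simp
    next
      case False
      have "v powr 1 \<le> v powr (3 / 2)" using False by (intro powr_mono) auto
      then show ?thesis unfolding eq v_def[symmetric] using 1 v by simp
    qed
  qed
qed

text \<open>The noise amplitude is written \<open>\<delta> ^ 8\<close> so that all the fractional powers of it that occur
  become integer powers of \<open>\<delta>\<close>. The constant shift \<open>k\<close> makes the perturbed gaps of the noise
  nonnegative, as \<open>shifted_gap_product\<close> requires; the exponent \<open>3 / 2\<close> there makes the bound
  integrable in time at \<open>0\<close>.\<close>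

lemma driven_a_priori:
  assumes w0: "\<And>i. i \<in> {1..N} \<Longrightarrow> w i 0 = 0"
    and wm: "\<And>i t. i \<in> {1..N} \<Longrightarrow> t \<in> {0..T} \<Longrightarrow> \<bar>w i t\<bar> \<le> m" and m: "0 \<le> m" and T: "0 \<le> T"
  shows "\<exists>C>0. \<forall>\<delta> x. 0 < \<delta> \<longrightarrow> \<delta> \<le> 1 \<longrightarrow> driven N T (\<delta> ^ 8) w x \<longrightarrow>
    (\<forall>i\<in>{1..N}. \<forall>t\<in>{0..T}. \<bar>x i t - sqrt t * hermite_zero N i\<bar> \<le> C * \<delta> ^ 6)"
proof -
  let ?z = "hermite_zero N"
  obtain g where g: "0 < g" "\<And>i j. i \<in> {1..N} \<Longrightarrow> j \<in> {1..N} \<Longrightarrow> i < j \<Longrightarrow> g \<le> ?z j - ?z i"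
    using hermite_zero_gap[of N] by blast
  \<comment> \<open>Consecutive shifts differ by \<open>2 * m\<close>, the largest possible value of
    \<open>w j - w i\<close>. The constant \<open>c\<close> below then bounds noise gap plus shift
    for every pair.\<close>
  define k where "k i = 2 * m * real i" for i :: nat
  define c where "c = 2 * m + 2 * m * real N"
  \<comment> \<open>Energy divided by \<open>\<delta> ^ 12\<close>: the initial energy caused by the
    shifts, plus the time integral \<open>4 * T powr (1 / 4)\<close> of
    \<open>s powr (- 3 / 4)\<close> for at most \<open>N * N\<close> pairs.\<close>
  define S where "S = (\<Sum>i\<in>{1..N}. (k i)\<^sup>2) + (real N)\<^sup>2 * (c / g) powr (3 / 2) * 4 * T powr (1 / 4)"
  define C where "C = sqrt S + m + 2 * m * real N + 1"
  have S0: "0 \<le> S" unfolding S_def using T by (intro add_nonneg_nonneg sum_nonneg mult_nonneg_nonneg) auto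
  have "0 < C" unfolding C_def using m S0 by (intro add_nonneg_pos add_nonneg_nonneg mult_nonneg_nonneg) auto
  moreover have "\<bar>x i t - sqrt t * ?z i\<bar> \<le> C * \<delta> ^ 6"
    if d: "0 < \<delta>" "\<delta> \<le> 1" and dr: "driven N T (\<delta> ^ 8) w x" and i: "i \<in> {1..N}" and t: "t \<in> {0..T}" for \<delta> x i t
  proof -
    \<comment> \<open>Subtracting the additive noise leaves an absolutely continuous function, so
      its energy obeys the ordinary product rule.\<close>
    define D where "D i t = (x i t - \<delta> ^ 8 * w i t) - ?z i * t powr (1 / 2) - \<delta> ^ 8 * k i" for i t
    define D' where "D' i s = drift N (\<lambda>j. x j s) i - ?z i * (1 / 2 * s powr (1 / 2 - 1)) - 0" for i s
    define K where "K = (real N)\<^sup>2 * ((c / g) powr (3 / 2) * \<delta> ^ 12)"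
    have D: "primitive T (D i) (D' i)" if "i \<in> {1..N}" for i
      unfolding D_def D'_def
      by (intro primitive_diff primitive_cmult primitive_const primitive_powr) (use dr that in \<open>auto simp: driven_def\<close>)
    have P: "primitive T (\<lambda>t. \<Sum>i\<in>{1..N}. D i t * D i t) (\<lambda>s. \<Sum>i\<in>{1..N}. D i s * D' i s + D' i s * D i s)"
      by (intro primitive_sum primitive_mult D) auto
    have Q: "primitive T (\<lambda>t. 4 * K * t powr (1 / 4)) (\<lambda>s. 4 * K * (1 / 4 * s powr (1 / 4 - 1)))"
      by (intro primitive_cmult primitive_powr) simp
    have pw: "(\<Sum>i\<in>{1..N}. D i s * D' i s + D' i s * D i s) \<le> 4 * K * (1 / 4 * s powr (1 / 4 - 1))"
      if s: "0 < s" "s \<le> T" and ord: "\<forall>i\<in>{1..N}. \<forall>j\<in>{1..N}. i < j \<longrightarrow> x i s < x j s" for s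
    proof -
      define y where "y i = s powr (1 / 2) * ?z i" for i
      define h where "h i j = 1 / (x i s - x j s) - 1 / (y i - y j)" for i j
      have anti: "h j i = - h i j" for i j
        using minus_divide_right[of 1 "x i s - x j s"] minus_divide_right[of 1 "y i - y j"] by (simp add: h_def)
      have D'h: "D' i s = (\<Sum>j\<in>{1..N} - {i}. h i j)" if "i \<in> {1..N}" for i
        unfolding D'_def h_def sum_subtractf drift_def equilibrium_scaled[OF that s(1), symmetric] y_def by simp
      have pair: "(D i s - D j s) * h i j \<le> (c / g) powr (3 / 2) * \<delta> ^ 12 * s powr (- 3 / 4)"
        if ij: "i \<in> {1..N}" "j \<in> {1..N}" "j < i" for i j
      proof -
        define e where "e = \<delta> ^ 8 * (w i s - w j s + k i - k j)"
        have ws: "\<bar>w i s\<bar> \<le> m" "\<bar>w j s\<bar> \<le> m" using wm ij s by auto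
        have kk: "2 * m \<le> k i - k j" "k i - k j \<le> 2 * m * real N"
        proof -
          have e: "k i - k j = 2 * m * (real i - real j)" by (simp add: k_def algebra_simps)
          have "2 * m * 1 \<le> 2 * m * (real i - real j)" "2 * m * (real i - real j) \<le> 2 * m * real N"
            using ij m by (intro mult_left_mono; force)+
          then show "2 * m \<le> k i - k j" "k i - k j \<le> 2 * m * real N" unfolding e by simp_all
        qed
        have e: "0 \<le> e" "e \<le> \<delta> ^ 8 * c" unfolding e_def c_def using d ws kk
          by (auto intro!: mult_nonneg_nonneg mult_left_mono)
        have y: "g * s powr (1 / 2) \<le> y i - y j"
          unfolding y_def right_diff_distrib[symmetric] using g(2)[of j i] ij s
          by (subst mult.commute) (intro mult_left_mono, auto)
        have gs: "0 < g * s powr (1 / 2)" using g s by simp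
        have "(D i s - D j s) * h i j = (x i s - x j s - (y i - y j) - e) * (1 / (x i s - x j s) - 1 / (y i - y j))"
          by (simp add: D_def e_def h_def y_def algebra_simps)
        also have "\<dots> \<le> (e / (y i - y j)) powr (3 / 2)"
          by (rule shifted_gap_product) (use ord ij y gs e in auto)
        also have "\<dots> \<le> (\<delta> ^ 8 * c / (g * s powr (1 / 2))) powr (3 / 2)"
          using e y gs by (intro powr_mono2 frac_le divide_nonneg_pos) auto
        also have "\<delta> ^ 8 * c / (g * s powr (1 / 2)) = (c / g) * (\<delta> ^ 8 * s powr (- 1 / 2))"
          using s by (simp add: powr_minus_divide del: powr_half_sqrt)
        also have "\<dots> powr (3 / 2) = (c / g) powr (3 / 2) * ((\<delta> ^ 8) powr (3 / 2) * (s powr (- 1 / 2)) powr (3 / 2))"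
          using m d g s by (subst powr_mult; simp add: c_def powr_mult)
        \<comment> \<open>The \<open>num\<close> terms in the instances below are the numerals 8 and
          12.\<close>
        also have "(\<delta> ^ 8) powr (3 / 2) = \<delta> ^ 12"
          using powr_powr[of \<delta> 8 "3 / 2"] powr_numeral[of \<delta> "num.Bit0 (num.Bit0 (num.Bit0 num.One))"]
            powr_numeral[of \<delta> "num.Bit0 (num.Bit0 (num.Bit1 num.One))"] d by simp
        also have "(s powr (- 1 / 2)) powr (3 / 2) = s powr (- 3 / 4)" by (simp add: powr_powr)
        finally show ?thesis by (simp add: mult.assoc)
      qed
      have "(\<Sum>i\<in>{1..N}. D i s * D' i s + D' i s * D i s) = 2 * (\<Sum>i\<in>{1..N}. D i s * (\<Sum>j\<in>{1..N} - {i}. h i j))"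
        unfolding sum_distrib_left[of 2] by (intro sum.cong refl) (use D'h in simp)
      also have "\<dots> = (\<Sum>i\<in>{1..N}. \<Sum>j\<in>{1..N} - {i}. (D i s - D j s) * h i j)"
        by (rule double_sum_antisym[OF anti])
      also have "\<dots> \<le> (\<Sum>i\<in>{1..N}. \<Sum>j\<in>{1..N}. (c / g) powr (3 / 2) * \<delta> ^ 12 * s powr (- 3 / 4))"
      proof (intro sum_mono order_trans[OF sum_mono sum_mono2])
        fix i j assume ij: "i \<in> {1..N}" "j \<in> {1..N} - {i}"
        show "(D i s - D j s) * h i j \<le> (c / g) powr (3 / 2) * \<delta> ^ 12 * s powr (- 3 / 4)"
        proof (cases "j < i")
          case True then show ?thesis using pair ij by blast
        next
          case False
          then have "(D j s - D i s) * h j i \<le> (c / g) powr (3 / 2) * \<delta> ^ 12 * s powr (- 3 / 4)"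
            using pair ij by force
          then show ?thesis unfolding anti[of j i] by (simp add: algebra_simps)
        qed
      qed (use d in auto)
      also have "\<dots> = 4 * K * (1 / 4 * s powr (1 / 4 - 1))"
        by (simp add: K_def power2_eq_square)
      finally show ?thesis .
    qed
    have "(\<Sum>i\<in>{1..N}. D i t * D i t) - (\<Sum>i\<in>{1..N}. D i 0 * D i 0) \<le> 4 * K * t powr (1 / 4) - 4 * K * 0 powr (1 / 4)"
    proof (rule primitive_mono[OF P Q])
      show "AE s in lborel. 0 < s \<longrightarrow> s \<le> T \<longrightarrow>
        (\<Sum>i\<in>{1..N}. D i s * D' i s + D' i s * D i s) \<le> 4 * K * (1 / 4 * s powr (1 / 4 - 1))"
        using dr[unfolded driven_def] pw by (auto elim!: eventually_mono)
    qed (use t in auto)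
    moreover have "(\<Sum>i\<in>{1..N}. D i 0 * D i 0) = (\<delta> ^ 8)\<^sup>2 * (\<Sum>i\<in>{1..N}. (k i)\<^sup>2)"
      unfolding sum_distrib_left
      by (intro sum.cong refl) (use dr w0 in \<open>auto simp: driven_def D_def power2_eq_square\<close>)
    moreover have "\<dots> \<le> \<delta> ^ 12 * (\<Sum>i\<in>{1..N}. (k i)\<^sup>2)"
      using d power_decreasing[of 12 16 \<delta>] by (intro mult_right_mono sum_nonneg) (auto simp flip: power_mult)
    moreover have "4 * K * t powr (1 / 4) \<le> 4 * K * T powr (1 / 4)"
      using t d by (intro mult_left_mono powr_mono2) (auto simp: K_def)
    moreover have "D i t * D i t \<le> (\<Sum>i\<in>{1..N}. D i t * D i t)"
      by (rule member_le_sum) (use i in auto)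
    ultimately have "(D i t)\<^sup>2 \<le> \<delta> ^ 12 * S"
      unfolding S_def K_def power2_eq_square[of "D i t"] by (simp add: algebra_simps)
    then have "\<bar>D i t\<bar> \<le> sqrt (\<delta> ^ 12 * S)" using real_sqrt_le_mono by fastforce
    also have "\<dots> = \<delta> ^ 6 * sqrt S"
      using d by (simp add: real_sqrt_mult real_sqrt_unique[of "\<delta> ^ 6"] flip: power_mult)
    finally have "\<bar>D i t\<bar> \<le> \<delta> ^ 6 * sqrt S" .
    moreover have "\<bar>\<delta> ^ 8 * (w i t + k i)\<bar> \<le> \<delta> ^ 6 * (m + 2 * m * real N)"
      unfolding abs_mult
    proof (intro mult_mono)
      have "2 * m * real i \<le> 2 * m * real N" "0 \<le> 2 * m * real i" using i m by (auto intro!: mult_left_mono)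
      then show "\<bar>w i t + k i\<bar> \<le> m + 2 * m * real N" using wm[OF i t] unfolding k_def by linarith
    qed (use d in \<open>auto intro: power_decreasing\<close>)
    moreover have "x i t - sqrt t * ?z i = D i t + \<delta> ^ 8 * (w i t + k i)"
      using t by (simp add: D_def powr_half_sqrt algebra_simps)
    moreover have "0 \<le> \<delta> ^ 6" using d by simp
    moreover have "C * \<delta> ^ 6 = \<delta> ^ 6 * sqrt S + \<delta> ^ 6 * (m + 2 * m * real N) + \<delta> ^ 6"
      by (simp add: C_def algebra_simps)
    ultimately show ?thesis by linarith
  qed
  ultimately show ?thesis by blast
qed

section \<open>Linearisation along the noise-free flow\<close>

text \<open>After time \<open>v ^ 4\<close> the gap \<open>\<alpha>\<close> is comparable to \<open>\<beta>\<close>; before, the singular force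
  \<open>1 / \<alpha>\<close> is only controlled by its time integral, through \<open>G\<close>.\<close>

lemma linearization_error_pair:
  fixes \<alpha> \<beta> g v s G :: real
  assumes \<alpha>: "0 < \<alpha>" and g: "0 < g" and v: "0 < v" and s: "0 < s"
    and \<beta>: "g * sqrt s \<le> \<beta>" and R: "\<bar>\<alpha> - \<beta>\<bar> \<le> g * v\<^sup>2 / 2" and G: "1 / \<alpha> \<le> G"
  shows "sqrt s * ((\<alpha> - \<beta>)\<^sup>2 / (\<alpha> * \<beta>\<^sup>2)) \<le> v\<^sup>2 * (indicator {0..v ^ 4} s * G) + v ^ 3 / (2 * g) * s powr (- 3 / 4)"
proof -
  have \<beta>0: "0 < \<beta>" using g s \<beta> by (meson less_le_trans mult_pos_pos real_sqrt_gt_zero)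
  \<comment> \<open>The fourth root of time makes all exponents integers and turns
    \<open>s \<le> v ^ 4\<close> into \<open>r \<le> v\<close>.\<close>
  define r where "r = s powr (1 / 4)"
  have r: "0 < r" "sqrt s = r\<^sup>2" "s = r ^ 4" "s powr (- 3 / 4) = 1 / r ^ 3"
  proof -
    show 0: "0 < r" using s by (simp add: r_def)
    show 4: "s = r ^ 4" using s unfolding r_def by (simp add: powr_power)
    show "sqrt s = r\<^sup>2" unfolding 4 using 0 by (simp add: real_sqrt_unique flip: power_mult)
    have "s powr (- 3 / 4) = 1 / (s powr (1 / 4)) powr 3" by (simp add: powr_powr powr_minus_divide)
    then show "s powr (- 3 / 4) = 1 / r ^ 3" using s by (simp add: r_def)
  qed
  have vr: "(s \<le> v ^ 4) = (r \<le> v)" unfolding r(3) using v r(1) by simp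
  have G0: "0 \<le> G" using G \<alpha> by (meson divide_pos_pos less_eq_real_def order_trans zero_less_one)
  show ?thesis
  proof (cases "r \<le> v")
    \<comment> \<open>In the early phase the quadratic remainder is expanded again into its Taylor
      terms, so that the uncontrolled \<open>1 / \<alpha>\<close> appears alone and can be replaced
      by \<open>G\<close>; the factor \<open>sqrt s\<close> is at most \<open>v\<close>
      squared.\<close>
    case True
    have "(\<alpha> - \<beta>)\<^sup>2 / (\<alpha> * \<beta>\<^sup>2) = 1 / \<alpha> - 1 / \<beta> + (\<alpha> - \<beta>) / \<beta>\<^sup>2"
      using \<alpha> \<beta>0 by (simp add: field_simps power2_eq_square)
    also have "\<dots> \<le> G + (g * v\<^sup>2 / 2) / (g * sqrt s)\<^sup>2"
    proof -
      have "(\<alpha> - \<beta>) / \<beta>\<^sup>2 \<le> (g * v\<^sup>2 / 2) / \<beta>\<^sup>2" using abs_le_D1[OF R] by (intro divide_right_mono) auto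
      also have "\<dots> \<le> (g * v\<^sup>2 / 2) / (g * sqrt s)\<^sup>2"
        using g s \<beta> v \<beta>0 by (intro divide_left_mono power_mono mult_pos_pos) auto
      finally show ?thesis using G \<beta>0 by (smt (verit) zero_le_divide_1_iff)
    qed
    finally have "sqrt s * ((\<alpha> - \<beta>)\<^sup>2 / (\<alpha> * \<beta>\<^sup>2)) \<le> sqrt s * (G + (g * v\<^sup>2 / 2) / (g * sqrt s)\<^sup>2)"
      using s by (intro mult_left_mono) auto
    also have "\<dots> = r\<^sup>2 * G + v\<^sup>2 * r / (2 * g) * (1 / r ^ 3)"
      unfolding r(2) using r(1) g by (simp add: field_simps power2_eq_square power3_eq_cube)
    also have "\<dots> \<le> v\<^sup>2 * G + v\<^sup>2 * v / (2 * g) * (1 / r ^ 3)"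
      using True r(1) g v G0 by (intro add_mono mult_right_mono divide_right_mono mult_left_mono power_mono) auto
    also have "\<dots> = v\<^sup>2 * (indicator {0..v ^ 4} s * G) + v ^ 3 / (2 * g) * s powr (- 3 / 4)"
      unfolding r(4) using vr True s by (simp add: power2_eq_square power3_eq_cube)
    finally show ?thesis .
  next
    case False
    have "g * v\<^sup>2 \<le> g * r\<^sup>2" using False v g by (intro mult_left_mono power_mono) auto
    then have "\<beta> / 2 \<le> \<alpha>" using R \<beta> unfolding r(2) by linarith
    then have den: "(\<beta> / 2) * \<beta>\<^sup>2 \<le> \<alpha> * \<beta>\<^sup>2" by (rule mult_right_mono) simp
    have num: "(\<alpha> - \<beta>)\<^sup>2 \<le> (g * v\<^sup>2 / 2)\<^sup>2" using power_mono[OF R abs_ge_zero, of 2] unfolding power2_abs .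
    have "(\<alpha> - \<beta>)\<^sup>2 / (\<alpha> * \<beta>\<^sup>2) \<le> (g * v\<^sup>2 / 2)\<^sup>2 / ((\<beta> / 2) * \<beta>\<^sup>2)"
      by (rule frac_le[OF _ num _ den]) (use \<beta>0 in simp_all)
    also have "\<dots> = (g * v\<^sup>2 / 2)\<^sup>2 * 2 / \<beta> ^ 3" by (simp add: power2_eq_square power3_eq_cube)
    also have "\<dots> \<le> (g * v\<^sup>2 / 2)\<^sup>2 * 2 / (g * sqrt s) ^ 3"
      using g s \<beta> \<beta>0 by (intro divide_left_mono power_mono mult_pos_pos) auto
    finally have "sqrt s * ((\<alpha> - \<beta>)\<^sup>2 / (\<alpha> * \<beta>\<^sup>2)) \<le> sqrt s * ((g * v\<^sup>2 / 2)\<^sup>2 * 2 / (g * sqrt s) ^ 3)"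
      using s by (intro mult_left_mono) auto
    also have "\<dots> = v ^ 3 / (2 * g) * (1 / r ^ 3) * (v / r)"
      unfolding r(2) using r(1) g by (simp add: field_simps power2_eq_square power3_eq_cube)
    \<comment> \<open>The bound so far is of order \<open>1 / s\<close>, which is not integrable at
      0. Giving up the factor \<open>v / r < 1\<close> reduces it to the integrable
      \<open>s powr (- 3 / 4)\<close> at the price of one power of \<open>v\<close>.\<close>
    also have "\<dots> \<le> v ^ 3 / (2 * g) * (1 / r ^ 3) * 1"
      using False r(1) g v by (intro mult_left_mono) auto
    also have "\<dots> = v\<^sup>2 * (indicator {0..v ^ 4} s * G) + v ^ 3 / (2 * g) * s powr (- 3 / 4)"
      unfolding r(4) using vr False by simp
    finally show ?thesis .
  qed
qed

text \<open>\<open>h\<close> is bounded on the compact interval, so the product is dominated by the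
  integrable weight even where the weight is unbounded.\<close>

lemma primitive_powr_mult:
  assumes "0 < a" and h: "continuous_on {0..T} h"
  shows "primitive T (\<lambda>t. LBINT s:{0..t}. a * s powr (a - 1) * h s) (\<lambda>s. a * s powr (a - 1) * h s)"
proof (rule primitiveI)
  have "compact (h ` {0..T})" by (rule compact_continuous_image[OF h]) simp
  then obtain M where M: "\<And>s. s \<in> {0..T} \<Longrightarrow> \<bar>h s\<bar> \<le> M"
    by (fastforce dest!: compact_imp_bounded simp: bounded_iff)
  show "set_integrable lborel {0..T} (\<lambda>s. a * s powr (a - 1) * h s)"
  proof (rule set_integrable_bound)
    show "set_integrable lborel {0..T} (\<lambda>s. M * (a * s powr (a - 1)))"
      using primitive_integrable[OF primitive_powr[OF assms(1)] order_refl, of T] by simp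
    have "(\<lambda>s. indicator {0..T} s *\<^sub>R h s) \<in> borel_measurable lborel"
      using borel_measurable_continuous_on_indicator[OF _ h] by simp
    then have "(\<lambda>s. (a * s powr (a - 1)) * (indicator {0..T} s *\<^sub>R h s)) \<in> borel_measurable lborel" by measurable
    then show "set_borel_measurable lborel {0..T} (\<lambda>s. a * s powr (a - 1) * h s)"
      unfolding set_borel_measurable_def by (simp add: mult_ac)
    show "AE s in lborel. s \<in> {0..T} \<longrightarrow> norm (a * s powr (a - 1) * h s) \<le> norm (M * (a * s powr (a - 1)))"
    proof (intro AE_I2 impI)
      fix s assume "s \<in> {0..T}"
      from M[OF this] have "\<bar>h s\<bar> * (a * s powr (a - 1)) \<le> \<bar>M\<bar> * (a * s powr (a - 1))"
        using assms(1) by (intro mult_right_mono) auto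
      then show "norm (a * s powr (a - 1) * h s) \<le> norm (M * (a * s powr (a - 1)))"
        using assms(1) by (simp add: abs_mult mult_ac)
    qed
  qed
next
  fix t :: real
  show "(LBINT s:{0..t}. a * s powr (a - 1) * h s) =
      (LBINT s:{0..0}. a * s powr (a - 1) * h s) + (LBINT s:{0..t}. a * s powr (a - 1) * h s)"
    unfolding set_integral_zero_interval by simp
qed

text \<open>The driving path tested against the \<open>n\<close>-th eigenvector of the linearised
  drift, without normalisation.\<close>

definition q_noise :: "nat \<Rightarrow> nat \<Rightarrow> (nat \<Rightarrow> real \<Rightarrow> real) \<Rightarrow> real \<Rightarrow> real" where
  "q_noise N n w t = (\<Sum>i\<in>{1..N}. poly (q_poly N n) (hermite_zero N i) * w i t)"

text \<open>The Wiener integral of \<open>sqrt s ^ n\<close> against \<open>q_noise N n w / sqrt N\<close>, integrated by parts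
  to make it a functional of each single path.\<close>

definition limit_path :: "nat \<Rightarrow> nat \<Rightarrow> (nat \<Rightarrow> real \<Rightarrow> real) \<Rightarrow> real \<Rightarrow> real" where
  "limit_path N n w t =
     (sqrt t ^ n * q_noise N n w t - (LBINT s:{0..t}. real n / 2 * s powr (real n / 2 - 1) * q_noise N n w s)) / sqrt N"

text \<open>The mode with eigenvalue 0: the repulsions cancel in the sum, so the centre of mass
  follows the noise without any error. It is separate because the weight of this mode has exponent
  0, outside the reach of \<open>primitive_powr\<close>.\<close>

lemma driven_linearization_0:
  assumes "driven N T \<epsilon> w x" "t \<in> {0..T}" and w0: "\<And>i. i \<in> {1..N} \<Longrightarrow> w i 0 = 0"
  shows "(\<Sum>i\<in>{1..N}. x i t - sqrt t * hermite_zero N i) = \<epsilon> * (\<Sum>i\<in>{1..N}. w i t)"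
proof -
  have anti: "(\<Sum>i\<in>{1..N}. \<Sum>j\<in>{1..N} - {i}. 1 / (u i - u j)) = 0" for u :: "nat \<Rightarrow> real"
  proof -
    have "1 / (u j - u i) = - (1 / (u i - u j))" for i j by (simp flip: divide_minus_right)
    from double_sum_antisym[OF this, where c = "\<lambda>_. 1"] show ?thesis by simp
  qed
  have "primitive T (\<lambda>t. \<Sum>i\<in>{1..N}. x i t - \<epsilon> * w i t) (\<lambda>s. \<Sum>i\<in>{1..N}. drift N (\<lambda>j. x j s) i)"
    using assms(1) by (intro primitive_sum) (auto simp: driven_def)
  then have "primitive T (\<lambda>t. \<Sum>i\<in>{1..N}. x i t - \<epsilon> * w i t) (\<lambda>s. 0)"
    unfolding drift_def anti .
  from primitiveD[OF this, of t] have "(\<Sum>i\<in>{1..N}. x i t - \<epsilon> * w i t) = (\<Sum>i\<in>{1..N}. x i 0 - \<epsilon> * w i 0)"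
    using assms(2) by simp
  also have "\<dots> = 0" using assms(1) w0 by (simp add: driven_def)
  finally have "(\<Sum>i\<in>{1..N}. x i t) = \<epsilon> * (\<Sum>i\<in>{1..N}. w i t)" by (simp add: sum_subtractf sum_distrib_left)
  moreover have "(\<Sum>i\<in>{1..N}. hermite_zero N i) = 0"
  proof -
    have "(\<Sum>i\<in>{1..N}. hermite_zero N i / 2) = 0"
      unfolding anti[of "hermite_zero N", symmetric]
      by (intro sum.cong refl) (rule hermite_zero_equilibrium[symmetric])
    then show ?thesis by (simp flip: sum_divide_distrib)
  qed
  ultimately show ?thesis by (simp add: sum_subtractf flip: sum_distrib_left)
qed

text \<open>With the integrating factor \<open>s powr (n / 2)\<close> the projected equation loses
  its singular linear term, and what remains besides noise is the quadratic Taylor remainder of the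
  drift. Integrating the pair estimate shows that it contributes only order
  \<open>\<delta> ^ 9\<close>.\<close>

lemma driven_linearization:
  assumes w0: "\<And>i. i \<in> {1..N} \<Longrightarrow> w i 0 = 0"
    and wc: "\<And>i. i \<in> {1..N} \<Longrightarrow> continuous_on {0..T} (w i)"
    and wm: "\<And>i t. i \<in> {1..N} \<Longrightarrow> t \<in> {0..T} \<Longrightarrow> \<bar>w i t\<bar> \<le> m" and m: "0 \<le> m"
    and T: "0 \<le> T" and n: "1 \<le> n" and C: "0 < C"
    and ap: "\<And>\<delta> x i t. 0 < \<delta> \<Longrightarrow> \<delta> \<le> 1 \<Longrightarrow> driven N T (\<delta> ^ 8) w x \<Longrightarrow> i \<in> {1..N} \<Longrightarrow> t \<in> {0..T} \<Longrightarrow>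
        \<bar>x i t - sqrt t * hermite_zero N i\<bar> \<le> C * \<delta> ^ 6"
  shows "\<exists>K. \<forall>\<delta> x t. 0 < \<delta> \<longrightarrow> \<delta> \<le> 1 \<longrightarrow> driven N T (\<delta> ^ 8) w x \<longrightarrow> t \<in> {0..T} \<longrightarrow>
     \<bar>sqrt t ^ n * (\<Sum>i\<in>{1..N}. poly (q_poly N n) (hermite_zero N i) * (x i t - sqrt t * hermite_zero N i)) / \<delta> ^ 8
       - (sqrt t ^ n * q_noise N n w t - (LBINT s:{0..t}. real n / 2 * s powr (real n / 2 - 1) * q_noise N n w s))\<bar> \<le> K * \<delta>"
proof -
  let ?z = "hermite_zero N"
  define q where "q i = poly (q_poly N n) (?z i)" for i
  define h where "h = q_noise N n w"
  obtain g where g: "0 < g" "\<And>i j. i \<in> {1..N} \<Longrightarrow> j \<in> {1..N} \<Longrightarrow> i < j \<Longrightarrow> g \<le> ?z j - ?z i"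
    using hermite_zero_gap[of N] by blast
  define H where "H t = (LBINT s:{0..t}. real n / 2 * s powr (real n / 2 - 1) * h s)" for t
  have hc: "continuous_on {0..T} h" unfolding h_def q_noise_def by (intro continuous_intros wc) auto
  have H: "primitive T H (\<lambda>s. real n / 2 * s powr (real n / 2 - 1) * h s)"
    unfolding H_def using n hc by (intro primitive_powr_mult) auto
  define Q where "Q = (\<Sum>i\<in>{1..N}. \<bar>q i\<bar>)"
  have Q: "\<bar>q i\<bar> \<le> Q" if "i \<in> {1..N}" for i unfolding Q_def by (rule member_le_sum) (use that in auto)
  have Q0: "0 \<le> Q" unfolding Q_def by (intro sum_nonneg) auto
  define Z where "Z = (\<Sum>i\<in>{1..N}. \<bar>?z i\<bar>)"
  have Z: "\<bar>?z i\<bar> \<le> Z" if "i \<in> {1..N}" for i unfolding Z_def by (rule member_le_sum) (use that in auto)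
  have Z0: "0 \<le> Z" unfolding Z_def by (intro sum_nonneg) auto
  \<comment> \<open>Bounds the weight after one factor \<open>sqrt s\<close> has been split off;
    that factor is reserved for the singular pair estimate.\<close>
  define S where "S = T powr ((real n - 1) / 2)"
  \<comment> \<open>Chosen such that, with \<open>v = \<delta> ^ 3 * a\<close>, half of
    \<open>g\<close> times the square of \<open>v\<close> equals
    \<open>2 * C * \<delta> ^ 6\<close>, the a priori bound for the error of a gap.\<close>
  define a where "a = sqrt (4 * C / g)"
  have a: "0 < a" "a\<^sup>2 = 4 * C / g" using C g by (auto simp: a_def)
  define C5 where "C5 = (real N)\<^sup>2 * (C + a\<^sup>2 * Z + m)"
  define K where "K = Q * (S * (real N)\<^sup>2) * (a\<^sup>2 * C5 + a ^ 3 / (2 * g) * 4 * T powr (1 / 4))"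
  have "\<bar>sqrt t ^ n * (\<Sum>i\<in>{1..N}. q i * (x i t - sqrt t * ?z i)) / \<delta> ^ 8
       - (sqrt t ^ n * h t - H t)\<bar> \<le> K * \<delta>"
    if d: "0 < \<delta>" "\<delta> \<le> 1" and dr: "driven N T (\<delta> ^ 8) w x" and t: "t \<in> {0..T}" for \<delta> x t
  proof -
    define v where "v = \<delta> ^ 3 * a"
    have v: "0 < v" "v\<^sup>2 = \<delta> ^ 6 * a\<^sup>2" "v ^ 3 = \<delta> ^ 9 * a ^ 3" using d a
      by (auto simp: v_def power_mult_distrib simp flip: power_mult)
    define A where "A i t = (x i t - \<delta> ^ 8 * w i t) - ?z i * t powr (1 / 2)" for i t
    define A' where "A' i s = drift N (\<lambda>j. x j s) i - ?z i * (1 / 2 * s powr (1 / 2 - 1))" for i s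
    have A: "primitive T (A i) (A' i)" if "i \<in> {1..N}" for i
      unfolding A_def A'_def
      by (intro primitive_diff primitive_cmult primitive_powr) (use dr that in \<open>auto simp: driven_def\<close>)
    \<comment> \<open>This is the weighted projection of the deviation minus
      \<open>\<delta> ^ 8\<close> times its expected limit. Since the noise is subtracted inside
      \<open>A\<close>, \<open>W\<close> is absolutely continuous.\<close>
    define W where "W t = t powr (real n / 2) * (\<Sum>i\<in>{1..N}. q i * A i t) + \<delta> ^ 8 * H t" for t
    define W' where "W' s = s powr (real n / 2) * (\<Sum>i\<in>{1..N}. q i * A' i s) +
      (real n / 2 * s powr (real n / 2 - 1)) * (\<Sum>i\<in>{1..N}. q i * A i s) +
      \<delta> ^ 8 * (real n / 2 * s powr (real n / 2 - 1) * h s)" for s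
    have W: "primitive T W W'" unfolding W_def W'_def
      by (intro primitive_add primitive_mult primitive_cmult primitive_sum H primitive_powr A) (use n in auto)
    \<comment> \<open>The weights \<open>real i\<close> make all contributions to \<open>G\<close>
      nonnegative after symmetrisation: they become \<open>(i - j) / (x i - x j)\<close>. Hence
      every single repulsion is at most \<open>G\<close>, while the integral of \<open>G\<close> is
      the explicit quantity \<open>\<Gamma>\<close>.\<close>
    define G where "G s = (\<Sum>i\<in>{1..N}. real i * drift N (\<lambda>j. x j s) i)" for s
    define \<Gamma> where "\<Gamma> t = (\<Sum>i\<in>{1..N}. real i * (x i t - \<delta> ^ 8 * w i t))" for t
    have \<Gamma>: "primitive T \<Gamma> G" unfolding \<Gamma>_def G_def
      by (intro primitive_sum primitive_cmult) (use dr in \<open>auto simp: driven_def\<close>)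
    define \<Phi>' where "\<Phi>' s = Q * (S * (real N)\<^sup>2) * (v\<^sup>2 * (indicator {0..v ^ 4} s * G s) + v ^ 3 / (2 * g) * 4 * (1 / 4 * s powr (1 / 4 - 1)))" for s
    define \<Phi> where "\<Phi> t = Q * (S * (real N)\<^sup>2) * (v\<^sup>2 * \<Gamma> (min t (v ^ 4)) + v ^ 3 / (2 * g) * 4 * t powr (1 / 4))" for t
    have \<Phi>: "primitive T \<Phi> \<Phi>'" unfolding \<Phi>_def \<Phi>'_def
      by (intro primitive_add primitive_cmult primitive_stop \<Gamma> primitive_powr) (use v in auto)
    have pw: "\<bar>W' s\<bar> \<le> \<Phi>' s"
      if s: "0 < s" "s \<le> T" and ord: "\<forall>i\<in>{1..N}. \<forall>j\<in>{1..N}. i < j \<longrightarrow> x i s < x j s" for s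
    proof -
      have sq: "s powr (1 / 2) = sqrt s" using s by (simp add: powr_half_sqrt)
      define y where "y i = sqrt s * ?z i" for i
      define \<alpha> \<beta> where "\<alpha> i j = x i s - x j s" and "\<beta> i j = y i - y j" for i j
      define E where "E i j = (\<alpha> i j - \<beta> i j)\<^sup>2 / (\<alpha> i j * (\<beta> i j)\<^sup>2)" for i j
      have ne: "\<alpha> i j \<noteq> 0" "\<beta> i j \<noteq> 0" if "i \<in> {1..N}" "j \<in> {1..N} - {i}" for i j
      proof -
        have "i < j \<or> j < i" using that by auto
        then have "x i s < x j s \<or> x j s < x i s" using ord that by blast
        then show "\<alpha> i j \<noteq> 0" by (auto simp: \<alpha>_def)
        show "\<beta> i j \<noteq> 0" using \<open>i < j \<or> j < i\<close> hermite_zero_less[of i j N] hermite_zero_less[of j i N] that s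
          by (auto simp: \<beta>_def y_def)
      qed
      \<comment> \<open>An exact Taylor formula: the remainder \<open>E\<close> is kept in closed
        form, and scaling extracts the factor \<open>1 / s\<close> from the linear part.\<close>
      have A'E: "A' i s = (\<Sum>j\<in>{1..N} - {i}. E i j) - (1 / s) * (\<Sum>j\<in>{1..N} - {i}. ((x i s - y i) - (x j s - y j)) / (?z i - ?z j)\<^sup>2)"
        if i: "i \<in> {1..N}" for i
      proof -
        have "A' i s = (\<Sum>j\<in>{1..N} - {i}. 1 / \<alpha> i j - 1 / \<beta> i j)"
          unfolding A'_def sum_subtractf drift_def equilibrium_scaled[OF i s(1), symmetric] sq \<alpha>_def \<beta>_def y_def by simp
        also have "\<dots> = (\<Sum>j\<in>{1..N} - {i}. E i j - (1 / s) * (((x i s - y i) - (x j s - y j)) / (?z i - ?z j)\<^sup>2))"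
        proof (intro sum.cong refl)
          fix j assume j: "j \<in> {1..N} - {i}"
          have "1 / \<alpha> i j - 1 / \<beta> i j = E i j - (\<alpha> i j - \<beta> i j) / (\<beta> i j)\<^sup>2"
            unfolding E_def using ne[OF i j] by (simp add: field_simps power2_eq_square)
          also have "(\<beta> i j)\<^sup>2 = s * (?z i - ?z j)\<^sup>2"
            unfolding \<beta>_def y_def right_diff_distrib[symmetric] power_mult_distrib using s by simp
          also have "\<alpha> i j - \<beta> i j = (x i s - y i) - (x j s - y j)" by (simp add: \<alpha>_def \<beta>_def)
          finally show "1 / \<alpha> i j - 1 / \<beta> i j = E i j - (1 / s) * (((x i s - y i) - (x j s - y j)) / (?z i - ?z j)\<^sup>2)"
            by simp
        qed
        finally show ?thesis unfolding sum_subtractf sum_distrib_left .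
      qed
      have Ai: "A i s = (x i s - y i) - \<delta> ^ 8 * w i s" for i
        unfolding A_def y_def sq by simp
      have "(\<Sum>i\<in>{1..N}. q i * A' i s) = (\<Sum>i\<in>{1..N}. q i * (\<Sum>j\<in>{1..N} - {i}. E i j))
         - (1 / s) * (\<Sum>i\<in>{1..N}. q i * (\<Sum>j\<in>{1..N} - {i}. ((x i s - y i) - (x j s - y j)) / (?z i - ?z j)\<^sup>2))"
        unfolding sum_distrib_left[of "1 / s"] sum_subtractf[symmetric]
        by (intro sum.cong refl) (simp only: A'E, simp add: algebra_simps)
      also have "(\<Sum>i\<in>{1..N}. q i * (\<Sum>j\<in>{1..N} - {i}. ((x i s - y i) - (x j s - y j)) / (?z i - ?z j)\<^sup>2)) =
          real n / 2 * (\<Sum>i\<in>{1..N}. q i * (x i s - y i))"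
        unfolding q_def by (rule q_poly_eigen_sum)
      also have "(\<Sum>i\<in>{1..N}. q i * (x i s - y i)) = (\<Sum>i\<in>{1..N}. q i * A i s) + \<delta> ^ 8 * h s"
        unfolding Ai h_def q_noise_def q_def[symmetric] sum_distrib_left sum.distrib[symmetric]
        by (intro sum.cong refl) (simp add: algebra_simps)
      finally have qA': "(\<Sum>i\<in>{1..N}. q i * A' i s) = (\<Sum>i\<in>{1..N}. q i * (\<Sum>j\<in>{1..N} - {i}. E i j))
         - (1 / s) * (real n / 2 * ((\<Sum>i\<in>{1..N}. q i * A i s) + \<delta> ^ 8 * h s))" .
      have sp: "s powr (real n / 2 - 1) = s powr (real n / 2) * (1 / s)"
        using s by (simp add: powr_diff)
      \<comment> \<open>The derivative of the weight cancels the linear part, and the derivative of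
        \<open>H\<close> cancels the noise that the linear part had picked up.\<close>
      have W'E: "W' s = s powr (real n / 2) * (\<Sum>i\<in>{1..N}. q i * (\<Sum>j\<in>{1..N} - {i}. E i j))"
        unfolding W'_def qA' sp by (simp add: algebra_simps)
      have Gge: "1 / \<alpha> i j \<le> G s" if ij: "i \<in> {1..N}" "j \<in> {1..N}" "j < i" for i j
      proof -
        define f where "f i j = (real i - real j) * (1 / \<alpha> i j)" for i j
        have "1 / \<alpha> j i = - (1 / \<alpha> i j)" for i j
          unfolding \<alpha>_def by (simp flip: divide_minus_right)
        from double_sum_antisym[OF this, where c = real]
        have G2: "2 * G s = (\<Sum>i\<in>{1..N}. \<Sum>j\<in>{1..N} - {i}. f i j)" by (simp add: G_def drift_def \<alpha>_def f_def)
        have f0: "0 \<le> f i j" if "i \<in> {1..N}" "j \<in> {1..N} - {i}" for i j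
        proof (cases "i < j")
          case True
          then have "\<alpha> i j < 0" using ord that by (auto simp: \<alpha>_def)
          then show ?thesis using True unfolding f_def by (intro mult_nonpos_nonpos) auto
        next
          case False
          then have "0 < \<alpha> i j" using ord that by (auto simp: \<alpha>_def)
          then show ?thesis using False unfolding f_def by (intro mult_nonneg_nonneg) auto
        qed
        have 1: "1 / \<alpha> i j \<le> f i j" "f j i = f i j"
        proof -
          have "0 < \<alpha> i j" using ord ij by (auto simp: \<alpha>_def)
          then have "1 * (1 / \<alpha> i j) \<le> f i j" unfolding f_def using ij by (intro mult_right_mono) auto
          then show "1 / \<alpha> i j \<le> f i j" by simp
          have "\<alpha> j i = - \<alpha> i j" by (simp add: \<alpha>_def)
          then have "f j i = (real j - real i) * (1 / - \<alpha> i j)" by (simp only: f_def)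
          also have "\<dots> = f i j" unfolding f_def using \<open>0 < \<alpha> i j\<close> by (simp add: field_simps)
          finally show "f j i = f i j" .
        qed
        have *: "f i j \<le> (\<Sum>j\<in>{1..N} - {i}. f i j)" if "i \<in> {1..N}" "j \<in> {1..N} - {i}" for i j
          by (rule member_le_sum) (use that f0 in auto)
        have "(\<Sum>k\<in>{i, j}. \<Sum>j\<in>{1..N} - {k}. f k j) \<le> (\<Sum>i\<in>{1..N}. \<Sum>j\<in>{1..N} - {i}. f i j)"
        proof (rule sum_mono2)
          show "0 \<le> (\<Sum>j\<in>{1..N} - {b}. f b j)" if "b \<in> {1..N} - {i, j}" for b
            by (rule sum_nonneg, rule f0) (use that in auto)
        qed (use ij in auto)
        then have "f i j + f j i \<le> 2 * G s" unfolding G2 using *[of i j] *[of j i] ij by auto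
        then show ?thesis using 1 by simp
      qed
      have pair: "sqrt s * \<bar>E i j\<bar> \<le> v\<^sup>2 * (indicator {0..v ^ 4} s * G s) + v ^ 3 / (2 * g) * s powr (- 3 / 4)"
        if ij: "i \<in> {1..N}" "j \<in> {1..N}" "j < i" for i j
      proof -
        have \<alpha>: "0 < \<alpha> i j" using ord ij by (auto simp: \<alpha>_def)
        have "\<bar>x i s - y i\<bar> \<le> C * \<delta> ^ 6" "\<bar>x j s - y j\<bar> \<le> C * \<delta> ^ 6"
          using ap[OF d dr] ij s unfolding y_def by auto
        then have "\<bar>\<alpha> i j - \<beta> i j\<bar> \<le> 2 * (C * \<delta> ^ 6)" unfolding \<alpha>_def \<beta>_def by linarith
        also have "\<dots> = g * v\<^sup>2 / 2" unfolding v(2) a(2) using g by simp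
        finally have R: "\<bar>\<alpha> i j - \<beta> i j\<bar> \<le> g * v\<^sup>2 / 2" .
        have \<beta>: "g * sqrt s \<le> \<beta> i j" unfolding \<beta>_def y_def right_diff_distrib[symmetric]
          using g(2)[of j i] ij s by (subst mult.commute) (intro mult_left_mono, auto)
        have "0 \<le> E i j" unfolding E_def using \<alpha> by simp
        then have "\<bar>E i j\<bar> = E i j" by simp
        then show ?thesis using linearization_error_pair[OF \<alpha> g(1) v(1) s(1) \<beta> R Gge[OF ij]]
          unfolding E_def by (simp only:)
      qed
      define B where "B = v\<^sup>2 * (indicator {0..v ^ 4} s * G s) + v ^ 3 / (2 * g) * s powr (- 3 / 4)"
      have pair': "sqrt s * \<bar>E i j\<bar> \<le> B" if "i \<in> {1..N}" "j \<in> {1..N} - {i}" for i j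
      proof (cases "j < i")
        case True then show ?thesis using pair that unfolding B_def by auto
      next
        case False
        have neg: "\<alpha> i j = - \<alpha> j i" "\<beta> i j = - \<beta> j i" by (simp_all add: \<alpha>_def \<beta>_def)
        have "(- \<alpha> j i - - \<beta> j i)\<^sup>2 = (\<alpha> j i - \<beta> j i)\<^sup>2" by (simp add: power2_eq_square algebra_simps)
        then have "\<bar>E i j\<bar> = \<bar>E j i\<bar>" unfolding E_def neg abs_divide abs_mult by simp
        then show ?thesis using pair[of j i] that False unfolding B_def by auto
      qed
      have B0: "0 \<le> B" if "i \<in> {1..N}" "j \<in> {1..N} - {i}" for i j
        using pair'[OF that] s by (meson abs_ge_zero mult_nonneg_nonneg order_trans real_sqrt_ge_zero less_imp_le)
      have "sqrt s * \<bar>\<Sum>i\<in>{1..N}. q i * (\<Sum>j\<in>{1..N} - {i}. E i j)\<bar> \<le> sqrt s * (\<Sum>i\<in>{1..N}. \<Sum>j\<in>{1..N} - {i}. Q * \<bar>E i j\<bar>)"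
        unfolding sum_distrib_left[of "q _"]
        by (intro mult_left_mono order_trans[OF sum_abs] sum_mono)
          (use Q s in \<open>auto simp: abs_mult intro!: mult_right_mono\<close>)
      also have "\<dots> = (\<Sum>i\<in>{1..N}. \<Sum>j\<in>{1..N} - {i}. Q * (sqrt s * \<bar>E i j\<bar>))"
        by (simp add: sum_distrib_left mult_ac)
      also have "\<dots> \<le> (\<Sum>i\<in>{1..N}. \<Sum>j\<in>{1..N} - {i}. Q * B)"
        by (intro sum_mono mult_left_mono pair' Q0)
      also have "\<dots> \<le> Q * ((real N)\<^sup>2 * B)"
      proof (cases "\<exists>i\<in>{1..N}. {1..N} - {i} \<noteq> {}")
        case True
        then have "0 \<le> B" using B0 by blast
        then have "(\<Sum>i\<in>{1..N}. \<Sum>j\<in>{1..N} - {i}. Q * B) \<le> (\<Sum>i\<in>{1..N}. \<Sum>j\<in>{1..N}. Q * B)"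
          using Q0 by (intro sum_mono sum_mono2) auto
        then show ?thesis by (simp add: power2_eq_square mult_ac)
      next
        \<comment> \<open>Without any pair \<open>B0\<close> gives no information. Then
          \<open>N \<le> 1\<close>, and for \<open>N = 1\<close> the sign of \<open>B\<close>
          follows from \<open>G s = 0\<close>.\<close>
        case False
        then have "N = 0 \<or> N = 1" by (metis Diff_eq_empty_iff atLeastAtMost_iff le_refl less_one linorder_le_less_linear singletonD subsetD order_le_less)
        then show ?thesis
        proof
          assume "N = 1"
          then have "G s = 0" by (simp add: G_def drift_def)
          then have "0 \<le> B" unfolding B_def using v(1) g(1) by simp
          then show ?thesis using Q0 \<open>N = 1\<close> by simp
        qed simp
      qed
      finally have main: "sqrt s * \<bar>\<Sum>i\<in>{1..N}. q i * (\<Sum>j\<in>{1..N} - {i}. E i j)\<bar> \<le> Q * ((real N)\<^sup>2 * B)" .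
      have "s powr (real n / 2) = s powr ((real n - 1) / 2) * sqrt s"
        unfolding sq[symmetric] powr_add[symmetric] by (simp add: field_simps)
      also have "\<dots> \<le> S * sqrt s" unfolding S_def using s n by (intro mult_right_mono powr_mono2) auto
      finally have "\<bar>W' s\<bar> \<le> S * sqrt s * \<bar>\<Sum>i\<in>{1..N}. q i * (\<Sum>j\<in>{1..N} - {i}. E i j)\<bar>"
        unfolding W'E abs_mult by (intro mult_right_mono) auto
      also have "\<dots> \<le> S * (Q * ((real N)\<^sup>2 * B))"
        unfolding mult.assoc by (intro mult_left_mono main) (auto simp: S_def)
      also have "\<dots> = \<Phi>' s" unfolding \<Phi>'_def B_def by simp
      finally show ?thesis .
    qed
    have "\<bar>W t - W 0\<bar> \<le> \<Phi> t - \<Phi> 0"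
      by (rule primitive_abs_bound[OF W \<Phi>]) (use dr[unfolded driven_def] pw t in \<open>auto elim!: eventually_mono\<close>)
    moreover have "H 0 = 0" unfolding H_def by (rule set_integral_zero_interval)
    then have "W 0 = 0" by (simp add: W_def)
    moreover have "\<Phi> 0 = 0" using dr w0 v by (simp add: \<Phi>_def \<Gamma>_def driven_def min_def)
    moreover have "W t = sqrt t ^ n * (\<Sum>i\<in>{1..N}. q i * (x i t - sqrt t * ?z i)) - \<delta> ^ 8 * (sqrt t ^ n * h t - H t)"
    proof -
      have p: "t powr (real n / 2) = sqrt t ^ n"
      proof (cases "t = 0")
        case False
        then have "sqrt t ^ n = (t powr (1 / 2)) powr real n" using t by (simp add: powr_half_sqrt powr_realpow)
        then show ?thesis by (simp add: powr_powr)
      qed (use n in simp)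
      have "(\<Sum>i\<in>{1..N}. q i * A i t) = (\<Sum>i\<in>{1..N}. q i * (x i t - sqrt t * ?z i)) - \<delta> ^ 8 * h t"
        unfolding A_def h_def q_noise_def q_def[symmetric] sum_distrib_left sum_subtractf[symmetric]
        by (intro sum.cong refl) (use t in \<open>simp add: algebra_simps powr_half_sqrt\<close>)
      moreover have "c * (X - d * k) + d * l = c * X - d * (c * k - l)" for c X d k l :: real
        by (simp add: algebra_simps)
      ultimately show ?thesis unfolding W_def p by (simp only:)
    qed
    moreover have "\<Phi> t \<le> \<delta> ^ 9 * K"
    proof -
      \<comment> \<open>Up to time \<open>v ^ 4\<close> the noise-free particles have moved by at
        most the square of \<open>v\<close> times \<open>Z\<close>, which is of order
        \<open>\<delta> ^ 6\<close> like the a priori error. This makes the integrated repulsion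
        \<open>\<Gamma> r\<close> small as well.\<close>
      define r where "r = min t (v ^ 4)"
      have r: "r \<in> {0..T}" "r \<le> v ^ 4" using t v by (auto simp: r_def)
      have "\<Gamma> r \<le> (\<Sum>i\<in>{1..N}. real N * (\<delta> ^ 6 * (C + a\<^sup>2 * Z + m)))"
        unfolding \<Gamma>_def
      proof (rule sum_mono)
        fix i assume i: "i \<in> {1..N}"
        have "sqrt r \<le> sqrt (v ^ 4)" using r by simp
        also have "\<dots> = v\<^sup>2" by (simp add: real_sqrt_unique flip: power_mult)
        finally have sr: "sqrt r \<le> v\<^sup>2" .
        have "sqrt r * ?z i \<le> sqrt r * \<bar>?z i\<bar>" using r by (intro mult_left_mono) auto
        also have "\<dots> \<le> v\<^sup>2 * Z" by (rule mult_mono[OF sr Z[OF i]]) auto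
        finally have "sqrt r * ?z i \<le> v\<^sup>2 * Z" .
        moreover have "x i r - sqrt r * ?z i \<le> C * \<delta> ^ 6" using ap[OF d dr i r(1)] by linarith
        moreover have "- (\<delta> ^ 8 * w i r) \<le> \<delta> ^ 6 * m"
        proof -
          have "- (\<delta> ^ 8 * w i r) \<le> \<delta> ^ 8 * m" using wm[OF i r(1)] d
            by (simp only: mult_minus_right[symmetric]) (intro mult_left_mono, auto)
          also have "\<dots> \<le> \<delta> ^ 6 * m" using d m by (intro mult_right_mono power_decreasing) auto
          finally show ?thesis .
        qed
        ultimately have le: "x i r - \<delta> ^ 8 * w i r \<le> \<delta> ^ 6 * (C + a\<^sup>2 * Z + m)" unfolding v(2) by (simp add: algebra_simps)
        have "real i * (x i r - \<delta> ^ 8 * w i r) \<le> real i * (\<delta> ^ 6 * (C + a\<^sup>2 * Z + m))"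
          using le by (intro mult_left_mono) auto
        also have "\<dots> \<le> real N * (\<delta> ^ 6 * (C + a\<^sup>2 * Z + m))"
          using i d C Z0 m by (intro mult_right_mono mult_nonneg_nonneg add_nonneg_nonneg) auto
        finally show "real i * (x i r - \<delta> ^ 8 * w i r) \<le> real N * (\<delta> ^ 6 * (C + a\<^sup>2 * Z + m))" .
      qed
      then have \<Gamma>: "\<Gamma> r \<le> \<delta> ^ 6 * C5" by (simp add: C5_def power2_eq_square mult_ac)
      have C50: "0 \<le> C5" unfolding C5_def using C Z0 m by (intro mult_nonneg_nonneg add_nonneg_nonneg) auto
      have "v\<^sup>2 * \<Gamma> r \<le> \<delta> ^ 6 * a\<^sup>2 * (\<delta> ^ 6 * C5)" unfolding v(2) using \<Gamma> by (intro mult_left_mono) auto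
      also have "\<dots> = \<delta> ^ 12 * (a\<^sup>2 * C5)" by (simp add: algebra_simps flip: power_add)
      also have "\<dots> \<le> \<delta> ^ 9 * (a\<^sup>2 * C5)"
        using d C50 by (intro mult_right_mono power_decreasing) auto
      finally have 1: "v\<^sup>2 * \<Gamma> r \<le> \<delta> ^ 9 * (a\<^sup>2 * C5)" .
      have 2: "v ^ 3 / (2 * g) * 4 * t powr (1 / 4) \<le> \<delta> ^ 9 * (a ^ 3 / (2 * g) * 4 * T powr (1 / 4))"
      proof -
        have "v ^ 3 / (2 * g) * 4 * t powr (1 / 4) \<le> v ^ 3 / (2 * g) * 4 * T powr (1 / 4)"
          using t v(1) g(1) by (intro mult_left_mono powr_mono2) auto
        then show ?thesis unfolding v(3) by (simp add: mult_ac)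
      qed
      have "\<Phi> t \<le> Q * (S * (real N)\<^sup>2) * (\<delta> ^ 9 * (a\<^sup>2 * C5) + \<delta> ^ 9 * (a ^ 3 / (2 * g) * 4 * T powr (1 / 4)))"
        unfolding \<Phi>_def r_def[symmetric] using 1 2 Q0
        by (intro mult_left_mono add_mono mult_nonneg_nonneg) (auto simp: S_def)
      also have "\<dots> = \<delta> ^ 9 * K" unfolding K_def by (simp add: algebra_simps)
      finally show ?thesis .
    qed
    ultimately have "\<bar>sqrt t ^ n * (\<Sum>i\<in>{1..N}. q i * (x i t - sqrt t * ?z i)) - \<delta> ^ 8 * (sqrt t ^ n * h t - H t)\<bar> \<le> \<delta> ^ 9 * K"
      by simp
    then have "\<bar>sqrt t ^ n * (\<Sum>i\<in>{1..N}. q i * (x i t - sqrt t * ?z i)) - \<delta> ^ 8 * (sqrt t ^ n * h t - H t)\<bar> / \<delta> ^ 8 \<le> \<delta> ^ 9 * K / \<delta> ^ 8"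
      using d by (intro divide_right_mono) auto
    also have "\<delta> ^ 9 * K / \<delta> ^ 8 = K * \<delta>" using d by (simp add: power_numeral_reduce eval_nat_numeral)
    also have "\<bar>sqrt t ^ n * (\<Sum>i\<in>{1..N}. q i * (x i t - sqrt t * ?z i)) - \<delta> ^ 8 * (sqrt t ^ n * h t - H t)\<bar> / \<delta> ^ 8
       = \<bar>(sqrt t ^ n * (\<Sum>i\<in>{1..N}. q i * (x i t - sqrt t * ?z i)) - \<delta> ^ 8 * (sqrt t ^ n * h t - H t)) / \<delta> ^ 8\<bar>"
      using d by (simp add: abs_divide)
    also have "(sqrt t ^ n * (\<Sum>i\<in>{1..N}. q i * (x i t - sqrt t * ?z i)) - \<delta> ^ 8 * (sqrt t ^ n * h t - H t)) / \<delta> ^ 8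
       = sqrt t ^ n * (\<Sum>i\<in>{1..N}. q i * (x i t - sqrt t * ?z i)) / \<delta> ^ 8 - (sqrt t ^ n * h t - H t)"
      using d by (simp add: diff_divide_distrib)
    finally show ?thesis .
  qed
  then show ?thesis unfolding q_def h_def H_def by blast
qed

section \<open>Expansion of the observables and the pathwise limit\<close>

lemma power_taylor2:
  fixes B :: real
  assumes "0 \<le> B"
  shows "\<exists>K\<ge>0. \<forall>x y. \<bar>x\<bar> \<le> B \<longrightarrow> \<bar>y\<bar> \<le> B \<longrightarrow> \<bar>x ^ k - y ^ k - real k * y ^ (k - 1) * (x - y)\<bar> \<le> K * (x - y)\<^sup>2"
proof (induction k)
  case 0 then show ?case by (intro exI[of _ 0]) auto
next
  case (Suc k)
  then obtain K where K: "0 \<le> K"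
    "\<And>x y. \<bar>x\<bar> \<le> B \<Longrightarrow> \<bar>y\<bar> \<le> B \<Longrightarrow> \<bar>x ^ k - y ^ k - real k * y ^ (k - 1) * (x - y)\<bar> \<le> K * (x - y)\<^sup>2" by blast
  show ?case
  proof (intro exI[of _ "B * K + real k * B ^ (k - 1)"] conjI allI impI)
    fix x y :: real assume xy: "\<bar>x\<bar> \<le> B" "\<bar>y\<bar> \<le> B"
    have "x ^ Suc k - y ^ Suc k - real (Suc k) * y ^ (Suc k - 1) * (x - y) =
      x * (x ^ k - y ^ k - real k * y ^ (k - 1) * (x - y)) + real k * y ^ (k - 1) * (x - y)\<^sup>2"
      by (cases k) (auto simp: algebra_simps power2_eq_square)
    also have "\<bar>\<dots>\<bar> \<le> B * (K * (x - y)\<^sup>2) + real k * B ^ (k - 1) * (x - y)\<^sup>2"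
      by (intro order_trans[OF abs_triangle_ineq] add_mono)
        (use xy K assms in \<open>auto simp: abs_mult power_abs intro!: mult_mono power_mono\<close>)
    finally show "\<bar>x ^ Suc k - y ^ Suc k - real (Suc k) * y ^ (Suc k - 1) * (x - y)\<bar> \<le> (B * K + real k * B ^ (k - 1)) * (x - y)\<^sup>2"
      by (simp add: algebra_simps)
  qed (use K assms in auto)
qed

text \<open>The derivative of \<open>Qt_poly\<close> in \<open>x\<close>, evaluated by homogeneity.
  Where a coefficient is nonzero, parity makes the integer division in the exponent of
  \<open>t\<close> exact; elsewhere the term vanishes.\<close>

lemma Qt_poly_deriv_at:
  assumes "0 \<le> t"
  shows "(\<Sum>k\<le>Suc n. coeff (Q_poly N n) k * t ^ ((Suc n - k) div 2) * (real k * (sqrt t * z) ^ (k - 1))) =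
    sqrt t ^ n * poly (q_poly N n) z"
proof -
  have "(\<Sum>k\<le>Suc n. coeff (Q_poly N n) k * t ^ ((Suc n - k) div 2) * (real k * (sqrt t * z) ^ (k - 1))) =
    (\<Sum>k\<le>Suc n. sqrt t ^ n * (coeff (Q_poly N n) k * real k * z ^ (k - 1)))"
  proof (intro sum.cong refl)
    fix k
    show "coeff (Q_poly N n) k * t ^ ((Suc n - k) div 2) * (real k * (sqrt t * z) ^ (k - 1)) =
       sqrt t ^ n * (coeff (Q_poly N n) k * real k * z ^ (k - 1))"
    proof (cases "coeff (Q_poly N n) k = 0 \<or> k = 0")
      case False
      with coeff_Q_poly_nonzero obtain j where j: "k \<le> Suc n" "Suc n - k = 2 * j"
        by (blast elim: evenE)
      have "t ^ ((Suc n - k) div 2) = sqrt t ^ (2 * j)" using j assms by (simp add: power_mult)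
      moreover have "sqrt t ^ (2 * j) * sqrt t ^ (k - 1) = sqrt t ^ n"
        using j False by (subst power_add[symmetric]) (intro arg_cong2[where f = power], auto)
      ultimately show ?thesis by (simp add: power_mult_distrib mult_ac)
    qed auto
  qed
  also have "\<dots> = sqrt t ^ n * (\<Sum>k\<le>n. coeff (q_poly N n) k * z ^ k)"
    unfolding sum_distrib_left[symmetric] sum.atMost_Suc_shift by (simp add: Q_poly_def)
  also have "(\<Sum>k\<le>n. coeff (q_poly N n) k * z ^ k) = poly (q_poly N n) z"
  proof -
    have "degree (q_poly N n) \<le> n" by (rule degree_le) (use coeff_q_poly_nonzero in fastforce)
    then show ?thesis unfolding poly_altdef
      by (intro sum.mono_neutral_right) (auto simp: coeff_eq_0)
  qed
  finally show ?thesis .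
qed

text \<open>The polynomial form in \<open>t\<close> matters here: its coefficients are bounded by
  their absolute values at \<open>T\<close>, so the constant is uniform down to
  \<open>t = 0\<close>.\<close>

lemma Qt_poly_taylor2:
  assumes "0 \<le> B" "0 \<le> T"
  shows "\<exists>K\<ge>0. \<forall>t z x. t \<in> {0..T} \<longrightarrow> \<bar>x\<bar> \<le> B \<longrightarrow> \<bar>sqrt t * z\<bar> \<le> B \<longrightarrow>
     \<bar>Qt_poly N n t x - Qt_poly N n t (sqrt t * z) - sqrt t ^ n * poly (q_poly N n) z * (x - sqrt t * z)\<bar>
       \<le> K * (x - sqrt t * z)\<^sup>2"
proof -
  have "\<forall>k. \<exists>K\<ge>0. \<forall>x y. \<bar>x\<bar> \<le> B \<longrightarrow> \<bar>y\<bar> \<le> B \<longrightarrow> \<bar>x ^ k - y ^ k - real k * y ^ (k - 1) * (x - y)\<bar> \<le> K * (x - y)\<^sup>2"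
    using power_taylor2[OF assms(1)] by blast
  then obtain K where K: "\<And>k. 0 \<le> K k"
    "\<And>k x y. \<bar>x\<bar> \<le> B \<Longrightarrow> \<bar>y\<bar> \<le> B \<Longrightarrow> \<bar>x ^ k - y ^ k - real k * y ^ (k - 1) * (x - y)\<bar> \<le> K k * (x - y)\<^sup>2" by metis
  define c where "c k = \<bar>coeff (Q_poly N n) k\<bar> * T ^ ((Suc n - k) div 2)" for k
  show ?thesis
  proof (intro exI[of _ "\<Sum>k\<le>Suc n. c k * K k"] conjI allI impI)
    show "0 \<le> (\<Sum>k\<le>Suc n. c k * K k)" using K assms by (intro sum_nonneg mult_nonneg_nonneg) (auto simp: c_def)
    fix t z x :: real assume t: "t \<in> {0..T}" and x: "\<bar>x\<bar> \<le> B" "\<bar>sqrt t * z\<bar> \<le> B"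
    define y where "y = sqrt t * z"
    define a where "a k = coeff (Q_poly N n) k * t ^ ((Suc n - k) div 2)" for k
    have "Qt_poly N n t x - Qt_poly N n t y - sqrt t ^ n * poly (q_poly N n) z * (x - y) =
      (\<Sum>k\<le>Suc n. a k * (x ^ k - y ^ k - real k * y ^ (k - 1) * (x - y)))"
      unfolding Qt_poly_def Qt_poly_deriv_at[symmetric, OF atLeastAtMost_iff[THEN iffD1, OF t, THEN conjunct1]]
        y_def[symmetric] a_def[symmetric] sum_distrib_right sum_subtractf[symmetric]
      by (intro sum.cong refl) (simp add: algebra_simps)
    also have "\<bar>\<dots>\<bar> \<le> (\<Sum>k\<le>Suc n. c k * (K k * (x - y)\<^sup>2))"
    proof (intro order_trans[OF sum_abs] sum_mono)
      fix k
      have "\<bar>a k\<bar> \<le> c k" unfolding a_def c_def abs_mult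
        using t by (intro mult_left_mono) (auto intro!: power_mono)
      then show "\<bar>a k * (x ^ k - y ^ k - real k * y ^ (k - 1) * (x - y))\<bar> \<le> c k * (K k * (x - y)\<^sup>2)"
        unfolding abs_mult[of "a k"] using K(2)[of x y k] x assms
        by (intro mult_mono) (auto simp: y_def c_def)
    qed
    also have "\<dots> = (\<Sum>k\<le>Suc n. c k * K k) * (x - y)\<^sup>2"
      unfolding sum_distrib_right by (simp add: mult_ac)
    finally show "\<bar>Qt_poly N n t x - Qt_poly N n t (sqrt t * z) - sqrt t ^ n * poly (q_poly N n) z * (x - sqrt t * z)\<bar>
       \<le> (\<Sum>k\<le>Suc n. c k * K k) * (x - sqrt t * z)\<^sup>2" unfolding y_def .
  qed
qed

text \<open>To first order an observable sees only the projected deviation, which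
  \<open>driven_linearization\<close> controls; the second-order term is
  \<open>O(\<delta> ^ 12)\<close> and stays small after division by the amplitude
  \<open>\<delta> ^ 8\<close>. \<open>K\<close> may depend on the path \<open>w\<close>, but serves
  all \<delta>, all solutions, all modes and all times.\<close>

theorem driven_limit:
  assumes N: "1 \<le> N" and T: "0 \<le> T" and w0: "\<And>i. i \<in> {1..N} \<Longrightarrow> w i 0 = 0"
    and wc: "\<And>i. i \<in> {1..N} \<Longrightarrow> continuous_on {0..T} (w i)"
  shows "\<exists>K. \<forall>\<delta> x n t. 0 < \<delta> \<longrightarrow> \<delta> \<le> 1 \<longrightarrow> driven N T (\<delta> ^ 8) w x \<longrightarrow> n < N \<longrightarrow> t \<in> {0..T} \<longrightarrow>
     \<bar>sqrt N / \<delta> ^ 8 * ((\<Sum>i\<in>{1..N}. Qt_poly N n t (x i t)) / N - (\<Sum>i\<in>{1..N}. Qt_poly N n t (sqrt t * hermite_zero N i)) / N)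
       - limit_path N n w t\<bar> \<le> K * \<delta>"
proof -
  let ?z = "hermite_zero N" and ?q = "\<lambda>n i. poly (q_poly N n) (hermite_zero N i)"
  have "\<forall>i\<in>{1..N}. \<exists>M. \<forall>t\<in>{0..T}. \<bar>w i t\<bar> \<le> M"
  proof
    fix i assume "i \<in> {1..N}"
    then have "compact (w i ` {0..T})" by (intro compact_continuous_image wc) auto
    then show "\<exists>M. \<forall>t\<in>{0..T}. \<bar>w i t\<bar> \<le> M"
      by (auto dest!: compact_imp_bounded simp: bounded_iff)
  qed
  then obtain M where M: "\<And>i t. i \<in> {1..N} \<Longrightarrow> t \<in> {0..T} \<Longrightarrow> \<bar>w i t\<bar> \<le> M i" by metis
  define m where "m = (\<Sum>i\<in>{1..N}. \<bar>M i\<bar>)"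
  have wm: "\<bar>w i t\<bar> \<le> m" if "i \<in> {1..N}" "t \<in> {0..T}" for i t
    using M[OF that] member_le_sum[of i "{1..N}" "\<lambda>i. \<bar>M i\<bar>"] that(1) unfolding m_def by force
  have m: "0 \<le> m" unfolding m_def by (intro sum_nonneg) auto
  obtain C where C: "0 < C" and ap: "\<And>\<delta> x i t. 0 < \<delta> \<Longrightarrow> \<delta> \<le> 1 \<Longrightarrow> driven N T (\<delta> ^ 8) w x \<Longrightarrow> i \<in> {1..N} \<Longrightarrow> t \<in> {0..T} \<Longrightarrow>
        \<bar>x i t - sqrt t * ?z i\<bar> \<le> C * \<delta> ^ 6"
    using driven_a_priori[of N w T m, OF w0 wm m T] by blast
  define L where "L n x \<delta> t = sqrt t ^ n * (\<Sum>i\<in>{1..N}. ?q n i * (x i t - sqrt t * ?z i)) / \<delta> ^ 8" for n x \<delta> t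
  \<comment> \<open>Confines both the perturbed particles and the noise-free ones, using
    \<open>\<delta> \<le> 1\<close>.\<close>
  define B where "B = C + sqrt T * (\<Sum>i\<in>{1..N}. \<bar>?z i\<bar>)"
  have B0: "0 \<le> B" unfolding B_def using C T by (intro add_nonneg_nonneg mult_nonneg_nonneg sum_nonneg) auto
  have "\<forall>n. \<exists>K. \<forall>\<delta> x t. 0 < \<delta> \<longrightarrow> \<delta> \<le> 1 \<longrightarrow> driven N T (\<delta> ^ 8) w x \<longrightarrow> t \<in> {0..T} \<longrightarrow>
     \<bar>L n x \<delta> t - sqrt N * limit_path N n w t\<bar> \<le> K * \<delta>"
  proof
    fix n
    have sq: "sqrt N * limit_path N n w t = sqrt t ^ n * q_noise N n w t - (LBINT s:{0..t}. real n / 2 * s powr (real n / 2 - 1) * q_noise N n w s)" for t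
      unfolding limit_path_def using N by simp
    show "\<exists>K. \<forall>\<delta> x t. 0 < \<delta> \<longrightarrow> \<delta> \<le> 1 \<longrightarrow> driven N T (\<delta> ^ 8) w x \<longrightarrow> t \<in> {0..T} \<longrightarrow>
     \<bar>L n x \<delta> t - sqrt N * limit_path N n w t\<bar> \<le> K * \<delta>"
    proof (cases "n = 0")
      case False
      show ?thesis unfolding sq L_def
      proof (rule driven_linearization[OF w0 wc wm m T _ C])
        show "1 \<le> n" using False by simp
        fix \<delta> :: real and x i t
        assume "0 < \<delta>" "\<delta> \<le> 1" "driven N T (\<delta> ^ 8) w x" "i \<in> {1..N}" "t \<in> {0..T}"
        then show "\<bar>x i t - sqrt t * ?z i\<bar> \<le> C * \<delta> ^ 6" by (rule ap)
      qed
    next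
      case True
      show ?thesis unfolding sq L_def
        by (rule exI[of _ 0]) (use driven_linearization_0[where w = w and N = N, OF _ _ w0] True in \<open>auto simp: q_noise_def set_lebesgue_integral_def\<close>)
    qed
  qed
  then obtain K1 where K1: "\<And>n \<delta> x t. 0 < \<delta> \<Longrightarrow> \<delta> \<le> 1 \<Longrightarrow> driven N T (\<delta> ^ 8) w x \<Longrightarrow> t \<in> {0..T} \<Longrightarrow>
     \<bar>L n x \<delta> t - sqrt N * limit_path N n w t\<bar> \<le> K1 n * \<delta>" by metis
  have "\<forall>n. \<exists>K\<ge>0. \<forall>t z x. t \<in> {0..T} \<longrightarrow> \<bar>x\<bar> \<le> B \<longrightarrow> \<bar>sqrt t * z\<bar> \<le> B \<longrightarrow>
     \<bar>Qt_poly N n t x - Qt_poly N n t (sqrt t * z) - sqrt t ^ n * poly (q_poly N n) z * (x - sqrt t * z)\<bar>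
       \<le> K * (x - sqrt t * z)\<^sup>2"
    using Qt_poly_taylor2[OF B0 T] by blast
  then obtain K2 where K2: "\<And>n. 0 \<le> K2 n" "\<And>n t z x. t \<in> {0..T} \<Longrightarrow> \<bar>x\<bar> \<le> B \<Longrightarrow> \<bar>sqrt t * z\<bar> \<le> B \<Longrightarrow>
     \<bar>Qt_poly N n t x - Qt_poly N n t (sqrt t * z) - sqrt t ^ n * poly (q_poly N n) z * (x - sqrt t * z)\<bar>
       \<le> K2 n * (x - sqrt t * z)\<^sup>2" by metis
  define K where "K n = (\<bar>K1 n\<bar> + real N * (K2 n * C\<^sup>2)) / sqrt N" for n
  have main: "\<bar>sqrt N / \<delta> ^ 8 * ((\<Sum>i\<in>{1..N}. Qt_poly N n t (x i t)) / N - (\<Sum>i\<in>{1..N}. Qt_poly N n t (sqrt t * ?z i)) / N)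
       - limit_path N n w t\<bar> \<le> K n * \<delta>"
    if d: "0 < \<delta>" "\<delta> \<le> 1" and dr: "driven N T (\<delta> ^ 8) w x" and t: "t \<in> {0..T}" for \<delta> x n t
  proof -
    define R where "R i = Qt_poly N n t (x i t) - Qt_poly N n t (sqrt t * ?z i) - sqrt t ^ n * ?q n i * (x i t - sqrt t * ?z i)" for i
    have R: "\<bar>R i\<bar> \<le> K2 n * C\<^sup>2 * \<delta> ^ 12" if i: "i \<in> {1..N}" for i
    proof -
      have a: "\<bar>x i t - sqrt t * ?z i\<bar> \<le> C * \<delta> ^ 6" using ap[OF d dr i t] .
      have "C * \<delta> ^ 6 \<le> C" using C d by (intro mult_right_le_one_le power_le_one) auto
      moreover have b: "\<bar>sqrt t * ?z i\<bar> \<le> sqrt T * (\<Sum>i\<in>{1..N}. \<bar>?z i\<bar>)"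
        unfolding abs_mult using t member_le_sum[of i "{1..N}" "\<lambda>i. \<bar>?z i\<bar>"] i
        by (intro mult_mono) auto
      ultimately have "\<bar>x i t\<bar> \<le> B" "\<bar>sqrt t * ?z i\<bar> \<le> B" using a C unfolding B_def by linarith+
      from K2(2)[OF t this] have "\<bar>R i\<bar> \<le> K2 n * \<bar>x i t - sqrt t * ?z i\<bar>\<^sup>2" unfolding R_def power2_abs .
      also have "\<dots> \<le> K2 n * (C * \<delta> ^ 6)\<^sup>2" using a K2(1) by (intro mult_left_mono power_mono) auto
      finally show ?thesis by (simp add: power_mult_distrib mult_ac flip: power_mult)
    qed
    have "(\<Sum>i\<in>{1..N}. Qt_poly N n t (x i t)) - (\<Sum>i\<in>{1..N}. Qt_poly N n t (sqrt t * ?z i)) =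
       sqrt t ^ n * (\<Sum>i\<in>{1..N}. ?q n i * (x i t - sqrt t * ?z i)) + (\<Sum>i\<in>{1..N}. R i)"
      unfolding sum_distrib_left sum_subtractf[symmetric] sum.distrib[symmetric]
      by (intro sum.cong refl) (simp add: R_def mult.assoc)
    also have "\<dots> = \<delta> ^ 8 * (L n x \<delta> t + (\<Sum>i\<in>{1..N}. R i) / \<delta> ^ 8)"
      unfolding L_def using d by (simp add: field_simps)
    finally have e: "(\<Sum>i\<in>{1..N}. Qt_poly N n t (x i t)) - (\<Sum>i\<in>{1..N}. Qt_poly N n t (sqrt t * ?z i)) =
      \<delta> ^ 8 * (L n x \<delta> t + (\<Sum>i\<in>{1..N}. R i) / \<delta> ^ 8)" .
    have "sqrt N / \<delta> ^ 8 * ((\<Sum>i\<in>{1..N}. Qt_poly N n t (x i t)) / N - (\<Sum>i\<in>{1..N}. Qt_poly N n t (sqrt t * ?z i)) / N)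
       - limit_path N n w t = ((L n x \<delta> t - sqrt N * limit_path N n w t) + (\<Sum>i\<in>{1..N}. R i) / \<delta> ^ 8) / sqrt N"
    proof -
      have "sqrt N / \<delta> ^ 8 * ((\<delta> ^ 8 * u) / N) = u / sqrt N" for u
        using d N by (simp add: field_simps)
      moreover have "u / sqrt N - l = (u - sqrt N * l) / sqrt N" for u l :: real using N by (simp add: field_simps)
      ultimately show ?thesis unfolding diff_divide_distrib[symmetric] e by (simp only:) (simp only: add_diff_eq diff_add_eq)
    qed
    also have "\<bar>\<dots>\<bar> \<le> (\<bar>K1 n\<bar> * \<delta> + real N * (K2 n * C\<^sup>2) * \<delta>) / sqrt N"
      unfolding abs_divide
    proof (intro frac_le)
      have "\<bar>\<Sum>i\<in>{1..N}. R i\<bar> \<le> real N * (K2 n * C\<^sup>2 * \<delta> ^ 12)"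
        using sum_mono[of "{1..N}" "\<lambda>i. \<bar>R i\<bar>", OF R] by (intro order_trans[OF sum_abs]) simp
      then have "\<bar>(\<Sum>i\<in>{1..N}. R i) / \<delta> ^ 8\<bar> \<le> real N * (K2 n * C\<^sup>2 * \<delta> ^ 12) / \<delta> ^ 8"
        unfolding abs_divide using d by (simp add: divide_right_mono)
      also have "\<dots> = real N * (K2 n * C\<^sup>2) * \<delta> ^ 4" 
      proof -
        have p: "\<delta> ^ 12 = \<delta> ^ 4 * \<delta> ^ 8" by (simp flip: power_add)
        have cancel: "u * (c * (p * r)) / r = u * c * p" if "r \<noteq> 0" for u c p r :: real using that by simp
        show ?thesis unfolding p by (rule cancel) (use d in simp)
      qed
      also have "\<dots> \<le> real N * (K2 n * C\<^sup>2) * \<delta>"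
        using d K2(1)[of n] power_decreasing[of 1 4 \<delta>] by (intro mult_left_mono) auto
      finally have 1: "\<bar>(\<Sum>i\<in>{1..N}. R i) / \<delta> ^ 8\<bar> \<le> real N * (K2 n * C\<^sup>2) * \<delta>" .
      have "K1 n * \<delta> \<le> \<bar>K1 n\<bar> * \<delta>" using d by (intro mult_right_mono) auto
      then show "\<bar>(L n x \<delta> t - sqrt N * limit_path N n w t) + (\<Sum>i\<in>{1..N}. R i) / \<delta> ^ 8\<bar> \<le> \<bar>K1 n\<bar> * \<delta> + real N * (K2 n * C\<^sup>2) * \<delta>"
        using 1 K1[OF d dr t, of n] by linarith
    qed (use N d K2(1)[of n] in auto)
    also have "\<dots> = K n * \<delta>" unfolding K_def by (simp add: field_simps)
    finally show ?thesis .
  qed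
  show ?thesis
  proof (intro exI[of _ "\<Sum>n<N. \<bar>K n\<bar>"] allI impI)
    fix \<delta> x n t assume d: "0 < \<delta>" "\<delta> \<le> (1::real)" and dr: "driven N T (\<delta> ^ 8) w x" and t: "t \<in> {0..T}" and n: "n < N"
    have "K n \<le> (\<Sum>n<N. \<bar>K n\<bar>)" using member_le_sum[of n "{..<N}" "\<lambda>n. \<bar>K n\<bar>"] n by force
    then have "K n * \<delta> \<le> (\<Sum>n<N. \<bar>K n\<bar>) * \<delta>" using d by (intro mult_right_mono) auto
    then show "\<bar>sqrt N / \<delta> ^ 8 * ((\<Sum>i\<in>{1..N}. Qt_poly N n t (x i t)) / N - (\<Sum>i\<in>{1..N}. Qt_poly N n t (sqrt t * ?z i)) / N)
       - limit_path N n w t\<bar> \<le> (\<Sum>n<N. \<bar>K n\<bar>) * \<delta>"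
      using main[OF d dr t, of n] by linarith
  qed
qed

section \<open>Gaussian families and independence\<close>

lemma integrable_bounded:
  assumes "prob_space M" and W: "W \<in> borel_measurable M" and b: "\<And>\<omega>. \<omega> \<in> space M \<Longrightarrow> norm (W \<omega>) \<le> c"
  shows "integrable M (W :: 'a \<Rightarrow> 'b::{banach, second_countable_topology})"
proof -
  interpret prob_space M by fact
  show ?thesis by (rule integrable_const_bound[of _ c]) (use W b in auto)
qed

text \<open>Uniqueness of characteristic functions for the signed measure with density \<open>W\<close>: adding the
  constant \<open>c\<close> turns it into a positive one with the same total mass as \<open>c\<close>.\<close>

lemma integral_indicator_zero_real:
  fixes W :: "'a \<Rightarrow> real"
  assumes M: "prob_space M" and W[measurable]: "W \<in> borel_measurable M" and X[measurable]: "X \<in> borel_measurable M"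
    and b: "\<And>\<omega>. \<omega> \<in> space M \<Longrightarrow> \<bar>W \<omega>\<bar> \<le> c" and c: "0 < c"
    and char0: "\<And>s. (\<integral>\<omega>. complex_of_real (W \<omega>) * iexp (s * X \<omega>) \<partial>M) = 0" and A[measurable]: "A \<in> sets borel"
  shows "(\<integral>\<omega>. W \<omega> * indicator A (X \<omega>) \<partial>M) = 0"
proof -
  interpret prob_space M by fact
  define Q where "Q = density M (\<lambda>\<omega>. ennreal ((W \<omega> + c) / c))"
  have nn: "AE \<omega> in M. 0 \<le> (W \<omega> + c) / c" using b c by (intro AE_I2) (fastforce simp: abs_le_iff)
  have intW: "integrable M W" by (rule integrable_bounded[OF M W]) (use b in auto)
  have intWe: "integrable M (\<lambda>\<omega>. complex_of_real (W \<omega>) * iexp (s * X \<omega>))" for s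
    by (rule integrable_bounded[OF M, of _ c]) (use b in \<open>auto simp: norm_mult\<close>)
  have inte: "integrable M (\<lambda>\<omega>. iexp (s * X \<omega>))" for s
    by (rule integrable_bounded[OF M, of _ 1]) auto
  have "(\<integral>\<omega>. complex_of_real (W \<omega>) \<partial>M) = 0" using char0[of 0] by simp
  \<comment> \<open>The hypothesis at \<open>s = 0\<close> says that \<open>W\<close> has total mass
    zero; therefore \<open>Q\<close> has mass one.\<close>
  then have W0: "(\<integral>\<omega>. W \<omega> \<partial>M) = 0" using integral_complex_of_real[of M W] by simp
  have Qf: "(\<integral>\<omega>. f \<omega> \<partial>Q) = (\<integral>\<omega>. ((W \<omega> + c) / c) *\<^sub>R f \<omega> \<partial>M)" if "f \<in> borel_measurable M"
    for f :: "'a \<Rightarrow> 'b::{banach, second_countable_topology}"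
    unfolding Q_def by (rule integral_density) (use that nn in auto)
  interpret Q: prob_space Q
  proof
    have "emeasure Q (space Q) = (\<integral>\<^sup>+\<omega>. ennreal ((W \<omega> + c) / c) \<partial>M)"
      unfolding Q_def by (subst emeasure_density) (auto intro!: nn_integral_cong)
    also have "\<dots> = ennreal (\<integral>\<omega>. (W \<omega> + c) / c \<partial>M)"
      by (rule nn_integral_eq_integral) (use intW nn in auto)
    also have "(\<integral>\<omega>. (W \<omega> + c) / c \<partial>M) = 1" using intW W0 c by (simp add: prob_space)
    finally show "emeasure Q (space Q) = 1" by simp
  qed
  have XQ[measurable]: "X \<in> borel_measurable Q" unfolding Q_def by simp
  have "distr Q borel X = distr M borel X"
  proof (rule Levy_uniqueness)
    show "real_distribution (distr Q borel X)" "real_distribution (distr M borel X)"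
      using Q.real_distribution_distr[OF XQ] real_distribution_distr[OF X] by auto
    show "char (distr Q borel X) = char (distr M borel X)"
    proof
      fix s
      have "char (distr Q borel X) s = (\<integral>\<omega>. ((W \<omega> + c) / c) *\<^sub>R iexp (s * X \<omega>) \<partial>M)"
        unfolding char_def by (subst integral_distr) (auto simp: Qf)
      also have "\<dots> = (\<integral>\<omega>. (1 / c) *\<^sub>R (complex_of_real (W \<omega>) * iexp (s * X \<omega>)) + iexp (s * X \<omega>) \<partial>M)"
        using c by (intro Bochner_Integration.integral_cong) (auto simp: scaleR_conv_of_real field_simps)
      also have "\<dots> = (\<integral>\<omega>. iexp (s * X \<omega>) \<partial>M)"
        using intWe[of s] inte[of s] char0[of s] by (subst Bochner_Integration.integral_add) auto
      also have "\<dots> = char (distr M borel X) s" unfolding char_def by (subst integral_distr) auto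
      finally show "char (distr Q borel X) s = char (distr M borel X) s" .
    qed
  qed
  then have "(\<integral>x. indicator A x \<partial>distr Q borel X) = (\<integral>x. indicat_real A x \<partial>distr M borel X)" by simp
  then have "(\<integral>\<omega>. ((W \<omega> + c) / c) *\<^sub>R indicat_real A (X \<omega>) \<partial>M) = (\<integral>\<omega>. indicator A (X \<omega>) \<partial>M)"
    by (subst (asm) (1 2) integral_distr) (auto simp: Qf)
  moreover have "(\<integral>\<omega>. ((W \<omega> + c) / c) *\<^sub>R indicat_real A (X \<omega>) \<partial>M) =
     (\<integral>\<omega>. (1 / c) * (W \<omega> * indicator A (X \<omega>)) + indicator A (X \<omega>) \<partial>M)"
    using c by (intro Bochner_Integration.integral_cong) (auto simp: field_simps)
  moreover have "integrable M (\<lambda>\<omega>. W \<omega> * indicat_real A (X \<omega>))"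
    by (rule integrable_bounded[OF M, of _ c]) (use b c in \<open>auto simp: indicator_def\<close>)
  moreover have "integrable M (\<lambda>\<omega>. indicat_real A (X \<omega>))"
    by (rule integrable_bounded[OF M, of _ 1]) (auto simp: indicator_def)
  ultimately show ?thesis using c by simp
qed

text \<open>Real and imaginary parts satisfy the hypothesis separately: conjugation and the
  substitution of \<open>-s\<close> for \<open>s\<close> transfer it from \<open>W\<close> to its
  conjugate.\<close>

lemma integral_indicator_zero:
  fixes W :: "'a \<Rightarrow> complex"
  assumes M: "prob_space M" and W[measurable]: "W \<in> borel_measurable M" and X[measurable]: "X \<in> borel_measurable M"
    and b: "\<And>\<omega>. \<omega> \<in> space M \<Longrightarrow> norm (W \<omega>) \<le> c"
    and char0: "\<And>s. (\<integral>\<omega>. W \<omega> * iexp (s * X \<omega>) \<partial>M) = 0" and A[measurable]: "A \<in> sets borel"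
  shows "(\<integral>\<omega>. W \<omega> * indicator A (X \<omega>) \<partial>M) = 0"
proof -
  interpret prob_space M by fact
  define c' where "c' = max c 1"
  have c': "0 < c'" and b': "\<And>\<omega>. \<omega> \<in> space M \<Longrightarrow> norm (W \<omega>) \<le> c'" using b by (auto simp: c'_def intro: le_max_iff_disj[THEN iffD2])
  have i1: "integrable M (\<lambda>\<omega>. W \<omega> * iexp (s * X \<omega>))" for s
    by (rule integrable_bounded[OF M, of _ c]) (use b in \<open>auto simp: norm_mult\<close>)
  have [measurable]: "(\<lambda>\<omega>. cnj (W \<omega>)) \<in> borel_measurable M"
    by (rule measurable_compose[OF W borel_measurable_continuous_onI]) (intro continuous_intros)
  have i2: "integrable M (\<lambda>\<omega>. cnj (W \<omega>) * iexp (s * X \<omega>))" for s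
    by (rule integrable_bounded[OF M, of _ c]) (use b in \<open>auto simp: norm_mult\<close>)
  have conj0: "(\<integral>\<omega>. cnj (W \<omega>) * iexp (s * X \<omega>) \<partial>M) = 0" for s
  proof -
    have "(\<integral>\<omega>. cnj (W \<omega>) * iexp (s * X \<omega>) \<partial>M) = (\<integral>\<omega>. cnj (W \<omega> * iexp (- s * X \<omega>)) \<partial>M)"
      by (simp add: exp_cnj)
    also have "\<dots> = cnj (\<integral>\<omega>. W \<omega> * iexp (- s * X \<omega>) \<partial>M)" by (rule Bochner_Integration.integral_cnj)
    also have "\<dots> = 0" unfolding char0 by simp
    finally show ?thesis .
  qed
  have re: "(\<integral>\<omega>. complex_of_real (Re (W \<omega>)) * iexp (s * X \<omega>) \<partial>M) = 0" for s
  proof -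
    have "complex_of_real (Re w) = (1 / 2) * w + (1 / 2) * cnj w" for w by (simp add: complex_eq_iff)
    then have "(\<integral>\<omega>. complex_of_real (Re (W \<omega>)) * iexp (s * X \<omega>) \<partial>M) =
      (\<integral>\<omega>. (1 / 2) * (W \<omega> * iexp (s * X \<omega>)) + (1 / 2) * (cnj (W \<omega>) * iexp (s * X \<omega>)) \<partial>M)"
      by (simp only: distrib_right mult.assoc)
    also have "\<dots> = 0" using i1[of s] i2[of s] char0[of s] conj0[of s]
      by (subst Bochner_Integration.integral_add) simp_all
    finally show ?thesis .
  qed
  have im: "(\<integral>\<omega>. complex_of_real (Im (W \<omega>)) * iexp (s * X \<omega>) \<partial>M) = 0" for s
  proof -
    have "complex_of_real (Im w) = (- \<i> / 2) * w + (\<i> / 2) * cnj w" for w by (simp add: complex_eq_iff)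
    then have "(\<integral>\<omega>. complex_of_real (Im (W \<omega>)) * iexp (s * X \<omega>) \<partial>M) =
      (\<integral>\<omega>. (- \<i> / 2) * (W \<omega> * iexp (s * X \<omega>)) + (\<i> / 2) * (cnj (W \<omega>) * iexp (s * X \<omega>)) \<partial>M)"
      by (simp only: distrib_right mult.assoc)
    also have "\<dots> = 0" using i1[of s] i2[of s] char0[of s] conj0[of s]
      by (subst Bochner_Integration.integral_add) simp_all
    finally show ?thesis .
  qed
  have "(\<integral>\<omega>. Re (W \<omega>) * indicator A (X \<omega>) \<partial>M) = 0"
    by (rule integral_indicator_zero_real[OF M _ X _ c' re A]) (use b' abs_Re_le_cmod in \<open>auto intro: order_trans\<close>)
  moreover have "(\<integral>\<omega>. Im (W \<omega>) * indicator A (X \<omega>) \<partial>M) = 0"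
    by (rule integral_indicator_zero_real[OF M _ X _ c' im A]) (use b' abs_Im_le_cmod in \<open>auto intro: order_trans\<close>)
  moreover have int: "integrable M (\<lambda>\<omega>. W \<omega> * indicator A (X \<omega>))"
    by (rule integrable_bounded[OF M, of _ c']) (use b' c' in \<open>auto simp: norm_mult indicator_def\<close>)
  moreover have "Re (W \<omega> * indicator A (X \<omega>)) = Re (W \<omega>) * indicator A (X \<omega>)"
    "Im (W \<omega> * indicator A (X \<omega>)) = Im (W \<omega>) * indicator A (X \<omega>)" for \<omega>
    by (auto simp: indicator_def)
  ultimately show ?thesis
    using integral_Re[OF int] integral_Im[OF int] by (simp add: complex_eq_iff)
qed

text \<open>Multivariate uniqueness from the one-dimensional case. The exponential of the new
  coordinate is absorbed into \<open>W\<close>, the induction hypothesis handles the others, and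
  since its frequency is arbitrary it can then be exchanged for an indicator.\<close>

lemma integral_prod_indicator_zero:
  fixes W :: "'a \<Rightarrow> complex" and X :: "'i \<Rightarrow> 'a \<Rightarrow> real"
  assumes M: "prob_space M" and J: "finite J" and W: "W \<in> borel_measurable M"
    and X: "\<And>j. j \<in> J \<Longrightarrow> X j \<in> borel_measurable M"
    and b: "\<And>\<omega>. \<omega> \<in> space M \<Longrightarrow> norm (W \<omega>) \<le> c"
    and char0: "\<And>a. (\<integral>\<omega>. W \<omega> * iexp (\<Sum>j\<in>J. a j * X j \<omega>) \<partial>M) = 0" and A: "\<And>j. j \<in> J \<Longrightarrow> A j \<in> sets borel"
  shows "(\<integral>\<omega>. W \<omega> * (\<Prod>j\<in>J. indicator (A j) (X j \<omega>)) \<partial>M) = 0"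
  using J W X b char0 A
proof (induction J arbitrary: W rule: finite_induct)
  case (insert j J)
  note [measurable] = insert.prems(1)
  have Xm[measurable]: "X j \<in> borel_measurable M" and XJ[measurable]: "\<And>i. i \<in> J \<Longrightarrow> X i \<in> borel_measurable M"
    and Aj[measurable]: "A j \<in> sets borel" and AJ[measurable]: "\<And>i. i \<in> J \<Longrightarrow> A i \<in> sets borel"
    using insert.prems by auto
  let ?P = "\<lambda>\<omega>. \<Prod>i\<in>J. indicator (A i) (X i \<omega>) :: complex"
  have nP: "norm (?P \<omega>) \<le> 1" for \<omega>
    unfolding prod_norm[symmetric] by (intro prod_le_1) (auto simp: indicator_def)
  have Pm[measurable]: "?P \<in> borel_measurable M" by measurable
  have 1: "(\<integral>\<omega>. (W \<omega> * ?P \<omega>) * iexp (s * X j \<omega>) \<partial>M) = 0" for s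
  proof -
    have "(\<integral>\<omega>. (W \<omega> * iexp (s * X j \<omega>)) * ?P \<omega> \<partial>M) = 0"
    proof (rule insert.IH)
      show "(\<lambda>\<omega>. W \<omega> * iexp (s * X j \<omega>)) \<in> borel_measurable M" by measurable
      show "norm (W \<omega> * iexp (s * X j \<omega>)) \<le> c" if "\<omega> \<in> space M" for \<omega>
        using insert.prems(3)[OF that] by (simp add: norm_mult)
      fix a
      have sum: "(\<Sum>i\<in>insert j J. (a(j := s)) i * X i \<omega>) = s * X j \<omega> + (\<Sum>i\<in>J. a i * X i \<omega>)" for \<omega>
        using insert.hyps by (auto intro!: sum.cong)
      have "W \<omega> * iexp (s * X j \<omega>) * iexp (\<Sum>i\<in>J. a i * X i \<omega>) = W \<omega> * iexp (\<Sum>i\<in>insert j J. (a(j := s)) i * X i \<omega>)" for \<omega>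
        unfolding sum of_real_add distrib_left exp_add mult.assoc ..
      then show "(\<integral>\<omega>. W \<omega> * iexp (s * X j \<omega>) * iexp (\<Sum>i\<in>J. a i * X i \<omega>) \<partial>M) = 0"
        using insert.prems(4)[of "a(j := s)"] by (simp only:)
    qed (use XJ AJ in auto)
    then show ?thesis by (simp add: mult_ac)
  qed
  have "(\<integral>\<omega>. (W \<omega> * ?P \<omega>) * indicator (A j) (X j \<omega>) \<partial>M) = 0"
  proof (rule integral_indicator_zero[OF M _ Xm _ 1 Aj])
    show "(\<lambda>\<omega>. W \<omega> * ?P \<omega>) \<in> borel_measurable M" by measurable
    show "norm (W \<omega> * ?P \<omega>) \<le> \<bar>c\<bar> * 1" if "\<omega> \<in> space M" for \<omega>
      unfolding norm_mult by (intro mult_mono nP) (use insert.prems(3)[OF that] in auto)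
  qed
  then show ?case using insert.hyps by (simp add: mult_ac)
qed (use char0 in auto)

text \<open>One block of coordinates after the other is switched from exponentials to indicators.\<close>

lemma char_factor_imp_prob_factor:
  fixes X :: "nat \<Rightarrow> 't \<Rightarrow> 'a \<Rightarrow> real"
  assumes M: "prob_space M" and J: "finite J"
    and X[measurable]: "\<And>n t. n < N \<Longrightarrow> t \<in> J \<Longrightarrow> X n t \<in> borel_measurable M"
    and A[measurable]: "\<And>n t. n < N \<Longrightarrow> t \<in> J \<Longrightarrow> A n t \<in> sets borel"
    and fac: "\<And>c. (\<integral>\<omega>. iexp (\<Sum>n<N. \<Sum>t\<in>J. c n t * X n t \<omega>) \<partial>M) = (\<Prod>n<N. \<integral>\<omega>. iexp (\<Sum>t\<in>J. c n t * X n t \<omega>) \<partial>M)"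
  shows "(\<integral>\<omega>. (\<Prod>n<N. \<Prod>t\<in>J. indicat_real (A n t) (X n t \<omega>)) \<partial>M) =
    (\<Prod>n<N. \<integral>\<omega>. (\<Prod>t\<in>J. indicat_real (A n t) (X n t \<omega>)) \<partial>M)"
proof -
  interpret prob_space M by fact
  define I where "I n \<omega> = (\<Prod>t\<in>J. indicator (A n t) (X n t \<omega>) :: complex)" for n \<omega>
  define e where "e c n \<omega> = iexp (\<Sum>t\<in>J. c n t * X n t \<omega>)" for c n \<omega>
  have Im[measurable]: "I n \<in> borel_measurable M" if "n < N" for n unfolding I_def using that by measurable
  have em[measurable]: "e c n \<in> borel_measurable M" if "n < N" for n c unfolding e_def using that by measurable
  have nI: "norm (I n \<omega>) \<le> 1" for n \<omega>
    unfolding I_def prod_norm[symmetric] by (intro prod_le_1) (auto simp: indicator_def)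
  have ne: "norm (e c n \<omega>) = 1" for c n \<omega> unfolding e_def by simp
  have claim: "(\<integral>\<omega>. (\<Prod>n<m. I n \<omega>) * (\<Prod>n\<in>{m..<N}. e c n \<omega>) \<partial>M) =
    (\<Prod>n<m. \<integral>\<omega>. I n \<omega> \<partial>M) * (\<Prod>n\<in>{m..<N}. \<integral>\<omega>. e c n \<omega> \<partial>M)" if "m \<le> N" for m c
    using that
  proof (induction m arbitrary: c)
    case 0
    have "(\<Prod>n\<in>{0..<N}. e c n \<omega>) = iexp (\<Sum>n<N. \<Sum>t\<in>J. c n t * X n t \<omega>)" for \<omega>
      unfolding e_def by (simp add: exp_sum sum_distrib_left atLeast0LessThan)
    then show ?case using fac[of c] unfolding e_def by (simp add: atLeast0LessThan)
  next
    case (Suc m)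
    then have m: "m < N" by simp
    define P where "P \<omega> = (\<Prod>n<m. I n \<omega>) * (\<Prod>n\<in>{Suc m..<N}. e c n \<omega>)" for \<omega>
    define K where "K = (\<Prod>n<m. \<integral>\<omega>. I n \<omega> \<partial>M) * (\<Prod>n\<in>{Suc m..<N}. \<integral>\<omega>. e c n \<omega> \<partial>M)"
    have Pm[measurable]: "P \<in> borel_measurable M" unfolding P_def
      by (intro borel_measurable_times borel_measurable_prod Im em) (use m in auto)
    have nP: "norm (P \<omega>) \<le> 1" for \<omega>
    proof -
      have "norm (\<Prod>n<m. I n \<omega>) \<le> 1" unfolding prod_norm[symmetric] by (intro prod_le_1) (auto simp: nI)
      moreover have "norm (\<Prod>n\<in>{Suc m..<N}. e c n \<omega>) = 1" unfolding prod_norm[symmetric] by (simp add: ne)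
      ultimately show ?thesis unfolding P_def norm_mult by simp
    qed
    have iP: "integrable M (\<lambda>\<omega>. P \<omega> * f \<omega>)" if "f \<in> borel_measurable M" "\<And>\<omega>. norm (f \<omega>) \<le> 1" for f
    proof (rule integrable_bounded[OF M, of _ 1])
      show "norm (P \<omega> * f \<omega>) \<le> 1" for \<omega> unfolding norm_mult using mult_mono[OF nP that(2)] by simp
    qed (use that in measurable)
    have iK: "integrable M (\<lambda>\<omega>. K * f \<omega>)" if "f \<in> borel_measurable M" "\<And>\<omega>. norm (f \<omega>) \<le> 1" for f
      by (intro integrable_mult_right integrable_bounded[OF M, of _ 1]) (use that in auto)
    \<comment> \<open>The induction hypothesis, with arbitrary coefficients in block
      \<open>m\<close>, says that \<open>P - K\<close> integrates to zero against every exponential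
      of this block. By uniqueness the same holds against products of indicators.\<close>
    have "(\<integral>\<omega>. (P \<omega> - K) * (\<Prod>t\<in>J. indicator (A m t) (X m t \<omega>)) \<partial>M) = 0"
    proof (rule integral_prod_indicator_zero[OF M J])
      show "norm (P \<omega> - K) \<le> 1 + norm K" for \<omega> using norm_triangle_ineq4[of "P \<omega>" K] nP[of \<omega>] by linarith
      fix a :: "'t \<Rightarrow> real"
      let ?c = "c(m := a)"
      have e1: "e ?c n = e c n" if "n \<noteq> m" for n using that by (simp add: e_def fun_eq_iff)
      have em': "e ?c m \<omega> = iexp (\<Sum>t\<in>J. a t * X m t \<omega>)" for \<omega> by (simp add: e_def)
      have s: "{m..<N} = insert m {Suc m..<N}" using m by auto
      have "(\<integral>\<omega>. P \<omega> * e ?c m \<omega> \<partial>M) = (\<integral>\<omega>. (\<Prod>n<m. I n \<omega>) * (\<Prod>n\<in>{m..<N}. e ?c n \<omega>) \<partial>M)"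
        unfolding P_def s by (simp add: e1 mult_ac)
      also have "\<dots> = K * (\<integral>\<omega>. e ?c m \<omega> \<partial>M)"
        unfolding Suc.IH[OF less_imp_le[OF m]] unfolding K_def s by (simp add: e1 mult_ac)
      finally have "(\<integral>\<omega>. P \<omega> * e ?c m \<omega> - K * e ?c m \<omega> \<partial>M) = 0"
        using iP[of "e ?c m"] iK[of "e ?c m"] em[OF m] ne by (subst Bochner_Integration.integral_diff) auto
      then show "(\<integral>\<omega>. (P \<omega> - K) * iexp (\<Sum>t\<in>J. a t * X m t \<omega>) \<partial>M) = 0"
        unfolding em'[symmetric] by (simp add: left_diff_distrib)
    qed (use m X A in auto)
    then have "(\<integral>\<omega>. P \<omega> * I m \<omega> - K * I m \<omega> \<partial>M) = 0" by (simp add: left_diff_distrib I_def)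
    then have "(\<integral>\<omega>. P \<omega> * I m \<omega> \<partial>M) = K * (\<integral>\<omega>. I m \<omega> \<partial>M)"
      using iP[of "I m"] iK[of "I m"] Im[OF m] nI by (subst (asm) Bochner_Integration.integral_diff) auto
    then show ?case unfolding P_def K_def by (simp add: mult_ac)
  qed
  have r: "I n \<omega> = complex_of_real (\<Prod>t\<in>J. indicat_real (A n t) (X n t \<omega>))" for n \<omega>
    unfolding I_def of_real_prod by (intro prod.cong refl) (auto simp: indicator_def)
  have "complex_of_real (\<integral>\<omega>. (\<Prod>n<N. \<Prod>t\<in>J. indicat_real (A n t) (X n t \<omega>)) \<partial>M) =
     complex_of_real (\<Prod>n<N. \<integral>\<omega>. (\<Prod>t\<in>J. indicat_real (A n t) (X n t \<omega>)) \<partial>M)"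
    using claim[OF order_refl] unfolding r by (simp flip: of_real_prod)
  then show ?thesis by (simp only: of_real_eq_iff)
qed

text \<open>Cylinder sets form an intersection-stable generator of the path sigma-algebra, so
  independence has to be checked on them only, and there it is a statement about finitely many
  times.\<close>

lemma indep_processes_of_char:
  assumes M: "prob_space M"
    and X[measurable]: "\<And>n t. n < N \<Longrightarrow> 0 \<le> t \<Longrightarrow> X n t \<in> borel_measurable M"
    and fac: "\<And>J c. finite J \<Longrightarrow> J \<subseteq> {0..} \<Longrightarrow>
      (\<integral>\<omega>. iexp (\<Sum>n<N. \<Sum>t\<in>J. c n t * X n t \<omega>) \<partial>M) = (\<Prod>n<N. \<integral>\<omega>. iexp (\<Sum>t\<in>J. c n t * X n t \<omega>) \<partial>M)"
  shows "indep_processes M X {..<N}"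
proof -
  interpret prob_space M by fact
  define Y where "Y n \<omega> = (\<lambda>t\<in>{0::real..}. X n t \<omega>)" for n \<omega>
  let ?S = "PiM {0::real..} (\<lambda>_. borel :: real measure)"
  let ?F = "\<lambda>n. {Y n -` B \<inter> space M | B. B \<in> prod_algebra {0::real..} (\<lambda>_. borel :: real measure)}"
  have Ym: "Y n \<in> measurable M ?S" if "n < N" for n
    unfolding Y_def by (rule measurable_restrict) (use that in auto)
  have "sigma_sets (space M) {Y n -` B \<inter> space M | B. B \<in> sets ?S} = sigma_sets (space M) (?F n)" if "n < N" for n
  proof -
    have "Y n \<in> space M \<rightarrow> (\<Pi>\<^sub>E i\<in>{0::real..}. space (borel :: real measure))"
      using measurable_space[OF Ym[OF that]] by (auto simp: space_PiM)
    from sigma_sets_vimage_commute[OF this, of "prod_algebra {0..} (\<lambda>_. borel)"]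
    have "{Y n -` B \<inter> space M | B. B \<in> sets ?S} = sigma_sets (space M) (?F n)" unfolding sets_PiM by simp
    moreover have "?F n \<subseteq> Pow (space M)" by auto
    ultimately show ?thesis by (simp only: sigma_sets_sigma_sets_eq)
  qed
  note sig = this
  have "indep_sets ?F {..<N}"
  proof (rule indep_setsI)
    fix n assume n: "n \<in> {..<N}"
    have "B \<in> sets ?S" if "B \<in> prod_algebra {0::real..} (\<lambda>_. borel :: real measure)" for B
      using that unfolding sets_PiM by auto
    then show "?F n \<subseteq> events" using measurable_sets[OF Ym] n by blast
  next
    fix B K assume K: "K \<subseteq> {..<N}" "K \<noteq> {}" "finite K" and B: "\<forall>j\<in>K. B j \<in> ?F j"
    define R where "R n J E \<longleftrightarrow> finite J \<and> J \<subseteq> {0..} \<and> (\<forall>t\<in>J. E t \<in> sets borel) \<and>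
       B n = {\<omega> \<in> space M. \<forall>t\<in>J. X n t \<omega> \<in> E t}" for n J and E :: "real \<Rightarrow> real set"
    have "\<forall>n\<in>K. \<exists>J E. R n J E"
    proof
      fix n assume n: "n \<in> K"
      then obtain C where C: "C \<in> prod_algebra {0::real..} (\<lambda>_. borel :: real measure)" "B n = Y n -` C \<inter> space M" using B by blast
      from C(1) obtain J E where JE: "C = prod_emb {0..} (\<lambda>_. borel) J (\<Pi>\<^sub>E j\<in>J. E j)" "finite J" "J \<subseteq> {0..}" "\<And>i. i \<in> J \<Longrightarrow> E i \<in> sets (borel :: real measure)"
        by (rule prod_algebraE) (rule that, auto)
      have Bn: "B n = {\<omega> \<in> space M. \<forall>t\<in>J. X n t \<omega> \<in> E t}"
      proof -
        have "restrict (Y n \<omega>) J = (\<lambda>t\<in>J. X n t \<omega>)" for \<omega>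
          unfolding Y_def using JE(3) by (auto simp: restrict_def fun_eq_iff)
        then have a: "restrict (Y n \<omega>) J \<in> Pi\<^sub>E J E \<longleftrightarrow> (\<forall>t\<in>J. X n t \<omega> \<in> E t)" for \<omega>
          by (simp only: restrict_PiE_iff)
        have c: "Y n \<omega> \<in> (\<Pi>\<^sub>E i\<in>{0..}. space borel)" for \<omega> by (simp add: Y_def)
        show ?thesis unfolding C(2) JE(1) prod_emb_def
          by (auto simp only: Int_iff vimage_eq mem_Collect_eq a c)
      qed
      show "\<exists>J E. R n J E" unfolding R_def
        by (intro exI[of _ J] exI[of _ E] conjI ballI) (fact JE(2) JE(3) Bn | erule JE(4))+
    qed
    then obtain J E where JE: "\<And>n. n \<in> K \<Longrightarrow> R n (J n) (E n)" by metis
    have Jn: "finite (J n)" "J n \<subseteq> {0..}" and En: "t \<in> J n \<Longrightarrow> E n t \<in> sets borel"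
      and Bn: "B n = {\<omega> \<in> space M. \<forall>t\<in>J n. X n t \<omega> \<in> E n t}" if "n \<in> K" for n t
      using JE[OF that] unfolding R_def by blast+
    define JJ where "JJ = (\<Union>n\<in>K. J n)"
    have JJ: "finite JJ" "JJ \<subseteq> {0..}" unfolding JJ_def using Jn K(3) by blast+
    \<comment> \<open>The cylinders may involve different times. All are extended to the common set
      \<open>JJ\<close> by the void constraint \<open>UNIV\<close>, which also covers the processes
      outside \<open>K\<close>.\<close>
    define A where "A n t = (if n \<in> K \<and> t \<in> J n then E n t else UNIV)" for n t
    have Am: "A n t \<in> sets borel" for n t unfolding A_def using En by simp
    define D where "D n = {\<omega> \<in> space M. \<forall>t\<in>JJ. X n t \<omega> \<in> A n t}" for n
    have DB: "D n = B n" if "n \<in> K" for n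
    proof -
      have "(\<forall>t\<in>JJ. X n t \<omega> \<in> A n t) \<longleftrightarrow> (\<forall>t\<in>J n. X n t \<omega> \<in> E n t)" for \<omega>
        using that unfolding A_def JJ_def by auto
      then show ?thesis unfolding D_def Bn[OF that] by simp
    qed
    have DS: "D n = space M" if "n \<notin> K" for n unfolding D_def A_def using that by auto
    have Dm: "D n \<in> events" if n: "n < N" for n
      unfolding D_def
    proof (rule sets.sets_Collect_finite_All[OF _ JJ(1)])
      fix t assume "t \<in> JJ"
      then have "X n t -` A n t \<inter> space M \<in> events" using n JJ(2) by (intro measurable_sets[OF X Am]) auto
      then show "{\<omega> \<in> space M. X n t \<omega> \<in> A n t} \<in> events" by (simp add: vimage_def Int_def conj_commute)
    qed
    have ind: "(\<Prod>t\<in>JJ. indicat_real (A n t) (X n t \<omega>)) = indicator (D n) \<omega>" if "\<omega> \<in> space M" for n \<omega>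
    proof (cases "\<forall>t\<in>JJ. X n t \<omega> \<in> A n t")
      case True
      then have "(\<Prod>t\<in>JJ. indicat_real (A n t) (X n t \<omega>)) = 1" by (intro prod.neutral) simp
      then show ?thesis using True that by (simp add: D_def)
    next
      case False
      then have "\<exists>t\<in>JJ. indicat_real (A n t) (X n t \<omega>) = 0" by (force simp: indicator_def)
      then have "(\<Prod>t\<in>JJ. indicat_real (A n t) (X n t \<omega>)) = 0" by (rule prod_zero[OF JJ(1)])
      then show ?thesis using False by (simp add: D_def)
    qed
    have ind2: "(\<Prod>n<N. indicat_real (D n) \<omega>) = indicator (\<Inter>n\<in>K. B n) \<omega>" if "\<omega> \<in> space M" for \<omega>
    proof (cases "\<forall>n\<in>K. \<omega> \<in> B n")
      case True
      then have "\<omega> \<in> D n" for n by (cases "n \<in> K") (use DB DS that in auto)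
      then have "(\<Prod>n<N. indicat_real (D n) \<omega>) = 1" by (intro prod.neutral) simp
      then show ?thesis using True by simp
    next
      case False
      then obtain n where n: "n \<in> K" "\<omega> \<notin> D n" using DB by blast
      then have "n \<in> {..<N}" using K(1) by blast
      then have "(\<Prod>n<N. indicat_real (D n) \<omega>) = 0" using n by (intro prod_zero bexI[of _ n]) auto
      then show ?thesis using False by simp
    qed
    have "prob (\<Inter>n\<in>K. B n) = (\<integral>\<omega>. (\<Prod>n<N. \<Prod>t\<in>JJ. indicat_real (A n t) (X n t \<omega>)) \<partial>M)"
    proof -
      have "B n \<in> events" if "n \<in> K" for n using Dm[of n] DB[OF that] K(1) that by auto
      then have "(\<Inter>n\<in>K. B n) \<in> events" using K by (intro sets.finite_INT) auto
      then have "prob (\<Inter>n\<in>K. B n) = (\<integral>\<omega>. indicat_real (\<Inter>n\<in>K. B n) \<omega> \<partial>M)" by simp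
      also have "\<dots> = (\<integral>\<omega>. (\<Prod>n<N. \<Prod>t\<in>JJ. indicat_real (A n t) (X n t \<omega>)) \<partial>M)"
        by (intro Bochner_Integration.integral_cong refl) (simp add: ind ind2)
      finally show ?thesis .
    qed
    also have "\<dots> = (\<Prod>n<N. \<integral>\<omega>. (\<Prod>t\<in>JJ. indicat_real (A n t) (X n t \<omega>)) \<partial>M)"
      by (rule char_factor_imp_prob_factor[OF M JJ(1) _ Am fac[OF JJ]]) (use X JJ in auto)
    also have "\<dots> = (\<Prod>n<N. prob (D n))"
    proof (intro prod.cong refl)
      fix n assume "n \<in> {..<N}"
      then have "prob (D n) = (\<integral>\<omega>. indicat_real (D n) \<omega> \<partial>M)" using Dm by simp
      also have "\<dots> = (\<integral>\<omega>. (\<Prod>t\<in>JJ. indicat_real (A n t) (X n t \<omega>)) \<partial>M)"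
        by (intro Bochner_Integration.integral_cong refl) (simp add: ind)
      finally show "(\<integral>\<omega>. (\<Prod>t\<in>JJ. indicat_real (A n t) (X n t \<omega>)) \<partial>M) = prob (D n)" by simp
    qed
    also have "\<dots> = (\<Prod>n\<in>K. prob (B n))"
      by (rule prod.mono_neutral_cong_right) (use K DB DS prob_space in auto)
    finally show "prob (\<Inter>n\<in>K. B n) = (\<Prod>n\<in>K. prob (B n))" .
  qed
  then have "indep_sets (\<lambda>n. sigma_sets (space M) (?F n)) {..<N}"
  proof (rule indep_sets_sigma)
    fix n
    have st: "Int_stable (prod_algebra {0::real..} (\<lambda>_. borel :: real measure))" by (rule Int_stable_prod_algebra)
    show "Int_stable (?F n)"
    proof (rule Int_stableI)
      fix a b assume "a \<in> ?F n" "b \<in> ?F n"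
      then obtain C D where "C \<in> prod_algebra {0::real..} (\<lambda>_. borel :: real measure)" "D \<in> prod_algebra {0::real..} (\<lambda>_. borel :: real measure)"
        "a = Y n -` C \<inter> space M" "b = Y n -` D \<inter> space M" by blast
      then show "a \<inter> b \<in> ?F n" using Int_stableD[OF st] by (intro CollectI exI[of _ "C \<inter> D"]) auto
    qed
  qed
  then have "indep_sets (\<lambda>n. sigma_sets (space M) {Y n -` B \<inter> space M | B. B \<in> sets ?S}) {..<N}"
    by (subst indep_sets_cong[OF refl sig]) auto
  then have "indep_vars (\<lambda>_. ?S) Y {..<N}" unfolding indep_vars_def using Ym by auto
  then show ?thesis unfolding indep_processes_def Y_def .
qed

section \<open>Gaussian laws read off from characteristic functions\<close>

lemma char_normal_distributed:
  assumes M: "prob_space M" and \<sigma>: "0 < \<sigma>" and X: "distributed M lborel X (normal_density 0 \<sigma>)"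
  shows "(\<integral>\<omega>. iexp (s * X \<omega>) \<partial>M) = complex_of_real (exp (- (\<sigma> * s)\<^sup>2 / 2))"
proof -
  interpret prob_space M by fact
  define Z where "Z \<omega> = (X \<omega> - 0) / \<sigma>" for \<omega>
  have Z: "distributed M lborel Z std_normal_density"
    unfolding Z_def using normal_standard_normal_convert[OF \<sigma>, of X 0] X by simp
  have Zm: "Z \<in> borel_measurable M" using distributed_measurable[OF Z] by simp
  have "distr M borel Z = distr M lborel Z" by (rule distr_cong) auto
  also have "\<dots> = std_normal_distribution" using distributed_distr_eq_density[OF Z] by simp
  finally have d: "distr M borel Z = std_normal_distribution" .
  have "char (distr M borel Z) (s * \<sigma>) = (\<integral>\<omega>. iexp ((s * \<sigma>) * Z \<omega>) \<partial>M)"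
    unfolding char_def by (rule integral_distr) (use Zm in auto)
  also have "\<dots> = (\<integral>\<omega>. iexp (s * X \<omega>) \<partial>M)" using \<sigma> by (simp add: Z_def)
  finally show ?thesis unfolding d char_std_normal_distribution by (simp add: mult.commute)
qed

text \<open>The point mass \<open>v = 0\<close> is included, because the limit processes have
  variance 0 at time 0.\<close>

lemma distr_of_gaussian_char:
  assumes M: "prob_space M" and Y[measurable]: "Y \<in> borel_measurable M" and v: "0 \<le> v"
    and ch: "\<And>s. (\<integral>\<omega>. iexp (s * Y \<omega>) \<partial>M) = complex_of_real (exp (- v * s\<^sup>2 / 2))"
  shows "distr M borel Y = (if sqrt v = 0 then return borel 0 else density lborel (normal_density 0 (sqrt v)))"
proof (rule Levy_uniqueness)
  interpret prob_space M by fact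
  show "real_distribution (distr M borel Y)" by (rule real_distribution_distr) fact
  show "real_distribution (if sqrt v = 0 then return borel 0 else density lborel (normal_density 0 (sqrt v)))"
    using v prob_space_normal_density[of "sqrt v" 0] prob_space_return[of 0 borel]
    by (auto simp: real_distribution_def real_distribution_axioms_def)
  show "char (distr M borel Y) = char (if sqrt v = 0 then return borel 0 else density lborel (normal_density 0 (sqrt v)))"
  proof
    fix s
    have "char (distr M borel Y) s = (\<integral>\<omega>. iexp (s * Y \<omega>) \<partial>M)"
      unfolding char_def by (rule integral_distr) auto
    also have "\<dots> = char (if sqrt v = 0 then return borel 0 else density lborel (normal_density 0 (sqrt v))) s"
    proof (cases "v = 0")
      case True
      then show ?thesis unfolding ch by (simp add: char_def integral_return)
    next
      case False
      then have sv: "0 < sqrt v" using v by simp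
      let ?D = "density lborel (normal_density 0 (sqrt v))"
      have D: "prob_space ?D" by (rule prob_space_normal_density[OF sv])
      have "distr ?D lborel (\<lambda>x. x) = ?D" by (rule distr_id2) simp
      then have "distributed ?D lborel (\<lambda>x. x) (normal_density 0 (sqrt v))"
        unfolding distributed_def by simp
      from char_normal_distributed[OF D sv this, of s] show ?thesis
        unfolding ch using False v by (simp add: char_def power_mult_distrib)
    qed
    finally show "char (distr M borel Y) s = char (if sqrt v = 0 then return borel 0 else density lborel (normal_density 0 (sqrt v))) s" .
  qed
qed

lemma moments_of_gaussian_char:
  assumes M: "prob_space M" and Y[measurable]: "Y \<in> borel_measurable M" and v: "0 \<le> v"
    and ch: "\<And>s. (\<integral>\<omega>. iexp (s * Y \<omega>) \<partial>M) = complex_of_real (exp (- v * s\<^sup>2 / 2))"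
  shows "gaussian_rv M Y" "(\<integral>\<omega>. Y \<omega> \<partial>M) = 0" "integrable M (\<lambda>\<omega>. (Y \<omega>)\<^sup>2)" "(\<integral>\<omega>. (Y \<omega>)\<^sup>2 \<partial>M) = v"
proof -
  note d = distr_of_gaussian_char[OF assms]
  show "gaussian_rv M Y" unfolding gaussian_rv_def using d Y v by (intro conjI exI[of _ 0] exI[of _ "sqrt v"]) auto
  have E: "(\<integral>\<omega>. f (Y \<omega>) \<partial>M) = (\<integral>x. f x \<partial>distr M borel Y)" if "f \<in> borel_measurable borel" for f :: "real \<Rightarrow> real"
    by (rule integral_distr[symmetric]) (use that in auto)
  have I: "integrable M (\<lambda>\<omega>. f (Y \<omega>)) = integrable (distr M borel Y) f" if "f \<in> borel_measurable borel" for f :: "real \<Rightarrow> real"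
    by (rule integrable_distr_eq[symmetric]) (use that in auto)
  have "(\<integral>\<omega>. Y \<omega> \<partial>M) = 0 \<and> integrable M (\<lambda>\<omega>. (Y \<omega>)\<^sup>2) \<and> (\<integral>\<omega>. (Y \<omega>)\<^sup>2 \<partial>M) = v"
  proof (cases "v = 0")
    case True
    have ae: "AE x in return borel (0::real). x\<^sup>2 = 0" by (subst AE_return) auto
    have "integrable (return borel (0::real)) (\<lambda>x. x\<^sup>2) = integrable (return borel (0::real)) (\<lambda>x. 0 :: real)"
      by (rule integrable_cong_AE[OF _ _ ae]) auto
    then show ?thesis using E[of "\<lambda>x. x"] E[of "\<lambda>x. x\<^sup>2"] I[of "\<lambda>x. x\<^sup>2"] unfolding d using True by (simp add: integral_return)
  next
    case False
    then have sv: "0 < sqrt v" using v by simp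
    have "(\<integral>\<omega>. Y \<omega> \<partial>M) = 0"
      using E[of "\<lambda>x. x"] unfolding d using sv integral_normal_moment_nz_1[OF sv, of 0] by (simp add: integral_density)
    moreover have "integrable M (\<lambda>\<omega>. (Y \<omega>)\<^sup>2)"
      using I[of "\<lambda>x. x\<^sup>2"] unfolding d using sv integrable_normal_moment[OF sv, of 0 2] by (simp add: integrable_density)
    moreover have "(\<integral>\<omega>. (Y \<omega>)\<^sup>2 \<partial>M) = v"
      using E[of "\<lambda>x. x\<^sup>2"] unfolding d using sv v integral_normal_moment_even[OF sv, of 0 1]
      by (simp add: integral_density fact_numeral)
    ultimately show ?thesis by blast
  qed
  then show "(\<integral>\<omega>. Y \<omega> \<partial>M) = 0" "integrable M (\<lambda>\<omega>. (Y \<omega>)\<^sup>2)" "(\<integral>\<omega>. (Y \<omega>)\<^sup>2 \<partial>M) = v" by auto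
qed

text \<open>One identity for the joint characteristic function encodes Gaussianity, independence
  across \<open>n\<close> and the covariances. It is stable under pointwise limits and under image
  measures, the two operations it has to survive.\<close>

locale gaussian_family = prob_space M for M :: "'a measure" +
  fixes N :: nat and X :: "nat \<Rightarrow> real \<Rightarrow> 'a \<Rightarrow> real" and \<gamma> :: "nat \<Rightarrow> real \<Rightarrow> real \<Rightarrow> real"
  assumes meas: "\<And>n t. n < N \<Longrightarrow> 0 \<le> t \<Longrightarrow> X n t \<in> borel_measurable M"
    and sym: "\<And>n s t. \<gamma> n s t = \<gamma> n t s"
    and char_fun: "\<And>J c. finite J \<Longrightarrow> J \<subseteq> {0..} \<Longrightarrow>
      (\<integral>\<omega>. iexp (\<Sum>n<N. \<Sum>t\<in>J. c n t * X n t \<omega>) \<partial>M) =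
      complex_of_real (exp (- (\<Sum>n<N. \<Sum>s\<in>J. \<Sum>t\<in>J. c n s * c n t * \<gamma> n s t) / 2))"
begin

lemma comb_moments:
  fixes c :: "nat \<Rightarrow> real \<Rightarrow> real"
  assumes J: "finite J" "J \<subseteq> {0..}"
  defines "L \<equiv> \<lambda>\<omega>. \<Sum>n<N. \<Sum>t\<in>J. c n t * X n t \<omega>"
    and "V \<equiv> \<Sum>n<N. \<Sum>s\<in>J. \<Sum>t\<in>J. c n s * c n t * \<gamma> n s t"
  shows "gaussian_rv M L" "(\<integral>\<omega>. L \<omega> \<partial>M) = 0" "integrable M (\<lambda>\<omega>. (L \<omega>)\<^sup>2)" "(\<integral>\<omega>. (L \<omega>)\<^sup>2 \<partial>M) = V"
proof -
  have Lm: "L \<in> borel_measurable M"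
    unfolding L_def by (intro borel_measurable_sum borel_measurable_times borel_measurable_const meas) (use J in auto)
  have ch: "(\<integral>\<omega>. iexp (r * L \<omega>) \<partial>M) = complex_of_real (exp (- V * r\<^sup>2 / 2))" for r
  proof -
    have "r * L \<omega> = (\<Sum>n<N. \<Sum>t\<in>J. (r * c n t) * X n t \<omega>)" for \<omega>
      unfolding L_def by (simp add: sum_distrib_left mult.assoc)
    moreover have "(\<Sum>n<N. \<Sum>s\<in>J. \<Sum>t\<in>J. (r * c n s) * (r * c n t) * \<gamma> n s t) = V * r\<^sup>2"
      unfolding V_def sum_distrib_right by (simp add: power2_eq_square mult_ac)
    ultimately show ?thesis using char_fun[OF J, of "\<lambda>n t. r * c n t"] by (simp only: minus_mult_left)
  qed
  \<comment> \<open>A characteristic function has modulus at most 1, which forces the quadratic form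
    to be nonnegative.\<close>
  have "0 \<le> V"
  proof -
    have "norm (\<integral>\<omega>. iexp (1 * L \<omega>) \<partial>M) \<le> (\<integral>\<omega>. norm (iexp (1 * L \<omega>)) \<partial>M)" by (rule integral_norm_bound)
    then have "exp (- V / 2) \<le> 1" unfolding ch by (simp add: prob_space)
    then show ?thesis by simp
  qed
  from moments_of_gaussian_char[OF prob_space_axioms Lm this ch]
  show "gaussian_rv M L" "(\<integral>\<omega>. L \<omega> \<partial>M) = 0" "integrable M (\<lambda>\<omega>. (L \<omega>)\<^sup>2)" "(\<integral>\<omega>. (L \<omega>)\<^sup>2 \<partial>M) = V" by auto
qed

lemma sum_if_eq_index:
  assumes "n < N" shows "(\<Sum>k<N. (if k = n then f k else 0)) = (f n :: 'b::comm_monoid_add)"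
  using assms by (simp add: sum.delta)

lemma centered_gaussian: 
  assumes n: "n < N"
  shows "centered_gaussian_process M (X n)"
proof -
  have e: "(\<Sum>k<N. \<Sum>t\<in>J. (if k = n then c t else 0) * X k t \<omega>) = (\<Sum>t\<in>J. c t * X n t \<omega>)" for J c \<omega>
  proof -
    have "(\<Sum>k<N. \<Sum>t\<in>J. (if k = n then c t else 0) * X k t \<omega>) = (\<Sum>k<N. if k = n then (\<Sum>t\<in>J. c t * X k t \<omega>) else 0)"
      by (intro sum.cong refl) auto
    then show ?thesis unfolding sum_if_eq_index[OF n] .
  qed
  show ?thesis unfolding centered_gaussian_process_def
  proof (intro conjI allI impI)
    fix J :: "real set" and c assume J: "finite J" "J \<subseteq> {0..}"
    from comb_moments(1)[OF J, of "\<lambda>k t. if k = n then c t else 0"]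
    show "gaussian_rv M (\<lambda>\<omega>. \<Sum>t\<in>J. c t * X n t \<omega>)" unfolding e .
  next
    fix t :: real assume "0 \<le> t"
    with comb_moments(2)[of "{t}" "\<lambda>k t. if k = n then 1 else 0"] show "(\<integral>\<omega>. X n t \<omega> \<partial>M) = 0"
      unfolding e by simp
  qed
qed

text \<open>Polarisation: the second moments of the two variables and of their sum are known from
  \<open>comb_moments\<close>. The set \<open>J\<close> may collapse to one point when
  \<open>s = t\<close>; the bilinear form \<open>B\<close> is insensitive to that.\<close>

lemma covariance:
  assumes m: "m < N" "n < N" and t: "0 \<le> s" "0 \<le> t"
  shows "(\<integral>\<omega>. X m s \<omega> * X n t \<omega> \<partial>M) = (if m = n then \<gamma> n s t else 0)"
proof -
  define J where "J = {s, t}"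
  have J: "finite J" "J \<subseteq> {0..}" "s \<in> J" "t \<in> J" using t by (auto simp: J_def)
  define c d :: "nat \<Rightarrow> real \<Rightarrow> real" where "c k r = (if k = m then if r = s then 1 else 0 else 0)"
    and "d k r = (if k = n then if r = t then 1 else 0 else 0)" for k r
  define B where "B u v = (\<Sum>k<N. \<Sum>p\<in>J. \<Sum>r\<in>J. u k p * v k r * \<gamma> k p r)" for u v :: "nat \<Rightarrow> real \<Rightarrow> real"
  have Lc: "(\<Sum>k<N. \<Sum>r\<in>J. c k r * f k r) = f m s" for f :: "nat \<Rightarrow> real \<Rightarrow> real"
  proof -
    have "(\<Sum>k<N. \<Sum>r\<in>J. c k r * f k r) = (\<Sum>k<N. if k = m then (\<Sum>r\<in>J. if r = s then f k r else 0) else 0)"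
      by (intro sum.cong refl) (auto simp: c_def intro!: sum.cong)
    then show ?thesis using J m by (simp add: sum.delta)
  qed
  have Ld: "(\<Sum>k<N. \<Sum>r\<in>J. d k r * f k r) = f n t" for f :: "nat \<Rightarrow> real \<Rightarrow> real"
  proof -
    have "(\<Sum>k<N. \<Sum>r\<in>J. d k r * f k r) = (\<Sum>k<N. if k = n then (\<Sum>r\<in>J. if r = t then f k r else 0) else 0)"
      by (intro sum.cong refl) (auto simp: d_def intro!: sum.cong)
    then show ?thesis using J m by (simp add: sum.delta)
  qed
  have Bcd: "B c d = (if m = n then \<gamma> n s t else 0)"
  proof -
    have "B c d = (\<Sum>k<N. \<Sum>p\<in>J. c k p * (\<Sum>r\<in>J. d k r * \<gamma> k p r))"
      unfolding B_def by (simp add: sum_distrib_left mult.assoc)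
    also have "\<dots> = (\<Sum>r\<in>J. d m r * \<gamma> m s r)" by (rule Lc)
    also have "\<dots> = (if m = n then \<gamma> n s t else 0)"
      using J by (auto simp: d_def if_distrib[of "\<lambda>x. x * _"] sum.delta cong: if_cong)
    finally show ?thesis .
  qed
  have Bs: "B d c = B c d"
    unfolding B_def
  proof (rule sum.cong[OF refl])
    fix k
    show "(\<Sum>p\<in>J. \<Sum>r\<in>J. d k p * c k r * \<gamma> k p r) = (\<Sum>p\<in>J. \<Sum>r\<in>J. c k p * d k r * \<gamma> k p r)"
      by (subst sum.swap, intro sum.cong refl) (metis sym mult.commute)
  qed
  have Badd: "B (\<lambda>k r. c k r + d k r) (\<lambda>k r. c k r + d k r) = B c c + B c d + (B d c + B d d)"
    unfolding B_def sum.distrib[symmetric] by (intro sum.cong refl) (simp add: algebra_simps)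
  have "(\<integral>\<omega>. (X m s \<omega>)\<^sup>2 \<partial>M) = B c c" "integrable M (\<lambda>\<omega>. (X m s \<omega>)\<^sup>2)"
    using comb_moments(3,4)[OF J(1,2), of c] unfolding Lc B_def by auto
  moreover have "(\<integral>\<omega>. (X n t \<omega>)\<^sup>2 \<partial>M) = B d d" "integrable M (\<lambda>\<omega>. (X n t \<omega>)\<^sup>2)"
    using comb_moments(3,4)[OF J(1,2), of d] unfolding Ld B_def by auto
  moreover have "(\<integral>\<omega>. (X m s \<omega> + X n t \<omega>)\<^sup>2 \<partial>M) = B c c + 2 * B c d + B d d" "integrable M (\<lambda>\<omega>. (X m s \<omega> + X n t \<omega>)\<^sup>2)"
  proof -
    have Lcd: "(\<Sum>k<N. \<Sum>r\<in>J. (c k r + d k r) * X k r \<omega>) = X m s \<omega> + X n t \<omega>" for \<omega>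
      unfolding distrib_right sum.distrib Lc Ld ..
    from comb_moments(3,4)[OF J(1,2), of "\<lambda>k r. c k r + d k r"]
    show "(\<integral>\<omega>. (X m s \<omega> + X n t \<omega>)\<^sup>2 \<partial>M) = B c c + 2 * B c d + B d d" "integrable M (\<lambda>\<omega>. (X m s \<omega> + X n t \<omega>)\<^sup>2)"
      unfolding Lcd B_def[of "\<lambda>k r. c k r + d k r" "\<lambda>k r. c k r + d k r", symmetric] Badd Bs by auto
  qed
  moreover have "X m s \<omega> * X n t \<omega> = (1 / 2) * (((X m s \<omega> + X n t \<omega>)\<^sup>2 - (X m s \<omega>)\<^sup>2) - (X n t \<omega>)\<^sup>2)" for \<omega>
    by (simp add: power2_sum)
  ultimately show ?thesis unfolding Bcd[symmetric] by (simp only:) simp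
qed

lemma char_factor:
  assumes J: "finite J" "J \<subseteq> {0..}"
  shows "(\<integral>\<omega>. iexp (\<Sum>n<N. \<Sum>t\<in>J. c n t * X n t \<omega>) \<partial>M) = (\<Prod>n<N. \<integral>\<omega>. iexp (\<Sum>t\<in>J. c n t * X n t \<omega>) \<partial>M)"
proof -
  have "(\<integral>\<omega>. iexp (\<Sum>t\<in>J. c n t * X n t \<omega>) \<partial>M) = complex_of_real (exp (- (\<Sum>s\<in>J. \<Sum>t\<in>J. c n s * c n t * \<gamma> n s t) / 2))"
    if n: "n < N" for n
  proof -
    have "(\<Sum>k<N. \<Sum>t\<in>J. (if k = n then c k t else 0) * X k t \<omega>) = (\<Sum>k<N. if k = n then (\<Sum>t\<in>J. c k t * X k t \<omega>) else 0)" for \<omega>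
      by (intro sum.cong refl) auto
    moreover have "(\<Sum>k<N. \<Sum>s\<in>J. \<Sum>t\<in>J. (if k = n then c k s else 0) * (if k = n then c k t else 0) * \<gamma> k s t) =
       (\<Sum>k<N. if k = n then (\<Sum>s\<in>J. \<Sum>t\<in>J. c k s * c k t * \<gamma> k s t) else 0)"
      by (intro sum.cong refl) auto
    ultimately show ?thesis
      using char_fun[OF J, of "\<lambda>k t. if k = n then c k t else 0"] unfolding sum_if_eq_index[OF n] by (simp only: sum_if_eq_index[OF n])
  qed
  then show ?thesis unfolding char_fun[OF J]
    by (simp add: sum_negf[symmetric] sum_divide_distrib exp_sum flip: of_real_prod)
qed

end

section \<open>Random elements of the path space\<close>

abbreviation path_metric :: "real \<Rightarrow> (real \<Rightarrow> real) metric" where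
  "path_metric T \<equiv> cfunspace (top_of_set {0..T}) euclidean_metric"

text \<open>Compactness of the interval makes the boundedness required in the function space
  automatic.\<close>

lemma mspace_path_metric:
  "mspace (path_metric T) = {f \<in> extensional {0..T}. continuous_on {0..T} f}"
proof -
  have "compactin (top_of_set {0..T}) (topspace (top_of_set {0..T}))"
    by (simp add: compactin_subtopology)
  from compactin_mspace_cfunspace[OF this, of euclidean_metric] show ?thesis
    by auto
qed

lemma restrict_in_path_metric: "continuous_on {0..T} f \<Longrightarrow> (\<lambda>t\<in>{0..T}. f t) \<in> mspace (path_metric T)"
  unfolding mspace_path_metric by (auto cong: continuous_on_cong_simp)

lemma mdist_path_metric_le:
  assumes "0 \<le> e" "\<And>t. t \<in> {0..T} \<Longrightarrow> \<bar>f t - g t\<bar> \<le> e"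
  shows "mdist (path_metric T) (\<lambda>t\<in>{0..T}. f t) (\<lambda>t\<in>{0..T}. g t) \<le> e"
  by (rule mdist_cfunspace_le) (use assms in \<open>auto simp: dist_real_def\<close>)

lemma topspace_path_space:
  "topspace (path_space T N) = (\<Pi>\<^sub>E n\<in>{..<N}. mspace (path_metric T))"
  unfolding path_space_def by simp

lemma metrizable_path_space: "metrizable_space (path_space T N)"
proof -
  have m: "metrizable_space (mtopology_of (path_metric T))" unfolding mtopology_of_def
    by (rule Metric_space.metrizable_space_mtopology[OF Metric_space_mspace_mdist])
  show ?thesis unfolding path_space_def metrizable_space_product_topology
    by (intro disjI2 conjI ballI m countable_finite) simp
qed

lemma paths_in_path_space:
  assumes "\<And>n. n < N \<Longrightarrow> continuous_on {0..T} (\<lambda>t. X n t \<omega>)"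
  shows "paths T N X \<omega> \<in> topspace (path_space T N)"
  unfolding topspace_path_space paths_def restrict_PiE_iff
  by (intro ballI restrict_in_path_metric assms) simp

lemma limitin_path_space:
  assumes Y: "\<And>n. n < N \<Longrightarrow> continuous_on {0..T} (\<lambda>t. Y n t \<omega>)"
    and X: "\<And>n i. n < N \<Longrightarrow> continuous_on {0..T} (\<lambda>t. X i n t \<omega>)"
    and lim: "\<And>n e. n < N \<Longrightarrow> 0 < e \<Longrightarrow> \<forall>\<^sub>F i in F. \<forall>t\<in>{0..T}. \<bar>X i n t \<omega> - Y n t \<omega>\<bar> \<le> e"
  shows "limitin (path_space T N) (\<lambda>i. paths T N (X i) \<omega>) (paths T N Y \<omega>) F"
  unfolding path_space_def limitin_componentwise
proof (intro conjI ballI)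
  show "paths T N Y \<omega> \<in> extensional {..<N}" by (simp add: paths_def)
  show "\<forall>\<^sub>F i in F. paths T N (X i) \<omega> \<in> topspace (product_topology (\<lambda>_. mtopology_of (path_metric T)) {..<N})"
    using paths_in_path_space[of N T "X _" \<omega>] X unfolding path_space_def by (auto intro!: always_eventually)
  fix n assume "n \<in> {..<N}"
  then have n: "n < N" by simp
  interpret C: Metric_space "mspace (path_metric T)" "mdist (path_metric T)" by (rule Metric_space_mspace_mdist)
  have "limitin C.mtopology (\<lambda>i. \<lambda>t\<in>{0..T}. X i n t \<omega>) (\<lambda>t\<in>{0..T}. Y n t \<omega>) F"
    unfolding C.limitin_metric
  proof (intro conjI allI impI)
    show "(\<lambda>t\<in>{0..T}. Y n t \<omega>) \<in> mspace (path_metric T)" by (rule restrict_in_path_metric[OF Y[OF n]])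
    fix e :: real assume "0 < e"
    then have "\<forall>\<^sub>F i in F. \<forall>t\<in>{0..T}. \<bar>X i n t \<omega> - Y n t \<omega>\<bar> \<le> e / 2" by (intro lim[OF n]) simp
    then show "\<forall>\<^sub>F i in F. (\<lambda>t\<in>{0..T}. X i n t \<omega>) \<in> mspace (path_metric T) \<and>
        mdist (path_metric T) (\<lambda>t\<in>{0..T}. X i n t \<omega>) (\<lambda>t\<in>{0..T}. Y n t \<omega>) < e"
    proof eventually_elim
      case (elim i)
      have "mdist (path_metric T) (\<lambda>t\<in>{0..T}. X i n t \<omega>) (\<lambda>t\<in>{0..T}. Y n t \<omega>) \<le> e / 2"
        using elim \<open>0 < e\<close> by (intro mdist_path_metric_le) auto
      then show ?case using \<open>0 < e\<close> restrict_in_path_metric[OF X[OF n]] by auto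
    qed
  qed
  then show "limitin (mtopology_of (path_metric T)) (\<lambda>c. paths T N (X c) \<omega> n) (paths T N Y \<omega> n) F"
    using n by (simp add: paths_def mtopology_of_def)
qed

section \<open>Measurability of maps into the path space\<close>

text \<open>In a metric space the limit lies in an open set exactly if, for some fixed radius, the
  balls around all late terms lie in that set. This is a countable combination of measurable
  events.\<close>

lemma random_element_limit:
  assumes S: "metrizable_space S" and Xk: "\<And>k::nat. random_element M S (Xk k)"
    and lim: "\<And>\<omega>. \<omega> \<in> space M \<Longrightarrow> limitin S (\<lambda>k. Xk k \<omega>) (X \<omega>) sequentially"
  shows "random_element M S X"
  unfolding random_element_def
proof (rule measurable_measure_of)
  show "{U. openin S U} \<subseteq> Pow (topspace S)" using openin_subset by auto
  show "X \<in> space M \<rightarrow> topspace S" using lim limitin_topspace by fast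
  fix U assume "U \<in> {U. openin S U}"
  then have U: "openin S U" by simp
  from S obtain D d where "Metric_space D d" and Sd: "S = Metric_space.mtopology D d"
    unfolding metrizable_space_def by blast
  interpret Metric_space D d by fact
  have topS: "topspace S = D" by (simp add: Sd)
  \<comment> \<open>The points at depth at least \<open>1 / Suc m\<close> inside \<open>U\<close>.
    The set is closed, which makes its preimages measurable.\<close>
  define A where "A m = {x \<in> D. mball x (1 / Suc m) \<subseteq> U}" for m :: nat
  have opn: "openin S (D - A m)" for m
    unfolding Sd openin_mtopology
  proof (intro conjI allI impI)
    fix x assume "x \<in> D - A m"
    then have "x \<in> D" "\<not> mball x (1 / Suc m) \<subseteq> U" by (simp_all only: A_def) auto
    then obtain y where y: "x \<in> D" "y \<in> mball x (1 / Suc m)" "y \<notin> U" by blast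
    then have r: "0 < 1 / Suc m - d x y" by simp
    have "mball x (1 / Suc m - d x y) \<subseteq> D - A m"
    proof
      fix x' assume x': "x' \<in> mball x (1 / Suc m - d x y)"
      have "d x' y < 1 / Suc m" using triangle[of x' x y] x' y commute[of x' x] by auto
      then have "y \<in> mball x' (1 / Suc m)" using x' y by auto
      then show "x' \<in> D - A m" using x' y by (auto simp: A_def)
    qed
    then show "\<exists>r>0. mball x r \<subseteq> D - A m" using r by blast
  qed auto
  have XkD: "Xk k \<omega> \<in> D" if "\<omega> \<in> space M" for k \<omega>
    using measurable_space[OF Xk[unfolded random_element_def] that] openin_subset topS
    by (metis PowI mem_Collect_eq space_measure_of subsetI)
  have meas: "Xk k -` A m \<inter> space M \<in> sets M" for k m
  proof -
    have sub: "{U. openin S U} \<subseteq> Pow (topspace S)" using openin_subset by auto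
    have "D - A m \<in> sets (sigma (topspace S) {U. openin S U})"
      unfolding sets_measure_of[OF sub] using opn by (intro sigma_sets.Basic) simp
    from measurable_sets[OF Xk[unfolded random_element_def] this]
    have "Xk k -` (D - A m) \<inter> space M \<in> sets M" .
    then have "space M - (Xk k -` (D - A m) \<inter> space M) \<in> sets M" by auto
    moreover have "space M - (Xk k -` (D - A m) \<inter> space M) = Xk k -` A m \<inter> space M"
      using XkD by (auto simp: A_def)
    ultimately show ?thesis by simp
  qed
  have "X -` U \<inter> space M = (\<Union>m. \<Union>j. \<Inter>k\<in>{j..}. Xk k -` A m \<inter> space M)"
  proof (intro set_eqI iffI)
    fix \<omega> assume \<omega>: "\<omega> \<in> X -` U \<inter> space M"
    then have X: "X \<omega> \<in> D" and L: "\<And>e. 0 < e \<Longrightarrow> \<forall>\<^sub>F k in sequentially. Xk k \<omega> \<in> D \<and> d (Xk k \<omega>) (X \<omega>) < e"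
      using lim[of \<omega>] unfolding Sd limitin_metric by auto
    obtain r where r: "0 < r" "mball (X \<omega>) r \<subseteq> U" using U \<omega> unfolding Sd openin_mtopology by auto
    obtain m :: nat where m: "1 / Suc m < r / 2" using r(1) reals_Archimedean[of "r / 2"] by (auto simp: inverse_eq_divide)
    obtain j where j: "\<And>k. j \<le> k \<Longrightarrow> d (Xk k \<omega>) (X \<omega>) < r / 2"
      using L[of "r / 2"] r(1) unfolding eventually_sequentially by auto
    have "Xk k \<omega> \<in> A m" if "j \<le> k" for k
    proof -
      have "mball (Xk k \<omega>) (1 / Suc m) \<subseteq> mball (X \<omega>) r"
      proof
        fix y assume y: "y \<in> mball (Xk k \<omega>) (1 / Suc m)"
        then have "d (X \<omega>) y < r" using triangle[of "X \<omega>" "Xk k \<omega>" y] j[OF that] m X commute[of "X \<omega>" "Xk k \<omega>"] by auto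
        then show "y \<in> mball (X \<omega>) r" using y X by auto
      qed
      then show ?thesis using r XkD \<omega> by (auto simp: A_def)
    qed
    then show "\<omega> \<in> (\<Union>m. \<Union>j. \<Inter>k\<in>{j..}. Xk k -` A m \<inter> space M)" using \<omega> by blast
  next
    fix \<omega> assume "\<omega> \<in> (\<Union>m. \<Union>j. \<Inter>k\<in>{j..}. Xk k -` A m \<inter> space M)"
    then obtain m j where mj: "\<And>k. j \<le> k \<Longrightarrow> Xk k \<omega> \<in> A m" and \<omega>: "\<omega> \<in> space M" by auto
    have "X \<omega> \<in> D" and L: "\<forall>\<^sub>F k in sequentially. Xk k \<omega> \<in> D \<and> d (Xk k \<omega>) (X \<omega>) < 1 / Suc m"
      using lim[OF \<omega>] unfolding Sd limitin_metric by auto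
    then obtain k where k: "j \<le> k" "d (Xk k \<omega>) (X \<omega>) < 1 / Suc m"
      unfolding eventually_sequentially by (metis linorder_linear)
    then have "X \<omega> \<in> mball (Xk k \<omega>) (1 / Suc m)" using XkD[OF \<omega>] \<open>X \<omega> \<in> D\<close> by auto
    then show "\<omega> \<in> X -` U \<inter> space M" using mj[OF k(1)] \<omega> by (auto simp: A_def)
  qed
  also have "\<dots> \<in> sets M"
  proof -
    have "(\<Inter>k\<in>{j..}. Xk k -` A m \<inter> space M) \<in> sets M" for m j
      by (rule sets.countable_INT') (use meas in \<open>simp_all add: image_subset_iff\<close>)
    then have "(\<Union>j. \<Inter>k\<in>{j..}. Xk k -` A m \<inter> space M) \<in> sets M" for m
      by (intro sets.countable_UN') (simp_all add: image_subset_iff del: INT_simps)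
    then show ?thesis by (intro sets.countable_UN') (simp_all add: image_subset_iff del: UN_simps INT_simps)
  qed
  finally show "X -` U \<inter> space M \<in> sets M" .
qed

text \<open>A continuous path is the uniform limit of its Bernstein polynomials, and these depend
  continuously on finitely many values of the path. Measurability of the single values therefore
  suffices for the Borel sets of the uniform topology.\<close>

lemma random_element_paths:
  assumes T: "0 < T" and Xm: "\<And>n t. n < N \<Longrightarrow> t \<in> {0..T} \<Longrightarrow> X n t \<in> borel_measurable M"
    and Xc: "\<And>n \<omega>. n < N \<Longrightarrow> \<omega> \<in> space M \<Longrightarrow> continuous_on {0..T} (\<lambda>t. X n t \<omega>)"
  shows "random_element M (path_space T N) (paths T N X)"
proof -
  \<comment> \<open>The sampled values, padded with 0 so that they form a measurable map into a
    plain function space. Only \<open>Z (Suc K)\<close> is used, which avoids the grid with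
    denominator 0.\<close>
  define Z where "Z K \<omega> = (\<lambda>n k. if n < N \<and> k \<le> K then X n (T * (real k / real K)) \<omega> else 0)" for K :: nat and \<omega>
  define \<Phi> where "\<Phi> K = paths T N (\<lambda>n t a. \<Sum>k\<le>K. a n k * Bernstein K k (t / T))" for K :: nat
  have Zm: "Z (Suc K) \<in> borel_measurable M" for K
  proof -
    have "(\<lambda>\<omega>. Z (Suc K) \<omega> n k) \<in> borel_measurable M" for n k
    proof (cases "n < N \<and> k \<le> Suc K")
      case True
      then have "T * (real k / real (Suc K)) \<le> T * 1" using T by (intro mult_left_mono) auto
      then show ?thesis using True T by (simp add: Z_def del: of_nat_Suc) (rule Xm, auto)
    next
      case False
      then have "(\<lambda>\<omega>. Z (Suc K) \<omega> n k) = (\<lambda>_. 0)" by (auto simp: Z_def fun_eq_iff)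
      then show ?thesis by simp
    qed
    then show ?thesis by (intro measurable_coordinatewise_then_product)
  qed
  have B: "\<bar>Bernstein K k (t / T)\<bar> \<le> 1" if "t \<in> {0..T}" "k \<le> K" for K k t
  proof -
    have t: "0 \<le> t / T" "t / T \<le> 1" using that T by auto
    have "Bernstein K k (t / T) \<le> (\<Sum>k\<le>K. Bernstein K k (t / T))"
      by (rule member_le_sum) (use that t in \<open>auto intro: Bernstein_nonneg\<close>)
    then show ?thesis using Bernstein_nonneg[OF t, of K k] by simp
  qed
  have cB: "continuous_on {0..T} (\<lambda>t. \<Sum>k\<le>K. a n k * Bernstein K k (t / T))" for a :: "nat \<Rightarrow> nat \<Rightarrow> real" and n K
    unfolding Bernstein_def using T by (intro continuous_intros) auto
  have \<Phi>c: "continuous_map euclidean (path_space T N) (\<Phi> K)" for K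
    unfolding path_space_def continuous_map_componentwise
  proof (intro conjI ballI)
    show "\<Phi> K ` topspace euclidean \<subseteq> extensional {..<N}" by (auto simp: \<Phi>_def paths_def)
    fix n assume "n \<in> {..<N}"
    then have n: "n < N" by simp
    interpret C: Metric_space "mspace (path_metric T)" "mdist (path_metric T)" by (rule Metric_space_mspace_mdist)
    have "continuous_map euclidean C.mtopology (\<lambda>a. \<lambda>t\<in>{0..T}. \<Sum>k\<le>K. a n k * Bernstein K k (t / T))"
      unfolding C.continuous_map_to_metric
    proof (intro ballI allI impI)
      fix a :: "nat \<Rightarrow> nat \<Rightarrow> real" and e :: real assume e: "0 < e"
      define U where "U = {b :: nat \<Rightarrow> nat \<Rightarrow> real. (\<Sum>k\<le>K. \<bar>a n k - b n k\<bar>) < e}"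
      have "continuous_on UNIV (\<lambda>b :: nat \<Rightarrow> nat \<Rightarrow> real. b n k)" for k
        using continuous_on_compose2[OF continuous_on_product_coordinates[of k] continuous_on_product_coordinates[of n]]
        by auto
      then have "open U" unfolding U_def
        by (intro open_Collect_less continuous_intros)
      moreover have "(\<lambda>t\<in>{0..T}. \<Sum>k\<le>K. b n k * Bernstein K k (t / T)) \<in>
          C.mball (\<lambda>t\<in>{0..T}. \<Sum>k\<le>K. a n k * Bernstein K k (t / T)) e" if "b \<in> U" for b
      proof -
        have "mdist (path_metric T) (\<lambda>t\<in>{0..T}. \<Sum>k\<le>K. a n k * Bernstein K k (t / T))
           (\<lambda>t\<in>{0..T}. \<Sum>k\<le>K. b n k * Bernstein K k (t / T)) \<le> (\<Sum>k\<le>K. \<bar>a n k - b n k\<bar>)"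
        proof (rule mdist_path_metric_le)
          fix t assume t: "t \<in> {0..T}"
          have "\<bar>(\<Sum>k\<le>K. a n k * Bernstein K k (t / T)) - (\<Sum>k\<le>K. b n k * Bernstein K k (t / T))\<bar> =
            \<bar>\<Sum>k\<le>K. (a n k - b n k) * Bernstein K k (t / T)\<bar>"
            by (simp add: sum_subtractf left_diff_distrib)
          also have "\<dots> \<le> (\<Sum>k\<le>K. \<bar>a n k - b n k\<bar> * 1)"
            by (intro order_trans[OF sum_abs] sum_mono, unfold abs_mult, intro mult_left_mono) (use B t in auto)
          finally show "\<bar>(\<Sum>k\<le>K. a n k * Bernstein K k (t / T)) - (\<Sum>k\<le>K. b n k * Bernstein K k (t / T))\<bar> \<le> (\<Sum>k\<le>K. \<bar>a n k - b n k\<bar>)" by simp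
        qed (intro sum_nonneg, auto)
        also have "\<dots> < e" using that by (simp add: U_def)
        finally show ?thesis unfolding C.in_mball by (intro conjI restrict_in_path_metric cB)
      qed
      ultimately show "\<exists>U. openin euclidean U \<and> a \<in> U \<and> (\<forall>b\<in>U. (\<lambda>t\<in>{0..T}. \<Sum>k\<le>K. b n k * Bernstein K k (t / T)) \<in>
          C.mball (\<lambda>t\<in>{0..T}. \<Sum>k\<le>K. a n k * Bernstein K k (t / T)) e)"
        using e by (intro exI[of _ U]) (auto simp: U_def)
    qed
    then show "continuous_map euclidean (mtopology_of (path_metric T)) (\<lambda>x. \<Phi> K x n)"
      using n by (simp add: \<Phi>_def paths_def mtopology_of_def)
  qed
  have \<Phi>m: "\<Phi> K \<in> measurable borel (sigma (topspace (path_space T N)) {U. openin (path_space T N) U})" for K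
  proof (rule measurable_measure_of)
    show "{U. openin (path_space T N) U} \<subseteq> Pow (topspace (path_space T N))" using openin_subset by auto
    show "\<Phi> K \<in> space borel \<rightarrow> topspace (path_space T N)" using continuous_map_funspace[OF \<Phi>c[of K]] by simp
    fix U assume "U \<in> {U. openin (path_space T N) U}"
    then have "openin euclidean {x \<in> topspace euclidean. \<Phi> K x \<in> U}" using \<Phi>c[of K] by (intro openin_continuous_map_preimage) auto
    then have "open (\<Phi> K -` U)" by (simp add: vimage_def)
    then show "\<Phi> K -` U \<inter> space borel \<in> sets borel" by simp
  qed
  have Xk: "random_element M (path_space T N) (\<lambda>\<omega>. \<Phi> (Suc K) (Z (Suc K) \<omega>))" for K
    unfolding random_element_def by (rule measurable_compose[OF Zm \<Phi>m])
  show ?thesis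
  proof (rule random_element_limit[OF metrizable_path_space Xk])
    fix \<omega> assume \<omega>: "\<omega> \<in> space M"
    have eq: "\<Phi> (Suc K) (Z (Suc K) \<omega>) = paths T N (\<lambda>n t \<omega>. \<Sum>k\<le>Suc K. X n (T * (real k / real (Suc K))) \<omega> * Bernstein (Suc K) k (t / T)) \<omega>" for K
      unfolding \<Phi>_def paths_def by (intro restrict_ext sum.cong) (auto simp: Z_def)
    show "limitin (path_space T N) (\<lambda>k. \<Phi> (Suc k) (Z (Suc k) \<omega>)) (paths T N X \<omega>) sequentially"
      unfolding eq
    proof (rule limitin_path_space)
      fix n assume n: "n < N"
      show "continuous_on {0..T} (\<lambda>t. X n t \<omega>)" by (rule Xc[OF n \<omega>])
      show "continuous_on {0..T} (\<lambda>t. \<Sum>k\<le>Suc i. X n (T * (real k / real (Suc i))) \<omega> * Bernstein (Suc i) k (t / T))" for i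
        using cB[of "\<lambda>n k. X n (T * (real k / real (Suc i))) \<omega>" n "Suc i"] by simp
      fix e :: real assume e: "0 < e"
      have "continuous_on {0..1} (\<lambda>r. X n (T * r) \<omega>)"
        by (rule continuous_on_compose2[OF Xc[OF n \<omega>]]) (use T in \<open>auto intro!: continuous_intros mult_left_le\<close>)
      from Bernstein_Weierstrass[OF this e] obtain K0 where K0: "\<And>K r. K0 \<le> K \<Longrightarrow> r \<in> {0..1} \<Longrightarrow>
         \<bar>X n (T * r) \<omega> - (\<Sum>k\<le>K. X n (T * (real k / real K)) \<omega> * Bernstein K k r)\<bar> < e" by blast
      show "\<forall>\<^sub>F i in sequentially. \<forall>t\<in>{0..T}.
          \<bar>(\<Sum>k\<le>Suc i. X n (T * (real k / real (Suc i))) \<omega> * Bernstein (Suc i) k (t / T)) - X n t \<omega>\<bar> \<le> e"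
      proof (rule eventually_sequentiallyI[of K0], intro ballI)
        fix i t assume i: "K0 \<le> i" and t: "t \<in> {0..T}"
        have "t / T \<in> {0..1}" "T * (t / T) = t" using t T by auto
        with K0[of "Suc i" "t / T"] i
        show "\<bar>(\<Sum>k\<le>Suc i. X n (T * (real k / real (Suc i))) \<omega> * Bernstein (Suc i) k (t / T)) - X n t \<omega>\<bar> \<le> e"
          by (simp only: abs_minus_commute) simp
      qed
    qed
  qed
qed

section \<open>Wiener integrals as limits of Riemann sums\<close>

lemma primitive_abs_bound_between:
  assumes f: "primitive T f f'" and g: "primitive T g g'" and pq: "0 \<le> p" "p \<le> q" "q \<le> T"
    and le: "AE s in lborel. p < s \<longrightarrow> s \<le> q \<longrightarrow> \<bar>f' s\<bar> \<le> g' s"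
  shows "\<bar>f q - f p\<bar> \<le> g q - g p"
proof -
  have F: "primitive q (\<lambda>t. f t - f (min t p)) (\<lambda>s. f' s - indicator {0..p} s * f' s)"
    and G: "primitive q (\<lambda>t. g t - g (min t p)) (\<lambda>s. g' s - indicator {0..p} s * g' s)"
    using pq f g by (auto intro!: primitive_diff primitive_stop intro: primitive_subset)
  have "AE s in lborel. 0 < s \<longrightarrow> s \<le> q \<longrightarrow> \<bar>f' s - indicator {0..p} s * f' s\<bar> \<le> g' s - indicator {0..p} s * g' s"
    using le by eventually_elim (auto simp: indicator_def)
  from primitive_abs_bound[OF F G this, of q] pq show ?thesis by simp
qed

text \<open>\<open>h\<close> is only continuous, so the limit is defined by parts. On a grid cell
  from \<open>p\<close> to \<open>q\<close> the error is the integral of \<open>h q - h s\<close>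
  against the increasing weight, hence at most the oscillation of \<open>h\<close> times the
  increment of the weight; these increments telescope.\<close>

lemma riemann_stieltjes_power:
  fixes h :: "real \<Rightarrow> real"
  assumes hc: "continuous_on {0..} h" and h0: "h 0 = 0" and t: "0 \<le> t"
  shows "(\<lambda>K. \<Sum>k<nat \<lfloor>t * real (Suc K)\<rfloor>. sqrt (real k / real (Suc K)) ^ j * (h (real (Suc k) / real (Suc K)) - h (real k / real (Suc K))))
    \<longlonglongrightarrow> sqrt t ^ j * h t - (LBINT s:{0..t}. real j / 2 * s powr (real j / 2 - 1) * h s)"
proof -
  define a where "a s = sqrt s ^ j" for s
  define H where "H t = (LBINT s:{0..t}. real j / 2 * s powr (real j / 2 - 1) * h s)" for t
  define E where "E t = a t * h t - H t" for t
  define T where "T = t + 1"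
  have T: "0 \<le> T" "t \<le> T" using t by (auto simp: T_def)
  have hT: "continuous_on {0..T} h" using hc by (rule continuous_on_subset) auto
  have pw: "s powr (real j / 2) = a s" if "0 \<le> s" "j \<noteq> 0" for s
  proof (cases "s = 0")
    case False
    then have "sqrt s ^ j = (s powr (1 / 2)) powr real j" using that by (simp add: powr_half_sqrt powr_realpow)
    then show ?thesis by (simp add: powr_powr a_def)
  qed (use that in \<open>simp add: a_def\<close>)
  have Hc: "continuous_on {0..T} H"
  proof (cases "j = 0")
    case True then show ?thesis by (simp add: H_def set_lebesgue_integral_def)
  next
    case False
    then show ?thesis unfolding H_def
      by (intro primitive_continuous[OF primitive_powr_mult] hT) auto
  qed
  have Ec: "continuous_on {0..T} E" unfolding E_def a_def by (intro continuous_intros Hc hT)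
  have E0: "E 0 = 0" unfolding E_def H_def set_integral_zero_interval by (simp add: h0)
  have amono: "a p \<le> a q" if "0 \<le> p" "p \<le> q" for p q
    unfolding a_def using that by (intro power_mono) auto
  have step: "\<bar>E q - E p - a p * (h q - h p)\<bar> \<le> e * (a q - a p)"
    if pq: "0 \<le> p" "p \<le> q" "q \<le> T" and e: "\<And>s. p \<le> s \<Longrightarrow> s \<le> q \<Longrightarrow> \<bar>h q - h s\<bar> \<le> e" for p q e
  proof (cases "j = 0")
    case True then show ?thesis by (simp add: E_def a_def H_def set_lebesgue_integral_def)
  next
    case False
    have P: "primitive T (\<lambda>s. h q * s powr (real j / 2) - H s)
       (\<lambda>s. h q * (real j / 2 * s powr (real j / 2 - 1)) - real j / 2 * s powr (real j / 2 - 1) * h s)"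
      unfolding H_def by (intro primitive_diff primitive_cmult primitive_powr primitive_powr_mult hT) (use False in auto)
    have Q: "primitive T (\<lambda>s. e * s powr (real j / 2)) (\<lambda>s. e * (real j / 2 * s powr (real j / 2 - 1)))"
      by (intro primitive_cmult primitive_powr) (use False in auto)
    have "\<bar>(h q * q powr (real j / 2) - H q) - (h q * p powr (real j / 2) - H p)\<bar> \<le> e * q powr (real j / 2) - e * p powr (real j / 2)"
    proof (rule primitive_abs_bound_between[OF P Q pq], intro AE_I2 impI)
      fix s assume s: "p < s" "s \<le> q"
      have "\<bar>h q * (real j / 2 * s powr (real j / 2 - 1)) - real j / 2 * s powr (real j / 2 - 1) * h s\<bar> =
        \<bar>h q - h s\<bar> * (real j / 2 * s powr (real j / 2 - 1))"
      proof -
        have *: "\<bar>h q * c - c * h s\<bar> = \<bar>h q - h s\<bar> * c" if "0 \<le> c" for c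
        proof -
          have "h q * c - c * h s = (h q - h s) * c" by (simp add: algebra_simps)
          then show ?thesis using that by (simp add: abs_mult)
        qed
        show ?thesis by (rule *) simp
      qed
      also have "\<dots> \<le> e * (real j / 2 * s powr (real j / 2 - 1))"
        using e[of s] s by (intro mult_right_mono) auto
      finally show "\<bar>h q * (real j / 2 * s powr (real j / 2 - 1)) - real j / 2 * s powr (real j / 2 - 1) * h s\<bar>
        \<le> e * (real j / 2 * s powr (real j / 2 - 1))" .
    qed
    moreover have "E q - E p - a p * (h q - h p) = (h q * q powr (real j / 2) - H q) - (h q * p powr (real j / 2) - H p)"
      using pw[of p] pw[of q] pq False by (simp add: E_def algebra_simps)
    moreover have "e * (a q - a p) = e * q powr (real j / 2) - e * p powr (real j / 2)"
      using pw[of p] pw[of q] pq False by (simp add: algebra_simps)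
    ultimately show ?thesis by (simp only:)
  qed
  define m where "m K = nat \<lfloor>t * real (Suc K)\<rfloor>" for K
  have mt: "real (m K) / real (Suc K) \<le> t" "t - 1 / real (Suc K) \<le> real (m K) / real (Suc K)" for K
  proof -
    have "real (m K) = of_int \<lfloor>t * real (Suc K)\<rfloor>" unfolding m_def using t by simp
    then have "real (m K) \<le> t * real (Suc K)" "t * real (Suc K) \<le> real (m K) + 1" by linarith+
    then have "real (m K) / real (Suc K) \<le> t * real (Suc K) / real (Suc K)"
      "(t * real (Suc K) - 1) / real (Suc K) \<le> real (m K) / real (Suc K)"
      by (intro divide_right_mono; simp)+
    then show "real (m K) / real (Suc K) \<le> t" "t - 1 / real (Suc K) \<le> real (m K) / real (Suc K)"
      by (simp_all add: diff_divide_distrib del: of_nat_Suc)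
  qed
  define R where "R K = (\<Sum>k<m K. a (real k / real (Suc K)) * (h (real (Suc k) / real (Suc K)) - h (real k / real (Suc K))))" for K
  have "(\<lambda>K. real (m K) / real (Suc K)) \<longlonglongrightarrow> t"
  proof (rule tendsto_sandwich[of "\<lambda>K. t - 1 / real (Suc K)" _ _ "\<lambda>_. t"])
    show "(\<lambda>K. t - 1 / real (Suc K)) \<longlonglongrightarrow> t"
      using tendsto_diff[OF tendsto_const[of t] LIMSEQ_Suc[OF lim_1_over_n]] by simp
  qed (use mt in auto)
  then have lim1: "(\<lambda>K. E (real (m K) / real (Suc K))) \<longlonglongrightarrow> E t"
    using mt t T
    by (intro continuous_on_tendsto_compose[OF Ec]) (auto intro!: always_eventually intro: order_trans)
  have lim2: "(\<lambda>K. R K - E (real (m K) / real (Suc K))) \<longlonglongrightarrow> 0"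
  proof (rule LIMSEQ_I)
    fix r :: real assume r: "0 < r"
    \<comment> \<open>Makes the telescoped error at most \<open>r / 2\<close>; the summand 1 keeps
      the denominator positive.\<close>
    define e where "e = r / (2 * (a T + 1))"
    have aT: "0 \<le> a T" using T by (simp add: a_def)
    have e: "0 < e" using r aT by (simp add: e_def)
    have "uniformly_continuous_on {0..T} h" by (rule compact_uniformly_continuous[OF hT]) simp
    then obtain d where d: "0 < d" "\<And>x y. x \<in> {0..T} \<Longrightarrow> y \<in> {0..T} \<Longrightarrow> dist y x < d \<Longrightarrow> dist (h y) (h x) < e"
      using e unfolding uniformly_continuous_on_def by metis
    obtain K0 where K0: "1 / real (Suc K0) < d" using d(1) reals_Archimedean[of d] by (auto simp: inverse_eq_divide)
    show "\<exists>K0. \<forall>K\<ge>K0. norm (R K - E (real (m K) / real (Suc K)) - 0) < r"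
    proof (intro exI[of _ K0] allI impI)
      fix K assume K: "K0 \<le> K"
      have "1 / real (Suc K) \<le> 1 / real (Suc K0)" using K by (intro divide_left_mono) auto
      then have Kd: "1 / real (Suc K) < d" using K0 by simp
      have tel: "f (real (m K) / real (Suc K)) - f 0 = (\<Sum>k<m K. f (real (Suc k) / real (Suc K)) - f (real k / real (Suc K)))" for f :: "real \<Rightarrow> real"
        using sum_lessThan_telescope[of "\<lambda>k. f (real k / real (Suc K))" "m K"] by simp
      have "\<bar>E (real (m K) / real (Suc K)) - R K\<bar> = \<bar>\<Sum>k<m K. E (real (Suc k) / real (Suc K)) - E (real k / real (Suc K))
          - a (real k / real (Suc K)) * (h (real (Suc k) / real (Suc K)) - h (real k / real (Suc K)))\<bar>"
        using tel[of E] unfolding E0 R_def by (simp add: sum_subtractf)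
      also have "\<dots> \<le> (\<Sum>k<m K. e * (a (real (Suc k) / real (Suc K)) - a (real k / real (Suc K))))"
      proof (intro order_trans[OF sum_abs] sum_mono step)
        fix k assume k: "k \<in> {..<m K}"
        show "0 \<le> real k / real (Suc K)" "real k / real (Suc K) \<le> real (Suc k) / real (Suc K)"
          by (auto intro: divide_right_mono simp del: of_nat_Suc)
        have "real (Suc k) / real (Suc K) \<le> real (m K) / real (Suc K)" using k by (intro divide_right_mono) auto
        then show le: "real (Suc k) / real (Suc K) \<le> T" using mt(1)[of K] T by linarith
        fix s assume s: "real k / real (Suc K) \<le> s" "s \<le> real (Suc k) / real (Suc K)"
        have s0: "0 \<le> s" using s(1) by (meson divide_nonneg_nonneg of_nat_0_le_iff order_trans)
        have "real (Suc k) / real (Suc K) - s \<le> real (Suc k) / real (Suc K) - real k / real (Suc K)" using s by simp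
        also have "\<dots> = 1 / real (Suc K)" by (simp add: diff_divide_distrib[symmetric])
        finally have "dist (real (Suc k) / real (Suc K)) s < d" using Kd s unfolding dist_real_def by linarith
        then have "dist (h (real (Suc k) / real (Suc K))) (h s) < e" using d(2)[of s "real (Suc k) / real (Suc K)"] s s0 le by auto
        then show "\<bar>h (real (Suc k) / real (Suc K)) - h s\<bar> \<le> e" by (simp add: dist_real_def)
      qed
      also have "\<dots> = e * (a (real (m K) / real (Suc K)) - a 0)" unfolding sum_distrib_left[symmetric] tel[of a, symmetric] ..
      also have "\<dots> \<le> e * (a T + 1)"
      proof (rule mult_left_mono)
        have "a (real (m K) / real (Suc K)) \<le> a T" using mt(1)[of K] T by (intro amono) auto
        moreover have "0 \<le> a 0" by (simp add: a_def)
        ultimately show "a (real (m K) / real (Suc K)) - a 0 \<le> a T + 1" by linarith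
      qed (use e in simp)
      also have "\<dots> = r / 2" using aT by (simp add: e_def field_simps)
      finally show "norm (R K - E (real (m K) / real (Suc K)) - 0) < r" unfolding real_norm_def using r by linarith
    qed
  qed
  have "R \<longlonglongrightarrow> E t" using tendsto_add[OF lim2 lim1] by simp
  then show ?thesis unfolding R_def m_def E_def a_def H_def .
qed

text \<open>The case of the identity path with exponent \<open>2 * n\<close>, so that powers of
  square roots become integer powers. It evaluates the limiting variances.\<close>

lemma riemann_sum_power:
  assumes t: "0 \<le> t"
  shows "(\<lambda>K. \<Sum>k<nat \<lfloor>t * real (Suc K)\<rfloor>. (real k / real (Suc K)) ^ n * (1 / real (Suc K))) \<longlonglongrightarrow> t ^ (n + 1) / real (n + 1)"
proof -
  have "(\<lambda>K. \<Sum>k<nat \<lfloor>t * real (Suc K)\<rfloor>. sqrt (real k / real (Suc K)) ^ (2 * n) * (real (Suc k) / real (Suc K) - real k / real (Suc K)))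
    \<longlonglongrightarrow> sqrt t ^ (2 * n) * t - (LBINT s:{0..t}. real (2 * n) / 2 * s powr (real (2 * n) / 2 - 1) * s)"
    by (rule riemann_stieltjes_power) (use t in \<open>auto intro: continuous_intros\<close>)
  moreover have "sqrt (real k / real (Suc K)) ^ (2 * n) = (real k / real (Suc K)) ^ n" for k K by (simp add: power_mult del: of_nat_Suc)
  moreover have "real (Suc k) / real (Suc K) - real k / real (Suc K) = 1 / real (Suc K)" for k K
    by (simp add: diff_divide_distrib[symmetric])
  moreover have "(LBINT s:{0..t}. real (2 * n) / 2 * s powr (real (2 * n) / 2 - 1) * s) = real n / (real n + 1) * t ^ (n + 1)"
  proof -
    have "(LBINT s:{0..t}. real (2 * n) / 2 * s powr (real (2 * n) / 2 - 1) * s) =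
       (LBINT s:{0..t}. real n / (real n + 1) * ((real n + 1) * s powr ((real n + 1) - 1)))"
    proof (rule set_lebesgue_integral_cong, simp, intro allI impI)
      fix s :: real assume "s \<in> {0..t}"
      then have "s powr (real n - 1) * s = s powr real n" if "s \<noteq> 0"
        using powr_add[of s "real n - 1" 1] that by simp
      moreover have "real n / (real n + 1) * ((real n + 1) * x) = real n * x" for x by (simp add: field_simps)
      ultimately show "real (2 * n) / 2 * s powr (real (2 * n) / 2 - 1) * s = real n / (real n + 1) * ((real n + 1) * s powr ((real n + 1) - 1))"
        by (cases "s = 0") auto
    qed
    also have "\<dots> = real n / (real n + 1) * (t powr (real n + 1))"
      using primitiveD[OF primitive_powr[of "real n + 1" t], of t] t by simp
    also have "t powr (real n + 1) = t ^ (n + 1)"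
      using t powr_realpow[of t "n + 1"] by (cases "t = 0") (auto simp: add.commute)
    finally show ?thesis .
  qed
  moreover have "sqrt t ^ (2 * n) * t - real n / (real n + 1) * t ^ (n + 1) = t ^ (n + 1) / real (n + 1)"
  proof -
    have "sqrt t ^ (2 * n) = t ^ n" using t by (simp add: power_mult[of _ 2])
    then show ?thesis by (simp add: field_simps)
  qed
  ultimately show ?thesis by (simp only:)
qed

section \<open>Gaussian law of the Riemann sums and of their limits\<close>

lemma prod_exp_half:
  "finite A \<Longrightarrow> (\<Prod>k\<in>A. complex_of_real (exp (- x k / 2))) = complex_of_real (exp (- (\<Sum>k\<in>A. x k) / 2))"
  unfolding of_real_prod[symmetric] by (subst exp_sum[symmetric]) (simp_all add: sum_negf sum_divide_distrib)

text \<open>Independence of the processes factorises over \<open>i\<close>, independence of the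
  increments over \<open>k\<close>; each remaining factor is the characteristic function of a normal
  variable with variance \<open>1 / K\<close>.\<close>

lemma char_brownian_increments:
  assumes M: "prob_space M" and b: "\<And>i. i \<in> I \<Longrightarrow> brownian_motion M (b i)" and I: "finite I" "indep_processes M b I"
    and K: "0 < K"
  shows "(\<integral>\<omega>. iexp (\<Sum>i\<in>I. \<Sum>k<m. f i k * (b i (real (Suc k) / K) \<omega> - b i (real k / K) \<omega>)) \<partial>M) =
    complex_of_real (exp (- (\<Sum>i\<in>I. \<Sum>k<m. (f i k)\<^sup>2 * (1 / K)) / 2))"
proof -
  interpret prob_space M by fact
  define \<Delta> where "\<Delta> i k \<omega> = b i (real (Suc k) / K) \<omega> - b i (real k / K) \<omega>" for i k \<omega>
  have bm: "b i t \<in> borel_measurable M" if "i \<in> I" "0 \<le> t" for i t using b[OF that(1)] that by (simp add: brownian_motion_def)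
  have \<Delta>m: "\<Delta> i k \<in> borel_measurable M" if "i \<in> I" for i k
    unfolding \<Delta>_def using K that by (intro borel_measurable_diff bm) auto
  have Y: "indep_vars (\<lambda>_. borel) (\<lambda>i \<omega>. \<Sum>k<m. f i k * \<Delta> i k \<omega>) I"
  proof -
    have 0: "indep_vars (\<lambda>_. PiM {0..} (\<lambda>_. borel)) (\<lambda>i \<omega>. \<lambda>t\<in>{0..}. b i t \<omega>) I"
      using I(2) unfolding indep_processes_def .
    have "indep_vars (\<lambda>_. borel) (\<lambda>i \<omega>. (\<lambda>p. \<Sum>k<m. f i k * (p (real (Suc k) / K) - p (real k / K))) (\<lambda>t\<in>{0..}. b i t \<omega>)) I"
      by (rule indep_vars_compose2[OF 0])
        (use K in \<open>intro borel_measurable_sum borel_measurable_times borel_measurable_diff borel_measurable_const measurable_component_singleton; simp\<close>)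
    then show ?thesis using K by (simp add: \<Delta>_def)
  qed
  have ch: "(\<integral>\<omega>. iexp (r * X \<omega>) \<partial>M) = char (distr M borel X) r" if "X \<in> borel_measurable M" for X :: "'a \<Rightarrow> real" and r
    unfolding char_def by (rule integral_distr[symmetric]) (use that in auto)
  have each: "char (distr M borel (\<lambda>\<omega>. \<Sum>k<m. f i k * \<Delta> i k \<omega>)) 1 = complex_of_real (exp (- (\<Sum>k<m. (f i k)\<^sup>2 * (1 / K)) / 2))"
    if i: "i \<in> I" for i
  proof -
    note bi = b[OF i, unfolded brownian_motion_def]
    have "indep_vars (\<lambda>_. borel) (\<lambda>k \<omega>. b i (real (Suc k) / K) \<omega> - b i (real k / K) \<omega>) {..<m}"
      using bi K by (elim conjE allE[of _ "\<lambda>k. real k / K"]) (auto simp: incseq_def divide_right_mono)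
    then have "indep_vars (\<lambda>_. borel) (\<Delta> i) {..<m}" unfolding \<Delta>_def .
    then have "indep_vars (\<lambda>_. borel) (\<lambda>k \<omega>. (\<lambda>x. f i k * x) (\<Delta> i k \<omega>)) {..<m}"
      by (rule indep_vars_compose2) auto
    from char_distr_sum[OF this] have "char (distr M borel (\<lambda>\<omega>. \<Sum>k<m. f i k * \<Delta> i k \<omega>)) 1 =
      (\<Prod>k<m. char (distr M borel (\<lambda>\<omega>. f i k * \<Delta> i k \<omega>)) 1)" .
    also have "\<dots> = (\<Prod>k<m. complex_of_real (exp (- ((f i k)\<^sup>2 * (1 / K)) / 2)))"
    proof (intro prod.cong refl)
      fix k
      have d: "distributed M lborel (\<Delta> i k) (normal_density 0 (sqrt (1 / K)))"
      proof -
        have "real (Suc k) / K - real k / K = 1 / K" by (simp add: diff_divide_distrib[symmetric])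
        moreover have "0 \<le> real k / K" "real k / K < real (Suc k) / K" using K by (auto intro: divide_strict_right_mono)
        ultimately show ?thesis using bi unfolding \<Delta>_def by metis
      qed
      have "char (distr M borel (\<lambda>\<omega>. f i k * \<Delta> i k \<omega>)) 1 = (\<integral>\<omega>. iexp (f i k * \<Delta> i k \<omega>) \<partial>M)"
        using ch[of "\<lambda>\<omega>. f i k * \<Delta> i k \<omega>" 1] \<Delta>m[OF i, of k] by simp
      also have "\<dots> = complex_of_real (exp (- (sqrt (1 / K) * f i k)\<^sup>2 / 2))"
        by (rule char_normal_distributed[OF M _ d]) (use K in simp)
      finally show "char (distr M borel (\<lambda>\<omega>. f i k * \<Delta> i k \<omega>)) 1 = complex_of_real (exp (- ((f i k)\<^sup>2 * (1 / K)) / 2))"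
        using K by (simp add: power_mult_distrib real_sqrt_divide power_divide mult.commute)
    qed
    also have "\<dots> = complex_of_real (exp (- (\<Sum>k<m. (f i k)\<^sup>2 * (1 / K)) / 2))"
      by (rule prod_exp_half) simp
    finally show ?thesis .
  qed
  have "(\<integral>\<omega>. iexp (\<Sum>i\<in>I. \<Sum>k<m. f i k * \<Delta> i k \<omega>) \<partial>M) = char (distr M borel (\<lambda>\<omega>. \<Sum>i\<in>I. \<Sum>k<m. f i k * \<Delta> i k \<omega>)) 1"
    using ch[of "\<lambda>\<omega>. \<Sum>i\<in>I. \<Sum>k<m. f i k * \<Delta> i k \<omega>" 1] \<Delta>m by (simp add: borel_measurable_sum)
  also have "\<dots> = (\<Prod>i\<in>I. char (distr M borel (\<lambda>\<omega>. \<Sum>k<m. f i k * \<Delta> i k \<omega>)) 1)"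
    by (rule char_distr_sum[OF Y])
  also have "\<dots> = (\<Prod>i\<in>I. complex_of_real (exp (- (\<Sum>k<m. (f i k)\<^sup>2 * (1 / K)) / 2)))"
    by (intro prod.cong refl each)
  also have "\<dots> = complex_of_real (exp (- (\<Sum>i\<in>I. \<Sum>k<m. (f i k)\<^sup>2 * (1 / K)) / 2))"
    by (rule prod_exp_half[OF I(1)])
  finally show ?thesis unfolding \<Delta>_def .
qed

text \<open>The left-endpoint sums of the Wiener integral behind \<open>limit_path\<close>. The grid
  of mesh \<open>1 / Suc K\<close> is the same for all times and modes, so joint linear combinations
  involve a single family of increments.\<close>

definition limit_sum :: "nat \<Rightarrow> nat \<Rightarrow> (nat \<Rightarrow> real \<Rightarrow> real) \<Rightarrow> nat \<Rightarrow> real \<Rightarrow> real" where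
  "limit_sum N n w K t = (\<Sum>k<nat \<lfloor>t * real (Suc K)\<rfloor>. sqrt (real k / real (Suc K)) ^ n *
     (q_noise N n w (real (Suc k) / real (Suc K)) - q_noise N n w (real k / real (Suc K)))) / sqrt N"

lemma limit_sum_tendsto:
  assumes "\<And>i. i \<in> {1..N} \<Longrightarrow> continuous_on {0..} (w i)" "\<And>i. i \<in> {1..N} \<Longrightarrow> w i 0 = 0" "0 \<le> t"
  shows "(\<lambda>K. limit_sum N n w K t) \<longlonglongrightarrow> limit_path N n w t"
  unfolding limit_sum_def limit_path_def divide_inverse
proof (rule tendsto_mult_right, fold divide_inverse, rule riemann_stieltjes_power)
  show "continuous_on {0..} (q_noise N n w)" unfolding q_noise_def by (intro continuous_intros assms)
  show "q_noise N n w 0 = 0" unfolding q_noise_def using assms(2) by simp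
qed (rule assms)

text \<open>Weights that vanish from the time index on extend the sum to any larger
  \<open>m\<close>; sums for different times then share one index range.\<close>

lemma limit_sum_eq:
  assumes "nat \<lfloor>t * real (Suc K)\<rfloor> \<le> m"
  shows "limit_sum N n (\<lambda>i t. b i t - b i 0) K t = (\<Sum>i\<in>{1..N}. \<Sum>k<m.
    (if k < nat \<lfloor>t * real (Suc K)\<rfloor> then sqrt (real k / real (Suc K)) ^ n / sqrt N else 0) * poly (q_poly N n) (hermite_zero N i) *
    (b i (real (Suc k) / real (Suc K)) - b i (real k / real (Suc K))))"
proof -
  let ?q = "\<lambda>i. poly (q_poly N n) (hermite_zero N i)" and ?\<mu> = "nat \<lfloor>t * real (Suc K)\<rfloor>"
  let ?D = "\<lambda>i k. b i (real (Suc k) / real (Suc K)) - b i (real k / real (Suc K))"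
  have "limit_sum N n (\<lambda>i t. b i t - b i 0) K t = (\<Sum>k<?\<mu>. sqrt (real k / real (Suc K)) ^ n / sqrt N * (\<Sum>i\<in>{1..N}. ?q i * ?D i k))"
    unfolding limit_sum_def q_noise_def sum_divide_distrib sum_subtractf[symmetric]
    by (intro sum.cong refl) (simp add: right_diff_distrib)
  also have "\<dots> = (\<Sum>k<m. (if k < ?\<mu> then sqrt (real k / real (Suc K)) ^ n / sqrt N else 0) * (\<Sum>i\<in>{1..N}. ?q i * ?D i k))"
    using assms by (intro sum.mono_neutral_cong_left) auto
  also have "\<dots> = (\<Sum>k<m. \<Sum>i\<in>{1..N}. (if k < ?\<mu> then sqrt (real k / real (Suc K)) ^ n / sqrt N else 0) * ?q i * ?D i k)"
    unfolding sum_distrib_left mult.assoc ..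
  also have "\<dots> = (\<Sum>i\<in>{1..N}. \<Sum>k<m. (if k < ?\<mu> then sqrt (real k / real (Suc K)) ^ n / sqrt N else 0) * ?q i * ?D i k)"
    by (rule sum.swap)
  finally show ?thesis .
qed

lemma sum_swap3:
  "(\<Sum>n\<in>A. \<Sum>t\<in>B. \<Sum>k\<in>C. g n t k) = (\<Sum>k\<in>C. \<Sum>n\<in>A. \<Sum>t\<in>B. g n t k)"
proof -
  have "(\<Sum>n\<in>A. \<Sum>t\<in>B. \<Sum>k\<in>C. g n t k) = (\<Sum>n\<in>A. \<Sum>k\<in>C. \<Sum>t\<in>B. g n t k)"
    by (rule sum.cong[OF refl], rule sum.swap)
  also have "\<dots> = (\<Sum>k\<in>C. \<Sum>n\<in>A. \<Sum>t\<in>B. g n t k)" by (rule sum.swap)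
  finally show ?thesis .
qed

text \<open>Parseval's identity. Here orthogonality removes the mixed terms and makes the limiting
  covariance diagonal in \<open>n\<close>.\<close>

lemma sum_square_q_comb:
  "(\<Sum>i\<in>{1..N}. (\<Sum>n<N. u n * poly (q_poly N n) (hermite_zero N i))\<^sup>2) =
   (\<Sum>n<N. (u n)\<^sup>2 * (\<Sum>i\<in>{1..N}. (poly (q_poly N n) (hermite_zero N i))\<^sup>2))"
proof -
  let ?q = "\<lambda>n i. poly (q_poly N n) (hermite_zero N i)"
  have "(\<Sum>i\<in>{1..N}. (\<Sum>n<N. u n * ?q n i)\<^sup>2) = (\<Sum>i\<in>{1..N}. \<Sum>n<N. \<Sum>m<N. u n * u m * (?q n i * ?q m i))"
    by (intro sum.cong refl) (simp add: power2_eq_square sum_product mult_ac)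
  also have "\<dots> = (\<Sum>n<N. \<Sum>i\<in>{1..N}. \<Sum>m<N. u n * u m * (?q n i * ?q m i))" by (rule sum.swap)
  also have "\<dots> = (\<Sum>n<N. \<Sum>m<N. u n * u m * (\<Sum>i\<in>{1..N}. ?q n i * ?q m i))"
    unfolding sum_distrib_left by (rule sum.cong[OF refl], rule sum.swap)
  also have "\<dots> = (\<Sum>n<N. \<Sum>m<N. if m = n then (u n)\<^sup>2 * (\<Sum>i\<in>{1..N}. (?q n i)\<^sup>2) else 0)"
  proof (intro sum.cong refl)
    fix n m
    show "u n * u m * (\<Sum>i\<in>{1..N}. ?q n i * ?q m i) = (if m = n then (u n)\<^sup>2 * (\<Sum>i\<in>{1..N}. (?q n i)\<^sup>2) else 0)"
    proof (cases "m = n")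
      case False
      then have "(\<Sum>i\<in>{1..N}. ?q n i * ?q m i) = 0" by (intro q_poly_orthogonal) simp
      then show ?thesis using False by simp
    qed (simp add: power2_eq_square)
  qed
  finally show ?thesis by (simp add: sum.delta)
qed

text \<open>A discrete Ito isometry: the truncated weights for \<open>s\<close> and \<open>t\<close>
  overlap up to \<open>min s t\<close>, and squaring the half-integer power gives a Riemann sum of
  the \<open>n\<close>-th power.\<close>

lemma variance_limit_sum:
  fixes c :: "nat \<Rightarrow> real \<Rightarrow> real"
  assumes J: "finite J" "J \<subseteq> {0..}" and N: "1 \<le> N"
  defines "\<mu> \<equiv> \<lambda>K t. nat \<lfloor>t * real (Suc K)\<rfloor>"
  defines "m \<equiv> \<lambda>K. \<Sum>t\<in>J. \<mu> K t"
  defines "f \<equiv> \<lambda>K i k. \<Sum>n<N. \<Sum>t\<in>J. c n t * ((if k < \<mu> K t then sqrt (real k / real (Suc K)) ^ n / sqrt N else 0) * poly (q_poly N n) (hermite_zero N i))"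
  shows "(\<lambda>K. \<Sum>i\<in>{1..N}. \<Sum>k<m K. (f K i k)\<^sup>2 * (1 / real (Suc K))) \<longlonglongrightarrow>
    (\<Sum>n<N. \<Sum>s\<in>J. \<Sum>t\<in>J. c n s * c n t * ((\<Sum>i\<in>{1..N}. (poly (q_poly N n) (hermite_zero N i))\<^sup>2) / N / real (n + 1) * min s t ^ (n + 1)))"
proof -
  define S where "S n = (\<Sum>i\<in>{1..N}. (poly (q_poly N n) (hermite_zero N i))\<^sup>2)" for n
  define R where "R K n u = (\<Sum>k<nat \<lfloor>u * real (Suc K)\<rfloor>. (real k / real (Suc K)) ^ n * (1 / real (Suc K)))" for K n and u :: real
  have "(\<Sum>i\<in>{1..N}. \<Sum>k<m K. (f K i k)\<^sup>2 * (1 / real (Suc K))) = (\<Sum>n<N. \<Sum>s\<in>J. \<Sum>t\<in>J. c n s * c n t * (S n / N * R K n (min s t)))" for K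
  proof -
    define a where "a n k t = (if k < \<mu> K t then sqrt (real k / real (Suc K)) ^ n / sqrt N else 0)" for n k t
    define u where "u k n = (\<Sum>t\<in>J. c n t * a n k t)" for k n
    have f: "f K i k = (\<Sum>n<N. u k n * poly (q_poly N n) (hermite_zero N i))" for i k
      unfolding f_def u_def a_def sum_distrib_right mult.assoc ..
    have aa: "(\<Sum>k<m K. a n k s * a n k t * (1 / real (Suc K))) = R K n (min s t) / N" if st: "s \<in> J" "t \<in> J" for n s t
    proof -
      have min: "nat \<lfloor>min s t * real (Suc K)\<rfloor> = min (\<mu> K s) (\<mu> K t)"
      proof (cases "s \<le> t")
        case True
        then have "\<mu> K s \<le> \<mu> K t" unfolding \<mu>_def by (intro nat_mono floor_mono mult_right_mono) auto
        then show ?thesis using True by (simp add: \<mu>_def min_def)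
      next
        case False
        then have "\<mu> K t \<le> \<mu> K s" unfolding \<mu>_def by (intro nat_mono floor_mono mult_right_mono) auto
        then show ?thesis using False by (simp add: \<mu>_def min_def)
      qed
      have le: "\<mu> K s \<le> m K" unfolding m_def by (rule member_le_sum) (use st J in auto)
      have "R K n (min s t) / N = (\<Sum>k<min (\<mu> K s) (\<mu> K t). (real k / real (Suc K)) ^ n * (1 / real (Suc K)) / N)"
        unfolding R_def min sum_divide_distrib ..
      also have "\<dots> = (\<Sum>k<m K. a n k s * a n k t * (1 / real (Suc K)))"
      proof (rule sum.mono_neutral_cong_left)
        show "{..<min (\<mu> K s) (\<mu> K t)} \<subseteq> {..<m K}" using le by auto
        show "\<forall>k\<in>{..<m K} - {..<min (\<mu> K s) (\<mu> K t)}. a n k s * a n k t * (1 / real (Suc K)) = 0"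
          by (auto simp: a_def)
        fix k assume k: "k \<in> {..<min (\<mu> K s) (\<mu> K t)}"
        have "sqrt (real k / real (Suc K)) ^ n * sqrt (real k / real (Suc K)) ^ n = (real k / real (Suc K)) ^ n"
          unfolding power_mult_distrib[symmetric] by (simp del: of_nat_Suc)
        then have "a n k s * a n k t = (real k / real (Suc K)) ^ n / N" using k N by (simp add: a_def del: of_nat_Suc)
        then show "(real k / real (Suc K)) ^ n * (1 / real (Suc K)) / N = a n k s * a n k t * (1 / real (Suc K))" by simp
      qed simp
      finally show ?thesis by simp
    qed
    have "(\<Sum>i\<in>{1..N}. \<Sum>k<m K. (f K i k)\<^sup>2 * (1 / real (Suc K))) = (\<Sum>k<m K. (\<Sum>i\<in>{1..N}. (f K i k)\<^sup>2) * (1 / real (Suc K)))"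
      unfolding sum_distrib_right by (rule sum.swap)
    also have "\<dots> = (\<Sum>k<m K. \<Sum>n<N. \<Sum>s\<in>J. \<Sum>t\<in>J. c n s * c n t * S n * (a n k s * a n k t * (1 / real (Suc K))))"
      unfolding f sum_square_q_comb S_def[symmetric] unfolding u_def power2_eq_square sum_product sum_distrib_right
      by (intro sum.cong refl) (simp add: sum_distrib_left sum_divide_distrib mult_ac)
    also have "\<dots> = (\<Sum>n<N. \<Sum>s\<in>J. \<Sum>t\<in>J. \<Sum>k<m K. c n s * c n t * S n * (a n k s * a n k t * (1 / real (Suc K))))"
      by (subst sum.swap, rule sum.cong[OF refl], rule sum_swap3[symmetric])
    also have "\<dots> = (\<Sum>n<N. \<Sum>s\<in>J. \<Sum>t\<in>J. c n s * c n t * (S n / N * R K n (min s t)))"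
      unfolding sum_distrib_left[symmetric] by (intro sum.cong refl) (simp only: aa, simp)
    finally show ?thesis .
  qed
  moreover have "(\<lambda>K. \<Sum>n<N. \<Sum>s\<in>J. \<Sum>t\<in>J. c n s * c n t * (S n / N * R K n (min s t))) \<longlonglongrightarrow>
     (\<Sum>n<N. \<Sum>s\<in>J. \<Sum>t\<in>J. c n s * c n t * (S n / N * (min s t ^ (n + 1) / real (n + 1))))"
    unfolding R_def by (intro tendsto_sum tendsto_mult tendsto_const riemann_sum_power) (use J in auto)
  ultimately show ?thesis unfolding S_def by simp
qed

text \<open>Riemann sums are finite combinations of Brownian increments, so their joint
  characteristic function is explicit; dominated convergence passes to the limit. Outside the good
  set \<open>G\<close> the process is set to 0, which keeps convergence valid at every sample
  point.\<close>

theorem limit_gaussian_family: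
  assumes M: "prob_space M" and N: "1 \<le> N" and b: "\<And>i. i \<in> {1..N} \<Longrightarrow> brownian_motion M (b i)"
    and ind: "indep_processes M b {1..N}"
    and G: "G \<in> sets M" "AE \<omega> in M. \<omega> \<in> G"
    and cont: "\<And>\<omega> i. \<omega> \<in> G \<Longrightarrow> i \<in> {1..N} \<Longrightarrow> continuous_on {0..} (\<lambda>t. b i t \<omega>)"
  defines "E \<equiv> \<lambda>n t \<omega>. if \<omega> \<in> G then limit_path N n (\<lambda>i t. b i t \<omega> - b i 0 \<omega>) t else 0"
  shows "gaussian_family M N E
    (\<lambda>n s t. (\<Sum>i\<in>{1..N}. (poly (q_poly N n) (hermite_zero N i))\<^sup>2) / N / real (n + 1) * min s t ^ (n + 1))"
proof -
  interpret prob_space M by fact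
  define E' where "E' K n t \<omega> = (if \<omega> \<in> G then limit_sum N n (\<lambda>i t. b i t \<omega> - b i 0 \<omega>) K t else 0)" for K n t \<omega>
  have bm: "b i t \<in> borel_measurable M" if "i \<in> {1..N}" "0 \<le> t" for i t
    using b[OF that(1)] that by (simp add: brownian_motion_def)
  have lim: "(\<lambda>K. E' K n t \<omega>) \<longlonglongrightarrow> E n t \<omega>" if "0 \<le> t" for n t \<omega>
  proof (cases "\<omega> \<in> G")
    case True
    have "(\<lambda>K. limit_sum N n (\<lambda>i t. b i t \<omega> - b i 0 \<omega>) K t) \<longlonglongrightarrow> limit_path N n (\<lambda>i t. b i t \<omega> - b i 0 \<omega>) t"
      by (rule limit_sum_tendsto) (use cont[OF True] that in \<open>auto intro!: continuous_intros\<close>)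
    then show ?thesis using True by (simp add: E'_def E_def)
  qed (simp add: E'_def E_def)
  have E'm[measurable]: "E' K n t \<in> borel_measurable M" for K n t
  proof -
    have "(\<lambda>\<omega>. limit_sum N n (\<lambda>i t. b i t \<omega> - b i 0 \<omega>) K t) \<in> borel_measurable M"
      unfolding limit_sum_def q_noise_def
      by (intro borel_measurable_divide borel_measurable_sum borel_measurable_times borel_measurable_diff borel_measurable_const bm) auto
    then show ?thesis unfolding E'_def by (rule measurable_If_set[OF _ borel_measurable_const]) (use G in auto)
  qed
  have Em: "E n t \<in> borel_measurable M" if "0 \<le> t" for n t
    by (rule borel_measurable_LIMSEQ_real[of M "\<lambda>K. E' K n t"]) (use lim[OF that] E'm in auto)
  show ?thesis
  proof (unfold_locales)
    show "E n t \<in> borel_measurable M" if "n < N" "0 \<le> t" for n t by (rule Em) fact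
    show "(\<Sum>i\<in>{1..N}. (poly (q_poly N n) (hermite_zero N i))\<^sup>2) / N / real (n + 1) * min s t ^ (n + 1) =
       (\<Sum>i\<in>{1..N}. (poly (q_poly N n) (hermite_zero N i))\<^sup>2) / N / real (n + 1) * min t s ^ (n + 1)" for n s t
      by (simp add: min.commute)
    fix J :: "real set" and c :: "nat \<Rightarrow> real \<Rightarrow> real" assume J: "finite J" "J \<subseteq> {0..}"
    define \<mu> where "\<mu> K t = nat \<lfloor>t * real (Suc K)\<rfloor>" for K t
    \<comment> \<open>The sum of the individual lengths is a convenient common upper bound for all
      of them.\<close>
    define m where "m K = (\<Sum>t\<in>J. \<mu> K t)" for K
    define f where "f K i k = (\<Sum>n<N. \<Sum>t\<in>J. c n t * ((if k < \<mu> K t then sqrt (real k / real (Suc K)) ^ n / sqrt N else 0) * poly (q_poly N n) (hermite_zero N i)))" for K i k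
    let ?V = "\<Sum>n<N. \<Sum>s\<in>J. \<Sum>t\<in>J. c n s * c n t * ((\<Sum>i\<in>{1..N}. (poly (q_poly N n) (hermite_zero N i))\<^sup>2) / N / real (n + 1) * min s t ^ (n + 1))"
    let ?L = "\<lambda>\<omega>. \<Sum>n<N. \<Sum>t\<in>J. c n t * E n t \<omega>" and ?LK = "\<lambda>K \<omega>. \<Sum>n<N. \<Sum>t\<in>J. c n t * E' K n t \<omega>"
    have VK: "(\<lambda>K. \<Sum>i\<in>{1..N}. \<Sum>k<m K. (f K i k)\<^sup>2 * (1 / real (Suc K))) \<longlonglongrightarrow> ?V"
      unfolding m_def f_def \<mu>_def by (rule variance_limit_sum[OF J N])
    have chK: "(\<integral>\<omega>. iexp (?LK K \<omega>) \<partial>M) = complex_of_real (exp (- (\<Sum>i\<in>{1..N}. \<Sum>k<m K. (f K i k)\<^sup>2 * (1 / real (Suc K))) / 2))" for K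
    proof -
      have LK: "?LK K \<omega> = (\<Sum>i\<in>{1..N}. \<Sum>k<m K. f K i k * (b i (real (Suc k) / real (Suc K)) \<omega> - b i (real k / real (Suc K)) \<omega>))" if "\<omega> \<in> G" for \<omega>
      proof -
        let ?D = "\<lambda>i k. b i (real (Suc k) / real (Suc K)) \<omega> - b i (real k / real (Suc K)) \<omega>"
        let ?g = "\<lambda>n t i k. (if k < \<mu> K t then sqrt (real k / real (Suc K)) ^ n / sqrt N else 0) * poly (q_poly N n) (hermite_zero N i)"
        have "E' K n t \<omega> = (\<Sum>i\<in>{1..N}. \<Sum>k<m K. ?g n t i k * ?D i k)" if "t \<in> J" for n t
        proof -
          have "\<mu> K t \<le> m K" unfolding m_def by (rule member_le_sum) (use that J in auto)
          from limit_sum_eq[of t K "m K" N n "\<lambda>i t. b i t \<omega>", folded \<mu>_def, OF this]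
          show ?thesis using \<open>\<omega> \<in> G\<close> by (simp add: E'_def)
        qed
        then have "?LK K \<omega> = (\<Sum>n<N. \<Sum>t\<in>J. \<Sum>i\<in>{1..N}. \<Sum>k<m K. c n t * ?g n t i k * ?D i k)"
          by (simp add: sum_distrib_left mult.assoc)
        also have "\<dots> = (\<Sum>i\<in>{1..N}. \<Sum>n<N. \<Sum>t\<in>J. \<Sum>k<m K. c n t * ?g n t i k * ?D i k)"
          by (rule sum_swap3)
        also have "\<dots> = (\<Sum>i\<in>{1..N}. \<Sum>k<m K. \<Sum>n<N. \<Sum>t\<in>J. c n t * ?g n t i k * ?D i k)"
          by (rule sum.cong[OF refl], rule sum_swap3)
        finally show ?thesis unfolding f_def sum_distrib_right .
      qed
      have "(\<integral>\<omega>. iexp (?LK K \<omega>) \<partial>M) =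
         (\<integral>\<omega>. iexp (\<Sum>i\<in>{1..N}. \<Sum>k<m K. f K i k * (b i (real (Suc k) / real (Suc K)) \<omega> - b i (real k / real (Suc K)) \<omega>)) \<partial>M)"
      proof (rule integral_cong_AE)
        show "(\<lambda>\<omega>. iexp (?LK K \<omega>)) \<in> borel_measurable M" by measurable
        have "(\<lambda>\<omega>. \<Sum>i\<in>{1..N}. \<Sum>k<m K. f K i k * (b i (real (Suc k) / real (Suc K)) \<omega> - b i (real k / real (Suc K)) \<omega>)) \<in> borel_measurable M"
          by (intro borel_measurable_sum borel_measurable_times borel_measurable_diff borel_measurable_const bm) auto
        then show "(\<lambda>\<omega>. iexp (\<Sum>i\<in>{1..N}. \<Sum>k<m K. f K i k * (b i (real (Suc k) / real (Suc K)) \<omega> - b i (real k / real (Suc K)) \<omega>))) \<in> borel_measurable M"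
          by measurable
        show "AE \<omega> in M. iexp (?LK K \<omega>) = iexp (\<Sum>i\<in>{1..N}. \<Sum>k<m K. f K i k * (b i (real (Suc k) / real (Suc K)) \<omega> - b i (real k / real (Suc K)) \<omega>))"
          using G(2) by eventually_elim (simp only: LK)
      qed
      also have "\<dots> = complex_of_real (exp (- (\<Sum>i\<in>{1..N}. \<Sum>k<m K. (f K i k)\<^sup>2 * (1 / real (Suc K))) / 2))"
        by (rule char_brownian_increments[OF M b _ ind]) auto
      finally show ?thesis .
    qed
    have Lm: "?L \<in> borel_measurable M" by (intro borel_measurable_sum borel_measurable_times borel_measurable_const Em) (use J in auto)
    have "(\<lambda>K. \<integral>\<omega>. iexp (?LK K \<omega>) \<partial>M) \<longlonglongrightarrow> (\<integral>\<omega>. iexp (?L \<omega>) \<partial>M)"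
    proof (rule integral_dominated_convergence[where w = "\<lambda>_. 1"])
      show "(\<lambda>\<omega>. iexp (?L \<omega>)) \<in> borel_measurable M" using Lm by measurable
      show "(\<lambda>\<omega>. iexp (?LK K \<omega>)) \<in> borel_measurable M" for K by measurable
      show "AE \<omega> in M. (\<lambda>K. iexp (?LK K \<omega>)) \<longlonglongrightarrow> iexp (?L \<omega>)"
        by (intro AE_I2 tendsto_exp tendsto_mult tendsto_const tendsto_of_real tendsto_sum lim) (use J in auto)
    qed auto
    moreover have "(\<lambda>K. \<integral>\<omega>. iexp (?LK K \<omega>) \<partial>M) \<longlonglongrightarrow> complex_of_real (exp (- ?V / 2))"
      unfolding chK by (intro tendsto_of_real tendsto_exp tendsto_divide tendsto_minus VK tendsto_const) simp
    ultimately show "(\<integral>\<omega>. iexp (?L \<omega>) \<partial>M) = complex_of_real (exp (- ?V / 2))"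
      by (rule LIMSEQ_unique)
  qed
qed

section \<open>Convergence of the fluctuations\<close>

lemma continuous_on_initial_segments:
  fixes f :: "real \<Rightarrow> 'b::topological_space"
  assumes "\<And>T. 0 \<le> T \<Longrightarrow> continuous_on {0..T} f"
  shows "continuous_on {0..} f"
  unfolding continuous_on_eq_continuous_within
proof
  fix t :: real assume t: "t \<in> {0..}"
  have "at t within {0..} = at t within {0..t + 1}"
    by (rule at_within_nhd[of t "{t - 1<..<t + 1}"]) auto
  moreover have "continuous (at t within {0..t + 1}) f"
    using assms[of "t + 1"] t by (simp add: continuous_on_eq_continuous_within)
  ultimately show "continuous (at t within {0..}) f" by (simp add: continuous_within)
qed

lemma continuous_on_limit_path:
  assumes "\<And>i. i \<in> {1..N} \<Longrightarrow> continuous_on {0..} (w i)"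
  shows "continuous_on {0..} (limit_path N n w)"
proof (rule continuous_on_initial_segments)
  fix T :: real assume "0 \<le> T"
  have h: "continuous_on {0..T} (q_noise N n w)" unfolding q_noise_def
    by (intro continuous_intros continuous_on_subset[OF assms]) auto
  have "continuous_on {0..T} (\<lambda>t. LBINT s:{0..t}. real n / 2 * s powr (real n / 2 - 1) * q_noise N n w s)"
  proof (cases "n = 0")
    case False
    then show ?thesis by (intro primitive_continuous[OF primitive_powr_mult] h) auto
  qed (simp add: set_lebesgue_integral_def)
  then show "continuous_on {0..T} (limit_path N n w)" unfolding limit_path_def divide_inverse
    by (intro continuous_intros h)
qed

lemma fluctuation_eq:
  "fluctuation N \<beta> X n t \<omega> = sqrt (\<beta> * real N / 2) *
     ((\<Sum>i\<in>{1..N}. Qt_poly N n t (X i t \<omega>)) / N - (\<Sum>i\<in>{1..N}. Qt_poly N n t (sqrt t * hermite_zero N i)) / N)"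
proof -
  have [measurable]: "Qt_poly N n t \<in> borel_measurable borel" unfolding Qt_poly_def by measurable
  show ?thesis unfolding fluctuation_def limit_measure_def
    by (subst (1 2) integral_empirical_measure) (auto simp: sum.atLeast_Suc_atMost)
qed

lemma continuous_on_fluctuation:
  assumes "\<And>i. i \<in> {1..N} \<Longrightarrow> continuous_on S (\<lambda>t. X i t \<omega>)"
  shows "continuous_on S (\<lambda>t. fluctuation N \<beta> X n t \<omega>)"
  unfolding fluctuation_eq Qt_poly_def divide_inverse by (intro continuous_intros assms)

lemma measurable_fluctuation:
  assumes "\<And>i. i \<in> {1..N} \<Longrightarrow> X i t \<in> borel_measurable M"
  shows "fluctuation N \<beta> X n t \<in> borel_measurable M"
  unfolding fluctuation_eq[abs_def] Qt_poly_def divide_inverse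
  by (intro borel_measurable_times borel_measurable_diff borel_measurable_sum borel_measurable_power borel_measurable_const assms)

text \<open>All generators, including the added null sets, are measurable in \<open>M\<close>, so
  adapted variables are measurable in \<open>M\<close>.\<close>

lemma measurable_augmented_filtration:
  assumes b: "\<And>i s. i \<in> {1..N} \<Longrightarrow> 0 \<le> s \<Longrightarrow> b i s \<in> borel_measurable M"
    and f: "f \<in> borel_measurable (augmented_filtration M N b t)"
  shows "f \<in> borel_measurable M"
proof -
  let ?A = "{b i s -` A \<inter> space M | i s A. i \<in> {1..N} \<and> 0 \<le> s \<and> s \<le> t \<and> A \<in> sets borel} \<union> null_sets M"
  have A: "?A \<subseteq> sets M" using b by (auto intro: measurable_sets)
  then have P: "?A \<subseteq> Pow (space M)" using sets.sets_into_space by blast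
  show ?thesis
  proof (rule measurableI)
    fix B :: "'b set" assume "B \<in> sets borel"
    from measurable_sets[OF f this]
    have "f -` B \<inter> space M \<in> sigma_sets (space M) ?A"
      unfolding augmented_filtration_def space_measure_of[OF P] sets_measure_of[OF P] .
    then show "f -` B \<inter> space M \<in> sets M" using sets.sigma_sets_subset[OF A] by blast
  qed simp
qed

lemma random_element_continuous_map:
  fixes f :: "'b \<Rightarrow> real"
  assumes X: "random_element M S X" and f: "continuous_map S euclideanreal f"
  shows "(\<lambda>\<omega>. f (X \<omega>)) \<in> borel_measurable M"
proof -
  have sub: "{U. openin S U} \<subseteq> Pow (topspace S)" using openin_subset by auto
  have "f \<in> borel_measurable (sigma (topspace S) {U. openin S U})"
  proof (rule borel_measurableI)
    fix V :: "real set" assume "open V"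
    then have "openin S {x \<in> topspace S. f x \<in> V}" using f by (intro openin_continuous_map_preimage) auto
    moreover have "f -` V \<inter> space (sigma (topspace S) {U. openin S U}) = {x \<in> topspace S. f x \<in> V}"
      unfolding space_measure_of[OF sub] by auto
    ultimately show "f -` V \<inter> space (sigma (topspace S) {U. openin S U}) \<in> sets (sigma (topspace S) {U. openin S U})"
      unfolding sets_measure_of[OF sub] by (simp add: sigma_sets.Basic)
  qed
  with X[unfolded random_element_def] show ?thesis by (rule measurable_compose)
qed

text \<open>The weak ordering at all times and distinctness at almost all times combine to strict
  ordering at almost all times. The exceptional event depends on \<open>\<beta>\<close>, but not on
  \<open>T\<close>.\<close>

lemma strong_solution_driven:
  assumes sol: "strong_solution M N \<beta> b X"
    and ord: "AE \<omega> in M. \<forall>t\<ge>0. \<forall>i\<in>{1..N}. \<forall>j\<in>{1..N}. i \<le> j \<longrightarrow> X i t \<omega> \<le> X j t \<omega>"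
  shows "AE \<omega> in M. \<forall>T. driven N T (sqrt (2 / \<beta>)) (\<lambda>i t. b i t \<omega> - b i 0 \<omega>) (\<lambda>i t. X i t \<omega>)"
proof -
  have 1: "AE \<omega> in M. \<forall>i\<in>{1..N}. X i 0 \<omega> = 0"
    and 2: "AE \<omega> in M. AE s in lborel. 0 < s \<longrightarrow> inj_on (\<lambda>i. X i s \<omega>) {1..N}"
    and 3: "AE \<omega> in M. \<forall>i\<in>{1..N}. \<forall>t\<ge>0.
        set_integrable lborel {0..t} (\<lambda>s. drift N (\<lambda>j. X j s \<omega>) i) \<and>
        X i t \<omega> = X i 0 \<omega> + sqrt (2 / \<beta>) * (b i t \<omega> - b i 0 \<omega>) + (LBINT s:{0..t}. drift N (\<lambda>j. X j s \<omega>) i)"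
    using sol unfolding strong_solution_def by blast+
  show ?thesis using 1 2 3 ord
  proof eventually_elim
    case (elim \<omega>)
    note e1 = elim(1) and e2 = elim(2) and e3 = elim(3) and e4 = elim(4)
    show ?case
    proof
      fix T
      show "driven N T (sqrt (2 / \<beta>)) (\<lambda>i t. b i t \<omega> - b i 0 \<omega>) (\<lambda>i t. X i t \<omega>)"
        unfolding driven_def
      proof (intro conjI ballI)
        fix i assume i: "i \<in> {1..N}"
        show "X i 0 \<omega> = 0" using e1 i by blast
        show "primitive T (\<lambda>t. X i t \<omega> - sqrt (2 / \<beta>) * (b i t \<omega> - b i 0 \<omega>)) (\<lambda>s. drift N (\<lambda>j. X j s \<omega>) i)"
        proof (rule primitiveI)
          show "set_integrable lborel {0..T} (\<lambda>s. drift N (\<lambda>j. X j s \<omega>) i)"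
          proof (cases "0 \<le> T")
            case True then show ?thesis using e3 i by blast
          next
            case False then show ?thesis by (simp add: set_integrable_def)
          qed
          fix t assume "0 \<le> t" "t \<le> T"
          then have eq: "X i t \<omega> = X i 0 \<omega> + sqrt (2 / \<beta>) * (b i t \<omega> - b i 0 \<omega>) + (LBINT s:{0..t}. drift N (\<lambda>j. X j s \<omega>) i)"
            using e3 i by blast
          show "X i t \<omega> - sqrt (2 / \<beta>) * (b i t \<omega> - b i 0 \<omega>) =
             X i 0 \<omega> - sqrt (2 / \<beta>) * (b i 0 \<omega> - b i 0 \<omega>) + (LBINT s:{0..t}. drift N (\<lambda>j. X j s \<omega>) i)"
            unfolding diff_self mult_zero_right using eq by linarith
        qed
      next
        show "AE s in lborel. 0 < s \<longrightarrow> s \<le> T \<longrightarrow> (\<forall>i\<in>{1..N}. \<forall>j\<in>{1..N}. i < j \<longrightarrow> X i s \<omega> < X j s \<omega>)"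
          using e2
        proof eventually_elim
          case (elim s)
          show ?case
          proof (intro impI ballI)
            fix i j assume s: "0 < s" and ij: "i \<in> {1..N}" "j \<in> {1..N}" "i < j"
            have "X i s \<omega> \<le> X j s \<omega>" using e4 s ij by (meson less_imp_le)
            moreover have "X i s \<omega> \<noteq> X j s \<omega>" using inj_onD[of "\<lambda>i. X i s \<omega>" "{1..N}" i j] elim s ij by blast
            ultimately show "X i s \<omega> < X j s \<omega>" by simp
          qed
        qed
      qed
    qed
  qed
qed

section \<open>Coupling of all \<beta> and convergence in law\<close>

theorem theorem4p3:
  fixes N :: nat
    and M :: "'a measure"
    and b :: "nat \<Rightarrow> real \<Rightarrow> 'a \<Rightarrow> real"
    and lam :: "real \<Rightarrow> nat \<Rightarrow> real \<Rightarrow> 'a \<Rightarrow> real"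
  assumes "N \<ge> 2"
    and "prob_space M"
    and "\<And>i. i \<in> {1..N} \<Longrightarrow> brownian_motion M (b i)"
    and "indep_processes M b {1..N}"
    and "\<And>\<beta>. \<beta> \<ge> 1 \<Longrightarrow> strong_solution M N \<beta> b (lam \<beta>)"
    and "\<And>\<beta>. \<beta> \<ge> 1 \<Longrightarrow>
           AE \<omega> in M. \<forall>t\<ge>0. \<forall>i\<in>{1..N}. \<forall>j\<in>{1..N}. i \<le> j \<longrightarrow> lam \<beta> i t \<omega> \<le> lam \<beta> j t \<omega>"
  shows "\<exists>(P :: (nat \<Rightarrow> real \<Rightarrow> real) measure) (\<eta> :: nat \<Rightarrow> real \<Rightarrow> (nat \<Rightarrow> real \<Rightarrow> real) \<Rightarrow> real).
           prob_space P \<and>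
           (\<forall>n<N. centered_gaussian_process P (\<eta> n)) \<and>
           indep_processes P \<eta> {..<N} \<and>
           (\<forall>m<N. \<forall>n<N. \<forall>s\<ge>0. \<forall>t\<ge>0.
              (\<integral>\<omega>. \<eta> m s \<omega> * \<eta> n t \<omega> \<partial>P) =
                (if m = n then 1 else 0) *
                ((\<integral>x. poly (q_poly N n) x * poly (q_poly N n) x \<partial>limit_measure N 1) / (real n + 1)) *
                (min s t) ^ (n + 1)) \<and>
           (\<forall>T>0. converges_in_distribution (path_space T N)
              M (\<lambda>\<beta>. paths T N (fluctuation N \<beta> (lam \<beta>)))
              P (paths T N \<eta>) at_top)"
proof -
  interpret M: prob_space M by fact
  note b = assms(3) and sol = assms(5) and ord = assms(6)
  have N: "1 \<le> N" using assms(1) by simp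
  \<comment> \<open>Starting from the increment makes the initial value 0 at every sample point;
    Brownian motion provides this only almost surely.\<close>
  define w where "w \<omega> i t = b i t \<omega> - b i 0 \<omega>" for \<omega> i t
  have "AE \<omega> in M. \<forall>i\<in>{1..N}. continuous_on {0..} (\<lambda>t. b i t \<omega>)"
    using b by (intro AE_finite_allI) (auto simp: brownian_motion_def)
  then obtain Nl where Nl: "Nl \<in> null_sets M" "{\<omega> \<in> space M. \<not> (\<forall>i\<in>{1..N}. continuous_on {0..} (\<lambda>t. b i t \<omega>))} \<subseteq> Nl"
    by (auto simp: eventually_ae_filter)
  \<comment> \<open>The set of continuous sample points may fail to be measurable; the complement of
    a null set covering the others is a measurable substitute.\<close>
  define G where "G = space M - Nl"
  have G: "G \<in> sets M" "AE \<omega> in M. \<omega> \<in> G"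
    using Nl(1) AE_not_in[OF Nl(1)] by (auto simp: G_def)
  have cont: "continuous_on {0..} (\<lambda>t. b i t \<omega>)" if "\<omega> \<in> G" "i \<in> {1..N}" for \<omega> i
  proof -
    have "\<omega> \<notin> {\<omega> \<in> space M. \<not> (\<forall>i\<in>{1..N}. continuous_on {0..} (\<lambda>t. b i t \<omega>))}" "\<omega> \<in> space M"
      using Nl(2) that(1) unfolding G_def by blast+
    then show ?thesis using that(2) by blast
  qed
  have wcont: "continuous_on {0..} (w \<omega> i)" if "\<omega> \<in> G" "i \<in> {1..N}" for \<omega> i
    unfolding w_def by (intro continuous_intros cont that)
  define E where "E n t \<omega> = (if \<omega> \<in> G then limit_path N n (w \<omega>) t else 0)" for n t \<omega>
  define \<gamma> where "\<gamma> n s t = (\<Sum>i\<in>{1..N}. (poly (q_poly N n) (hermite_zero N i))\<^sup>2) / N / real (n + 1) * min s t ^ (n + 1)" for n and s t :: real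
  interpret E: gaussian_family M N E \<gamma>
    unfolding E_def[abs_def] \<gamma>_def[abs_def] w_def[abs_def]
    by (rule limit_gaussian_family[OF assms(2) N b assms(4) G cont])
  have Ec: "continuous_on {0..} (\<lambda>t. E n t \<omega>)" for n \<omega>
    unfolding E_def using continuous_on_limit_path[OF wcont] by (cases "\<omega> \<in> G") auto
  \<comment> \<open>The space carries only continuous paths: a random element of \<^const>\<open>path_space\<close> has to take its
    values there everywhere, not just almost surely.\<close>
  define S where "S = (PiM {..<N} (\<lambda>_. PiM {0..} (\<lambda>_. borel)) :: (nat \<Rightarrow> real \<Rightarrow> real) measure)"
  define C where "C = {p :: nat \<Rightarrow> real \<Rightarrow> real. \<forall>n<N. continuous_on {0..} (p n)}"
  define \<Psi> where "\<Psi> \<omega> = (\<lambda>n\<in>{..<N}. \<lambda>t\<in>{0..}. E n t \<omega>)" for \<omega>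
  \<comment> \<open>The law of \<open>E\<close> on the function space prescribed by the conclusion;
    the limit processes are the coordinates under this law.\<close>
  define P where "P = distr M (restrict_space S C) \<Psi>"
  define \<eta> where "\<eta> n t p = p n t" for n t and p :: "nat \<Rightarrow> real \<Rightarrow> real"
  have \<Psi>S: "\<Psi> \<in> measurable M S"
    unfolding S_def \<Psi>_def by (intro measurable_restrict E.meas) auto
  have \<Psi>C: "\<Psi> \<omega> \<in> C" for \<omega>
  proof -
    have "continuous_on {0..} (\<lambda>t\<in>{0..}. E n t \<omega>)" for n
      using Ec[of n \<omega>] by (rule continuous_on_eq) simp
    then show ?thesis by (simp add: C_def \<Psi>_def)
  qed
  have \<Psi>m: "\<Psi> \<in> measurable M (restrict_space S C)"
    by (rule measurable_restrict_space2[OF _ \<Psi>S]) (use \<Psi>C in auto)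
  have \<eta>\<Psi>: "\<eta> n t (\<Psi> \<omega>) = E n t \<omega>" if "n < N" "0 \<le> t" for n t \<omega>
    using that by (simp add: \<eta>_def \<Psi>_def)
  have \<eta>m: "\<eta> n t \<in> borel_measurable (restrict_space S C)" if "n < N" "0 \<le> t" for n t
  proof (rule measurable_restrict_space1)
    have 1: "(\<lambda>p. p n) \<in> measurable S (PiM {0..} (\<lambda>_. borel :: real measure))"
      unfolding S_def by (rule measurable_component_singleton) (use that in simp)
    have 2: "(\<lambda>f. f t) \<in> borel_measurable (PiM {0..} (\<lambda>_. borel :: real measure))"
      by (rule measurable_component_singleton) (use that in simp)
    show "\<eta> n t \<in> borel_measurable S" unfolding \<eta>_def[abs_def] by (rule measurable_compose[OF 1 2])
  qed
  have \<eta>P: "\<eta> n t \<in> borel_measurable P" if "n < N" "0 \<le> t" for n t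
    using \<eta>m[OF that] by (simp add: P_def)
  have P: "prob_space P" unfolding P_def by (rule M.prob_space_distr[OF \<Psi>m])
  interpret P: prob_space P by (rule P)
  have Pfam: "gaussian_family P N \<eta> \<gamma>"
  proof (unfold_locales)
    show "\<eta> n t \<in> borel_measurable P" if "n < N" "0 \<le> t" for n t by (rule \<eta>P[OF that])
    show "\<gamma> n s t = \<gamma> n t s" for n s t by (rule E.sym)
    fix J :: "real set" and c :: "nat \<Rightarrow> real \<Rightarrow> real" assume J: "finite J" "J \<subseteq> {0..}"
    have Lm: "(\<lambda>p. \<Sum>n<N. \<Sum>t\<in>J. c n t * \<eta> n t p) \<in> borel_measurable (restrict_space S C)"
      by (intro borel_measurable_sum borel_measurable_times borel_measurable_const \<eta>m) (use J in auto)
    have "(\<integral>p. iexp (\<Sum>n<N. \<Sum>t\<in>J. c n t * \<eta> n t p) \<partial>P) = (\<integral>\<omega>. iexp (\<Sum>n<N. \<Sum>t\<in>J. c n t * \<eta> n t (\<Psi> \<omega>)) \<partial>M)"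
      unfolding P_def by (rule integral_distr[OF \<Psi>m], rule measurable_compose[OF Lm]) measurable
    also have "\<dots> = (\<integral>\<omega>. iexp (\<Sum>n<N. \<Sum>t\<in>J. c n t * E n t \<omega>) \<partial>M)"
    proof -
      have "(\<Sum>n<N. \<Sum>t\<in>J. c n t * \<eta> n t (\<Psi> \<omega>)) = (\<Sum>n<N. \<Sum>t\<in>J. c n t * E n t \<omega>)" for \<omega>
        by (intro sum.cong refl) (use J \<eta>\<Psi> in auto)
      then show ?thesis by (simp only:)
    qed
    also have "\<dots> = complex_of_real (exp (- (\<Sum>n<N. \<Sum>s\<in>J. \<Sum>t\<in>J. c n s * c n t * \<gamma> n s t) / 2))"
      by (rule E.char_fun[OF J])
    finally show "(\<integral>p. iexp (\<Sum>n<N. \<Sum>t\<in>J. c n t * \<eta> n t p) \<partial>P) =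
      complex_of_real (exp (- (\<Sum>n<N. \<Sum>s\<in>J. \<Sum>t\<in>J. c n s * c n t * \<gamma> n s t) / 2))" .
  qed
  interpret F: gaussian_family P N \<eta> \<gamma> by (rule Pfam)
  have indep: "indep_processes P \<eta> {..<N}"
    by (rule indep_processes_of_char[OF P \<eta>P F.char_factor])
  have cov: "(\<integral>\<omega>. \<eta> m s \<omega> * \<eta> n t \<omega> \<partial>P) = (if m = n then 1 else 0) *
      ((\<integral>x. poly (q_poly N n) x * poly (q_poly N n) x \<partial>limit_measure N 1) / (real n + 1)) * (min s t) ^ (n + 1)"
    if "m < N" "n < N" "0 \<le> s" "0 \<le> t" for m n s t
  proof -
    have "(\<integral>x. poly (q_poly N n) x * poly (q_poly N n) x \<partial>limit_measure N 1) =
       (\<Sum>i\<in>{1..N}. (poly (q_poly N n) (hermite_zero N i))\<^sup>2) / N"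
      unfolding limit_measure_def
      by (subst integral_empirical_measure)
        (auto simp: power2_eq_square intro!: borel_measurable_continuous_onI continuous_intros)
    then show ?thesis unfolding F.covariance[OF that] \<gamma>_def by (simp add: add.commute)
  qed
  have conv: "converges_in_distribution (path_space T N) M (\<lambda>\<beta>. paths T N (fluctuation N \<beta> (lam \<beta>))) P (paths T N \<eta>) at_top"
    if T: "0 < T" for T
    unfolding converges_in_distribution_def
  proof (intro conjI allI impI)
    have lam_c: "continuous_on {0..T} (\<lambda>t. lam \<beta> i t \<omega>)" if "1 \<le> \<beta>" "i \<in> {1..N}" "\<omega> \<in> space M" for \<beta> i \<omega>
      by (rule continuous_on_subset[of "{0..}"]) (use sol[OF that(1)] that in \<open>auto simp: strong_solution_def\<close>)
    have fl_c: "continuous_on {0..T} (\<lambda>t. fluctuation N \<beta> (lam \<beta>) n t \<omega>)" if "1 \<le> \<beta>" "\<omega> \<in> space M" for \<beta> n \<omega>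
      by (rule continuous_on_fluctuation) (rule lam_c[OF that(1) _ that(2)])
    have re: "random_element M (path_space T N) (paths T N (fluctuation N \<beta> (lam \<beta>)))" if \<beta>: "1 \<le> \<beta>" for \<beta>
    proof (rule random_element_paths[OF T])
      fix n t assume t: "t \<in> {0..T}"
      show "fluctuation N \<beta> (lam \<beta>) n t \<in> borel_measurable M"
      proof (rule measurable_fluctuation, rule measurable_augmented_filtration)
        fix i assume "i \<in> {1..N}"
        then show "lam \<beta> i t \<in> borel_measurable (augmented_filtration M N b t)"
          using sol[OF \<beta>] t by (auto simp: strong_solution_def)
      next
        fix i and s :: real assume "i \<in> {1..N}" "0 \<le> s"
        then show "b i s \<in> borel_measurable M" using b by (auto simp: brownian_motion_def)
      qed
    qed (rule fl_c[OF \<beta>])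
    show "\<forall>\<^sub>F \<beta> in at_top. random_element M (path_space T N) (paths T N (fluctuation N \<beta> (lam \<beta>)))"
      using eventually_ge_at_top[of 1] by eventually_elim (rule re)
    show reP: "random_element P (path_space T N) (paths T N \<eta>)"
    proof (rule random_element_paths[OF T])
      fix n p assume n: "n < N" and "p \<in> space P"
      then have "p \<in> C" by (auto simp: P_def space_restrict_space)
      then have "continuous_on {0..} (p n)" using n by (simp add: C_def)
      then show "continuous_on {0..T} (\<lambda>t. \<eta> n t p)" unfolding \<eta>_def by (rule continuous_on_subset) auto
    qed (use \<eta>P in auto)
    fix f :: "(nat \<Rightarrow> real \<Rightarrow> real) \<Rightarrow> real"
    assume f: "continuous_map (path_space T N) euclideanreal f" and bd: "bounded (f ` topspace (path_space T N))"
    from bd obtain B where B: "\<And>x. x \<in> topspace (path_space T N) \<Longrightarrow> \<bar>f x\<bar> \<le> B"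
      by (auto simp: bounded_iff)
    have "paths T N \<eta> (\<Psi> \<omega>) = paths T N E \<omega>" for \<omega>
      unfolding paths_def by (intro restrict_ext) (use \<eta>\<Psi> in auto)
    moreover have "(\<integral>p. f (paths T N \<eta> p) \<partial>P) = (\<integral>\<omega>. f (paths T N \<eta> (\<Psi> \<omega>)) \<partial>M)"
      unfolding P_def
      by (rule integral_distr[OF \<Psi>m]) (use random_element_continuous_map[OF reP f] in \<open>simp add: P_def\<close>)
    ultimately have fP: "(\<integral>p. f (paths T N \<eta> p) \<partial>P) = (\<integral>\<omega>. f (paths T N E \<omega>) \<partial>M)" by simp
    have Ecs: "continuous_on {0..T} (\<lambda>t. E n t \<omega>)" for n \<omega> by (rule continuous_on_subset[OF Ec]) auto
    have reE: "random_element M (path_space T N) (paths T N E)"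
      by (rule random_element_paths[OF T]) (use E.meas Ecs in auto)
    show "((\<lambda>\<beta>. \<integral>\<omega>. f (paths T N (fluctuation N \<beta> (lam \<beta>)) \<omega>) \<partial>M) \<longlongrightarrow> (\<integral>p. f (paths T N \<eta> p) \<partial>P)) at_top"
      unfolding fP
    proof (rule tendsto_at_topI_sequentially)
      fix X :: "nat \<Rightarrow> real" assume X: "filterlim X at_top sequentially"
      \<comment> \<open>A sequence is needed here, since the null sets of the solutions depend on \<open>\<beta>\<close>.\<close>
      define Y where "Y k = max 2 (X k)" for k
      have Y: "2 \<le> Y k" "1 \<le> Y k" for k by (auto simp: Y_def)
      have XY: "\<forall>\<^sub>F k in sequentially. Y k = X k"
        using filterlim_at_top[THEN iffD1, OF X, rule_format, of 2] by eventually_elim (simp add: Y_def)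
      have Ylim: "filterlim Y at_top sequentially"
        by (rule filterlim_at_top_mono[OF X]) (simp add: Y_def)
      \<comment> \<open>The exponent 1/16 makes \<open>\<delta> k ^ 8\<close> the noise amplitude
        \<open>sqrt (2 / Y k)\<close>, and \<open>2 \<le> Y k\<close> ensures
        \<open>\<delta> k \<le> 1\<close>.\<close>
      define \<delta> where "\<delta> k = (2 / Y k) powr (1 / 16)" for k
      have \<delta>: "0 < \<delta> k" "\<delta> k \<le> 1" "\<delta> k ^ 8 = sqrt (2 / Y k)" for k
      proof -
        have y: "0 < 2 / Y k" "2 / Y k \<le> 1" using Y(1)[of k] by (auto simp: divide_le_eq)
        show "0 < \<delta> k" using y by (simp add: \<delta>_def)
        have "(2 / Y k) powr (1 / 16) \<le> 1 powr (1 / 16)" using y by (intro powr_mono2) auto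
        then show "\<delta> k \<le> 1" by (simp add: \<delta>_def)
        have "\<delta> k ^ 8 = (2 / Y k) powr (1 / 16 * 8)"
          unfolding powr_powr[symmetric] \<delta>_def[symmetric] using \<open>0 < \<delta> k\<close> by (simp add: powr_numeral)
        then show "\<delta> k ^ 8 = sqrt (2 / Y k)" using y by (simp add: powr_half_sqrt)
      qed
      have \<delta>0: "\<delta> \<longlonglongrightarrow> 0"
      proof -
        have "(\<lambda>k. 2 / Y k) \<longlonglongrightarrow> 0" by (rule real_tendsto_divide_at_top[OF tendsto_const Ylim])
        moreover have "\<forall>\<^sub>F k in sequentially. 0 \<le> 2 / Y k" by (intro always_eventually allI divide_nonneg_nonneg) (simp_all add: Y_def)
        ultimately have "(\<lambda>k. (2 / Y k) powr (1 / 16)) \<longlonglongrightarrow> 0 powr (1 / 16)"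
          by (intro tendsto_powr') auto
        then show ?thesis by (simp add: \<delta>_def[abs_def])
      qed
      have ae: "AE \<omega> in M. \<forall>k. \<forall>T. driven N T (sqrt (2 / Y k)) (w \<omega>) (\<lambda>i t. lam (Y k) i t \<omega>)"
        unfolding AE_all_countable w_def using strong_solution_driven[OF sol ord] Y(2) by auto
      have "(\<lambda>k. \<integral>\<omega>. f (paths T N (fluctuation N (Y k) (lam (Y k))) \<omega>) \<partial>M) \<longlonglongrightarrow> (\<integral>\<omega>. f (paths T N E \<omega>) \<partial>M)"
      proof (rule integral_dominated_convergence[where w = "\<lambda>_. B"])
        show "(\<lambda>\<omega>. f (paths T N E \<omega>)) \<in> borel_measurable M" by (rule random_element_continuous_map[OF reE f])
        show "(\<lambda>\<omega>. f (paths T N (fluctuation N (Y k) (lam (Y k))) \<omega>)) \<in> borel_measurable M" for k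
          by (rule random_element_continuous_map[OF re[OF Y(2)] f])
        show "AE \<omega> in M. norm (f (paths T N (fluctuation N (Y k) (lam (Y k))) \<omega>)) \<le> B" for k
          using paths_in_path_space[of N T "fluctuation N (Y k) (lam (Y k))"] fl_c[OF Y(2)] B by (intro AE_I2) simp
        show "AE \<omega> in M. (\<lambda>k. f (paths T N (fluctuation N (Y k) (lam (Y k))) \<omega>)) \<longlonglongrightarrow> f (paths T N E \<omega>)"
          using ae G(2) AE_space
        proof eventually_elim
          case (elim \<omega>)
          have dr: "driven N T (\<delta> k ^ 8) (w \<omega>) (\<lambda>i t. lam (Y k) i t \<omega>)" for k using elim(1) \<delta>(3) by simp
          have w0: "w \<omega> i 0 = 0" for i by (simp add: w_def)
          have wc: "continuous_on {0..T} (w \<omega> i)" if "i \<in> {1..N}" for i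
            by (rule continuous_on_subset[OF wcont[OF elim(2) that]]) auto
          obtain K where K: "\<And>\<delta> x n t. 0 < \<delta> \<Longrightarrow> \<delta> \<le> 1 \<Longrightarrow> driven N T (\<delta> ^ 8) (w \<omega>) x \<Longrightarrow> n < N \<Longrightarrow> t \<in> {0..T} \<Longrightarrow>
             \<bar>sqrt N / \<delta> ^ 8 * ((\<Sum>i\<in>{1..N}. Qt_poly N n t (x i t)) / N - (\<Sum>i\<in>{1..N}. Qt_poly N n t (sqrt t * hermite_zero N i)) / N)
               - limit_path N n (w \<omega>) t\<bar> \<le> K * \<delta>"
            using driven_limit[OF N less_imp_le[OF T], of "w \<omega>"] w0 wc by blast
          have fl: "\<bar>fluctuation N (Y k) (lam (Y k)) n t \<omega> - E n t \<omega>\<bar> \<le> K * \<delta> k" if "n < N" "t \<in> {0..T}" for k n t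
          proof -
            \<comment> \<open>The normalisation of the pathwise limit is exactly that of
              \<open>fluctuation\<close>.\<close>
            have "sqrt N / \<delta> k ^ 8 = sqrt (Y k * real N / 2)"
              unfolding \<delta>(3) real_sqrt_divide[symmetric] by (simp add: mult.commute)
            then show ?thesis using K[OF \<delta>(1,2) dr that, of k] elim(2) unfolding fluctuation_eq E_def by simp
          qed
          have "limitin (path_space T N) (\<lambda>k. paths T N (fluctuation N (Y k) (lam (Y k))) \<omega>) (paths T N E \<omega>) sequentially"
          proof (rule limitin_path_space)
            fix n and e :: real assume n: "n < N" and e: "0 < e"
            have "(\<lambda>k. K * \<delta> k) \<longlonglongrightarrow> K * 0" by (intro tendsto_intros \<delta>0)
            then have "\<forall>\<^sub>F k in sequentially. K * \<delta> k < e" using e by (intro order_tendstoD(2)) auto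
            then show "\<forall>\<^sub>F k in sequentially. \<forall>t\<in>{0..T}. \<bar>fluctuation N (Y k) (lam (Y k)) n t \<omega> - E n t \<omega>\<bar> \<le> e"
              by eventually_elim (use fl[OF n] in \<open>meson less_imp_le order_trans\<close>)
          qed (use fl_c[OF Y(2)] elim(3) Ecs in auto)
          then have "limitin euclideanreal (f \<circ> (\<lambda>k. paths T N (fluctuation N (Y k) (lam (Y k))) \<omega>)) (f (paths T N E \<omega>)) sequentially"
            by (rule continuous_map_limit[OF f])
          then show ?case by (simp add: comp_def)
        qed
      qed auto
      then show "(\<lambda>k. \<integral>\<omega>. f (paths T N (fluctuation N (X k) (lam (X k))) \<omega>) \<partial>M) \<longlonglongrightarrow> (\<integral>\<omega>. f (paths T N E \<omega>) \<partial>M)"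
        by (rule Lim_transform_eventually) (use XY in \<open>auto elim!: eventually_mono\<close>)
    qed
  qed
  show ?thesis
    by (intro exI[of _ P] exI[of _ \<eta>] conjI allI impI P indep conv cov F.centered_gaussian)
qed

end
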